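(* Let $x\in D_1^+$, $\nu,\mu\in\mathbb{C}$, $2\mu\notin\mathbb{Z}$, $\nu+\mu\notin-\mathbb{N}$. Then, for the upper sign chosen everywhere as well as for the lower sign chosen everywhere, $$\mathsf{Q}_\nu^\mu(x)=\frac{\Gamma(-\mu)}{2^{\mu+1}}\frac{\Gamma(\nu+\mu+1)}{\Gamma(\nu-\mu+1)}(1-x^2)^{\frac12\mu}\big(x\pm i\sqrt{1-x^2}\big)^{\nu-\mu}{}_2F_1\!\left(\tfrac12+\mu,\mu-\nu;1+2\mu;\frac{2i\sqrt{1-x^2}}{\pm x+i\sqrt{1-x^2}}\right)$$ $$+\,2^{\mu-1}\Gamma(\mu)\frac{\cos(\pi\mu)\big(x\pm i\sqrt{1-x^2}\big)^{\nu+\mu}}{(1-x^2)^{\frac12\mu}}{}_2F_1\!\left(\tfrac12-\mu,-\nu-\mu;1-2\mu;\frac{2i\sqrt{1-x^2}}{\pm x+i\sqrt{1-x^2}}\right),$$ or equivalently, for $\operatorname{Re}\theta\in(0,\frac{\pi}{2})$, $$\mathsf{Q}_\nu^\mu(\cos\theta)=\frac{\Gamma(-\mu)}{2^{\mu+1}}\frac{\Gamma(\nu+\mu+1)}{\Gamma(\nu-\mu+1)}(\sin\theta)^\mu e^{\pm i(\nu-\mu)\theta}{}_2F_1\!\left(\tfrac12+\mu,\mu-\nu;1+2\mu;1-e^{\mp2i\theta}\right)$$ $$+\,2^{\mu-1}\Gamma(\mu)\frac{\cos(\pi\mu)e^{\pm i(\nu+\mu)\theta}}{(\sin\theta)^\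mu}{}_2F_1\!\left(\tfrac12-\mu,-\nu-\mu;1-2\mu;1-e^{\mp2i\theta}\right).$$
   Context: $\mathbb{N}=\{1,2,3,\dots\}$, $-\mathbb{N}=\{-1,-2,\dots\}$. $D_1=\mathbb{C}\setminus((-\infty,-1]\cup[1,\infty))$, $D_1^+=D_1\cap\{x:\operatorname{Re}x>0\}$, $D_2=\mathbb{C}\setminus(-\infty,1]$. Complex powers and roots are principal values. ${}_2F_1(a,b;c;w)$ is the Gauss hypergeometric function, principal branch on $\mathbb{C}\setminus[1,\infty)$ (the analytic continuation of $\sum_{n\ge0}\frac{(a)_n(b)_n}{(c)_n}\frac{w^n}{n!}$). $1/\Gamma$ is read as the entire function (zero at the poles of $\Gamma$), and a quotient ${}_2F_1(a,b;c;w)/\Gamma(c)$ with $c\in\{0,-1,-2,\dots\}$ is read as the regularized function (continuous in $c$). Associated Legendre function of the second kind: for $z\in D_2$, $\nu+\mu\in\mathbb{C}\setminus-\mathbb{N}$, $$Q_\nu^\mu(z)=\frac{\sqrt{\pi}\,e^{i\pi\mu}\Gamma(\nu+\mu+1)(z^2-1)^{\frac12\mu}}{2^{\nu+1}\Gamma(\nu+\frac32)z^{\nu+\mu+1}}\,{}_2F_1\!\left(\tfrac{\nu+\mu+2}{2},\tfrac{\nu+\mu+1}{2};\nu+\tfrac32;\tfrac1{z^2}\right),$$ where $(z^2-1)^\alpha:=(z+1)^\alpha(z-1)^\alpha$. Ferrers function of the second kind: for $x\in(-1,1)$, $$\mathsf{Q}_\nu^\mu(x)=\tfrac12\big[e^{-\frac12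 i\pi\mu}\,e^{-i\pi\mu}Q_\nu^\mu(x+i0)+e^{\frac12 i\pi\mu}\,e^{-i\pi\mu}Q_\nu^\mu(x-i0)\big],$$ where $x\pm i0$ denotes the limit from the upper/lower half-plane, and $\mathsf{Q}_\nu^\mu$ is extended analytically to $D_1$. *)

theory Defs
  imports "HOL-Complex_Analysis.Complex_Analysis"
begin

definition cut_plane :: "complex set" where
  "cut_plane = - complex_of_real ` {1..}"

text \<open>
  The analytic continuation to \<open>cut_plane\<close> of the sum of a power series on the open unit disc.
  By the identity theorem it is unique on \<open>cut_plane\<close> if it exists; it is unspecified on the cut.
\<close>

definition continue_fps :: "complex fps \<Rightarrow> complex \<Rightarrow> complex" where
  "continue_fps S =
     (SOME F. F holomorphic_on cut_plane \<and> (\<forall>w\<in>ball 0 1. F w = eval_fps S w))"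

text \<open>The Gauss function; only meaningful for \<open>c \<notin> \<int>\<^sub>\<le>\<^sub>0\<close>.\<close>

definition hyp2F1 :: "complex \<Rightarrow> complex \<Rightarrow> complex \<Rightarrow> complex \<Rightarrow> complex" where
  "hyp2F1 a b c = continue_fps (fps_hypergeo [a, b] [c] 1)"

text \<open>
  The regularized Gauss function, i.e. the quotient of \<open>hyp2F1 a b c w\<close> by \<open>Gamma c\<close>, for
  arbitrary \<open>c\<close>. Its series is that of \<open>hyp2F1\<close> with \<open>1 / (Gamma c * pochhammer c n)\<close> read as
  \<open>rGamma (c + n)\<close>, which is entire in \<open>c\<close>; see \<open>fps_hyp2F1_reg_eq\<close>.
\<close>

definition fps_hyp2F1_reg :: "complex \<Rightarrow> complex \<Rightarrow> complex \<Rightarrow> complex fps" where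
  "fps_hyp2F1_reg a b c =
     Abs_fps (\<lambda>n. pochhammer a n * pochhammer b n * rGamma (c + of_nat n) / fact n)"

definition hyp2F1_reg :: "complex \<Rightarrow> complex \<Rightarrow> complex \<Rightarrow> complex \<Rightarrow> complex" where
  "hyp2F1_reg a b c = continue_fps (fps_hyp2F1_reg a b c)"

lemma fps_hyp2F1_reg_eq:
  assumes "c \<notin> \<int>\<^sub>\<le>\<^sub>0"
  shows "fps_hyp2F1_reg a b c = fps_const (1 / Gamma c) * fps_hypergeo [a, b] [c] 1"
proof (rule fps_ext)
  fix n
  have "pochhammer c n * rGamma (c + of_nat n) = rGamma c"
    by (rule pochhammer_rGamma [symmetric])
  moreover have "pochhammer c n \<noteq> 0"
    using assms by (auto simp: pochhammer_eq_0_iff)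
  ultimately have *: "rGamma (c + of_nat n) = rGamma c / pochhammer c n"
    by (simp add: field_simps)
  have "1 / Gamma c = rGamma c"
    by (simp add: rGamma_inverse_Gamma inverse_eq_divide)
  then show "fps_hyp2F1_reg a b c $ n = (fps_const (1 / Gamma c) * fps_hypergeo [a, b] [c] 1) $ n"
    unfolding fps_hyp2F1_reg_def by (simp add: * del: rGamma_inverse_Gamma)
qed

text \<open>
  The associated Legendre function of the second kind, for \<open>z\<close> in the plane cut along
  \<open>(-\<infinity>, 1]\<close> and \<open>\<nu> + \<mu>\<close> not a negative integer. The factor \<open>1 / Gamma (\<nu> + 3/2)\<close> is
  contained in \<open>hyp2F1_reg\<close>.
\<close>

definition legendreQ :: "complex \<Rightarrow> complex \<Rightarrow> complex \<Rightarrow> complex" where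
  "legendreQ \<nu> \<mu> z =
     of_real (sqrt pi) * exp (\<i> * of_real pi * \<mu>) * Gamma (\<nu> + \<mu> + 1)
       * ((z + 1) powr (\<mu> / 2) * (z - 1) powr (\<mu> / 2))
       / (2 powr (\<nu> + 1) * z powr (\<nu> + \<mu> + 1))
       * hyp2F1_reg ((\<nu> + \<mu> + 2) / 2) ((\<nu> + \<mu> + 1) / 2) (\<nu> + 3 / 2) (1 / z\<^sup>2)"

definition upper_limit :: "(complex \<Rightarrow> complex) \<Rightarrow> real \<Rightarrow> complex" where
  "upper_limit f x = Lim (at (complex_of_real x) within {z. Im z > 0}) f"

definition lower_limit :: "(complex \<Rightarrow> complex) \<Rightarrow> real \<Rightarrow> complex" where
  "lower_limit f x = Lim (at (complex_of_real x) within {z. Im z < 0}) f"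

definition D1 :: "complex set" where
  "D1 = - complex_of_real ` ({..-1} \<union> {1..})"

definition D1_pos :: "complex set" where
  "D1_pos = D1 \<inter> {x. Re x > 0}"

definition ferrersQ_real :: "complex \<Rightarrow> complex \<Rightarrow> real \<Rightarrow> complex" where
  "ferrersQ_real \<nu> \<mu> x =
     1 / 2 *
       (exp (- (1 / 2) * \<i> * of_real pi * \<mu>) * exp (- \<i> * of_real pi * \<mu>)
          * upper_limit (legendreQ \<nu> \<mu>) x
        + exp (1 / 2 * \<i> * of_real pi * \<mu>) * exp (- \<i> * of_real pi * \<mu>)
          * lower_limit (legendreQ \<nu> \<mu>) x)"

text \<open>The Ferrers function of the second kind on \<open>D1\<close>; the extension is unique on \<open>D1\<close>.\<close>

definition ferrersQ :: "complex \<Rightarrow> complex \<Rightarrow> complex \<Rightarrow> complex" where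
  "ferrersQ \<nu> \<mu> =
     (SOME F. F holomorphic_on D1 \<and>
        (\<forall>x\<in>{-1<..<1}. F (complex_of_real x) = ferrersQ_real \<nu> \<mu> x))"

end

theory Submission
  imports Defs
begin

text \<open>
  The regularized Gauss function continues to the cut plane because \<open>w = 4u / (1 + u)\<^sup>2\<close> maps the
  unit disc conformally onto it and pulls the hypergeometric equation back to an equation whose only
  singularity in the disc is a regular one at \<open>0\<close>; the pulled back power series therefore converges
  in the whole disc. Pfaff's transformation and the quadratic transformation of \<open>F(a, a + 1/2; c)\<close>
  are instances of the Chu--Vandermonde sum.

  With \<open>z = cos \<theta>\<close> the quadratic transformation turns \<open>legendreQ \<nu> \<mu> z\<close> into a multiple of
  \<open>exp (\<mp> i \<theta> (\<nu> + \<mu> + 1)) F(\<nu> + \<mu> + 1, \<mu> + 1/2; \<nu> + 3/2; exp (\<mp> 2 i \<theta>))\<close>, which is analytic across the interval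
  \<open>(-1, 1)\<close>. The connection formula between \<open>0\<close> and \<open>1\<close> splits it into two solutions in
  \<open>1 - exp (\<mp> 2 i \<theta>)\<close>. By Pfaff's transformation each of these, with its exponential prefactor, is even in
  \<open>\<theta>\<close>, so the two boundary values can be added term by term.

  For the connection formula, the existence of coefficients follows from the Wronskians. The operator
  \<open>u d/du + c\<close> lowers \<open>c + 1\<close> to \<open>c\<close> in all three solutions, which yields a recurrence for the first
  coefficient; its value follows from \<open>F(a, b; c + n; 1) \<longlonglongrightarrow> 1\<close>. Euler's transformation exchanges the
  two coefficients.
\<close>

text \<open>Three constraints shape the proof. With a = nu + mu + 1, b = mu + 1/2, c = nu + 3/2 one
  has c - a - b = -2 mu, so \<open>2 * \<mu> \<notin> \<int>\<close> makes the two local solutions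
  at 1 independent. The parameter nu + 3/2 may be a nonpositive integer; hence everything is proved
  for the regularized function with \<open>rGamma\<close>, and Gamma factors are restored at the
  end. Finally, Re theta < pi/2 keeps exp (-2 i s theta) off the negative axis, so that Pfaff's
  transformation and the powers of 1 - exp (-2 i s theta) can be computed with principal logarithms;
  the boundary values themselves live on the whole strip 0 < Re theta < pi.

  Two independent signs occur, s for the half-plane of the boundary value and s' for the sign chosen
  in the formula. Evenness in theta decouples them: all that remains of s is a factor exp (-i s pi
  mu) in the second term, and averaging it over s gives the cosine.

  The continuations are defined by a choice operator, so each of them needs an explicit candidate
  before anything can be said about it.\<close>

unbundle no vec_syntax

section \<open>Power series solutions at a regular singular point\<close>

text \<open>Comparing coefficients expresses (n + 1) (n + P_0) g_(n+1) by g_0, ..., g_n. The factor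
  n + 1 absorbs the one in the derivative, and n + P_0 tends to infinity, so at a radius s < R the
  partial sums of |g_n| s^n eventually grow by at most a prescribed factor q > 1 per step. The
  series \<open>g\<close> is given, so an index with n + P_0 = 0 does no harm: the estimate is used
  for large n.\<close>

lemma fps_conv_radius_regular_singular:
  fixes P Q g :: "complex fps"
  assumes ode: "fps_X * fps_deriv (fps_deriv g) + P * fps_deriv g + Q * g = 0"
    and P: "R \<le> fps_conv_radius P" and Q: "R \<le> fps_conv_radius Q"
  shows "R \<le> fps_conv_radius g"
  unfolding fps_conv_radius_def
proof (rule conv_radius_geI_ex')
  fix r :: real assume r: "0 < r" "ereal r < R"
  \<comment> \<open>Strictly between \<open>r\<close> and \<open>R\<close>: coefficients are bounded
    at radius \<open>s\<close>, and the ratio \<open>r / s\<close> pays for the growth factor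
    \<open>q\<close>.\<close>
  obtain s where s: "r < s" "ereal s < R"
    using r(2) by (metis ereal_dense2 less_ereal.simps(1))
  have s0: "s > 0" using r s by simp
  have bdd: "\<exists>M. \<forall>n. norm (F $ n) * s ^ n \<le> M" if "R \<le> fps_conv_radius F" for F :: "complex fps"
  proof -
    have "summable (\<lambda>n. norm (F $ n * of_real s ^ n))"
      using that s s0 by (intro norm_summable_fps) (auto intro: less_le_trans)
    then have "Bseq (\<lambda>n. norm (F $ n * of_real s ^ n))"
      by (intro convergent_imp_Bseq) (auto dest: summable_LIMSEQ_zero simp: convergent_def)
    then show ?thesis
      using s0 by (auto simp: Bseq_def norm_mult norm_power)
  qed
  obtain M1 where M1: "\<And>n. norm (P $ n) * s ^ n \<le> M1" using bdd[OF P] by auto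
  obtain M2 where M2: "\<And>n. norm (Q $ n) * s ^ n \<le> M2" using bdd[OF Q] by auto
  define M where "M = max M1 M2"
  have MP: "norm (P $ n) * s ^ n \<le> M" and MQ: "norm (Q $ n) * s ^ n \<le> M" for n
    using M1[of n] M2[of n] by (auto simp: M_def)
  have M0: "M \<ge> 0" using order_trans[OF norm_ge_zero[of "P $ 0"], of M] MP[of 0] by simp
  define D where "D = (\<lambda>n. norm (g $ n) * s ^ n)"
  define S where "S = (\<lambda>n. \<Sum>k\<le>n. D k)"
  have D0: "D n \<ge> 0" for n using s0 by (simp add: D_def)
  have DS: "D k \<le> S n" if "k \<le> n" for k n
    unfolding S_def using that D0 by (intro member_le_sum) auto
  have S0: "S n \<ge> 0" for n unfolding S_def by (intro sum_nonneg D0)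
  define K where "K = M * (1 + s) + 1"
  have conv: "(F * G) $ n = (\<Sum>k\<le>n. F $ (n - k) * G $ k)" for F G :: "complex fps" and n
    unfolding mult.commute[of F G] fps_mult_nth atMost_atLeast0
    by (intro sum.cong) (auto simp: mult_ac)
  have step: "norm (of_nat n + P $ 0) * D (Suc n) \<le> K * S n" for n
  proof -
    have "(fps_X * fps_deriv (fps_deriv g) + P * fps_deriv g + Q * g) $ n = 0"
      by (simp add: ode)
    moreover have "(fps_X * fps_deriv (fps_deriv g)) $ n = of_nat n * (of_nat (Suc n) * g $ Suc n)"
      by (cases n) auto
    moreover have "(P * fps_deriv g) $ n = (\<Sum>k\<le>n. P $ (n - k) * (of_nat (Suc k) * g $ Suc k))"
      by (simp add: conv)
    moreover have "(Q * g) $ n = (\<Sum>k\<le>n. Q $ (n - k) * g $ k)"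
      by (rule conv)
    moreover have "(\<Sum>k\<le>n. P $ (n - k) * (of_nat (Suc k) * g $ Suc k)) =
        (\<Sum>k<n. P $ (n - k) * (of_nat (Suc k) * g $ Suc k)) + P $ 0 * (of_nat (Suc n) * g $ Suc n)"
      by (simp flip: lessThan_Suc_atMost)
    ultimately have eq: "of_nat (Suc n) * ((of_nat n + P $ 0) * g $ Suc n) =
        - ((\<Sum>k<n. P $ (n - k) * (of_nat (Suc k) * g $ Suc k)) + (\<Sum>k\<le>n. Q $ (n - k) * g $ k))"
      by (simp add: algebra_simps add_eq_0_iff2)
    have b1: "norm (\<Sum>k<n. P $ (n - k) * (of_nat (Suc k) * g $ Suc k)) * s ^ Suc n
        \<le> of_nat (Suc n) * M * S n"
    proof -
      have "norm (\<Sum>k<n. P $ (n - k) * (of_nat (Suc k) * g $ Suc k)) * s ^ Suc n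
         \<le> (\<Sum>k<n. norm (P $ (n - k) * (of_nat (Suc k) * g $ Suc k))) * s ^ Suc n"
        using s0 by (intro mult_right_mono norm_sum) auto
      also have "\<dots> = (\<Sum>k<n. (norm (P $ (n - k)) * s ^ (n - k)) * (real (Suc k) * D (Suc k)))"
        unfolding sum_distrib_right
      proof (intro sum.cong refl)
        fix k assume "k \<in> {..<n}"
        then have "s ^ Suc n = s ^ (n - k) * s ^ Suc k" by (simp flip: power_add)
        then show "norm (P $ (n - k) * (of_nat (Suc k) * g $ Suc k)) * s ^ Suc n =
          (norm (P $ (n - k)) * s ^ (n - k)) * (real (Suc k) * D (Suc k))"
          unfolding D_def norm_mult norm_of_nat by simp
      qed
      also have "\<dots> \<le> (\<Sum>k<n. M * (real (Suc n) * D (Suc k)))"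
        using D0 MP M0 s0 by (intro sum_mono mult_mono) auto
      also have "\<dots> = real (Suc n) * M * (\<Sum>k<n. D (Suc k))"
        by (simp add: sum_distrib_left mult_ac)
      also have "\<dots> \<le> real (Suc n) * M * S n"
      proof (intro mult_left_mono)
        have "S n = D 0 + (\<Sum>k<n. D (Suc k))"
          unfolding S_def by (subst lessThan_Suc_atMost [symmetric]) (rule sum.lessThan_Suc_shift)
        then show "(\<Sum>k<n. D (Suc k)) \<le> S n" using D0[of 0] by simp
      qed (use M0 in auto)
      finally show ?thesis .
    qed
    have b2: "norm (\<Sum>k\<le>n. Q $ (n - k) * g $ k) * s ^ Suc n \<le> real (Suc n) * M * s * S n"
    proof -
      have "norm (\<Sum>k\<le>n. Q $ (n - k) * g $ k) * s ^ Suc n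
         \<le> (\<Sum>k\<le>n. norm (Q $ (n - k) * g $ k)) * s ^ Suc n"
        using s0 by (intro mult_right_mono norm_sum) auto
      also have "\<dots> = (\<Sum>k\<le>n. s * ((norm (Q $ (n - k)) * s ^ (n - k)) * D k))"
        unfolding sum_distrib_right
      proof (intro sum.cong refl)
        fix k assume "k \<in> {..n}"
        then have "s ^ Suc n = s * (s ^ (n - k) * s ^ k)" by (simp flip: power_add)
        then show "norm (Q $ (n - k) * g $ k) * s ^ Suc n = s * ((norm (Q $ (n - k)) * s ^ (n - k)) * D k)"
          unfolding D_def norm_mult by simp
      qed
      also have "\<dots> \<le> (\<Sum>k\<le>n. s * (M * D k))"
        using D0 MQ M0 s0 by (intro sum_mono mult_mono) auto
      also have "\<dots> = M * s * S n"
        by (simp add: S_def sum_distrib_left mult_ac)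
      also have "\<dots> \<le> real (Suc n) * (M * s * S n)"
        using S0[of n] M0 s0 mult_right_mono[of 1 "real (Suc n)" "M * s * S n"] by simp
      finally show ?thesis by (simp add: mult_ac)
    qed
    have "real (Suc n) * (norm (of_nat n + P $ 0) * D (Suc n)) =
        norm (of_nat (Suc n) * ((of_nat n + P $ 0) * g $ Suc n)) * s ^ Suc n"
      unfolding D_def norm_mult norm_of_nat by simp
    also have "\<dots> \<le> (norm (\<Sum>k<n. P $ (n - k) * (of_nat (Suc k) * g $ Suc k)) +
          norm (\<Sum>k\<le>n. Q $ (n - k) * g $ k)) * s ^ Suc n"
      unfolding eq norm_minus_cancel using s0 by (intro mult_right_mono norm_triangle_ineq) auto
    also have "\<dots> \<le> real (Suc n) * M * S n + real (Suc n) * M * s * S n"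
      unfolding distrib_right by (intro add_mono b1 b2)
    also have "\<dots> \<le> real (Suc n) * (K * S n)"
      using S0[of n] by (simp add: K_def algebra_simps)
    finally show ?thesis by (rule mult_left_le_imp_le) simp
  qed
  \<comment> \<open>The midpoint of 1 and \<open>s / r\<close>: above 1, while
    \<open>q * r / s\<close> stays below 1 for the final geometric comparison.\<close>
  define q where "q = (1 + s / r) / 2"
  have q: "1 < q" "q * r / s < 1" "q > 0"
    using r s s0 by (auto simp: q_def field_simps)
  have K0: "K > 0" using M0 s0 by (simp add: K_def add_nonneg_pos)
  obtain N where N: "\<And>n. n \<ge> N \<Longrightarrow> K / (q - 1) \<le> norm (of_nat n + P $ 0)"
  proof -
    obtain N where N: "K / (q - 1) + norm (P $ 0) \<le> real N" using real_arch_simple by blast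
    show ?thesis
    proof (rule that[of N])
      fix n assume "n \<ge> N"
      then have "K / (q - 1) \<le> norm (of_nat n :: complex) - norm (P $ 0)" using N by simp
      also have "\<dots> \<le> norm (of_nat n + P $ 0)" by (metis diff_minus_eq_add norm_minus_cancel norm_triangle_ineq2)
      finally show "K / (q - 1) \<le> norm (of_nat n + P $ 0)" .
    qed
  qed
  have grow: "S (Suc n) \<le> q * S n" if "n \<ge> N" for n
  proof -
    have "(K / (q - 1)) * D (Suc n) \<le> norm (of_nat n + P $ 0) * D (Suc n)"
      using N[OF that] D0 by (intro mult_right_mono) auto
    also note step[of n]
    finally have *: "K * D (Suc n) \<le> K * ((q - 1) * S n)" using q by (simp add: field_simps)
    with K0 have "D (Suc n) \<le> (q - 1) * S n" by simp
    then show ?thesis by (simp add: S_def algebra_simps)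
  qed
  have SN: "S (N + m) \<le> q ^ m * S N" for m
  proof (induction m)
    case (Suc m)
    have "S (N + Suc m) \<le> q * S (N + m)" using grow[of "N + m"] by simp
    also have "\<dots> \<le> q * (q ^ m * S N)" using Suc q by (intro mult_left_mono) auto
    finally show ?case by (simp add: mult_ac)
  qed auto
  show "summable (\<lambda>n. g $ n * of_real r ^ n)"
  proof (subst summable_iff_shift [symmetric, of _ N], rule summable_comparison_test')
    show "summable (\<lambda>m. (S N * (r / s) ^ N) * (q * r / s) ^ m)"
      using q r s0 by (intro summable_mult summable_geometric) auto
    fix m :: nat
    have "norm (g $ (m + N) * of_real r ^ (m + N)) = D (m + N) * (r / s) ^ (m + N)"
      using r s0 by (simp add: D_def norm_mult norm_power power_divide)
    also have "\<dots> \<le> (q ^ m * S N) * (r / s) ^ (m + N)"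
      using DS[of "m + N" "m + N"] SN[of m] r s0 by (intro mult_right_mono) (auto simp: add.commute)
    also have "\<dots> = (S N * (r / s) ^ N) * (q * r / s) ^ m"
      by (simp add: power_add power_mult_distrib power_divide mult_ac)
    finally show "norm (g $ (m + N) * of_real r ^ (m + N)) \<le> (S N * (r / s) ^ N) * (q * r / s) ^ m" .
  qed
qed

section \<open>Lower bounds for radii of convergence\<close>

lemma fps_conv_radius_ge_mult:
  fixes f g :: "complex fps"
  assumes "R \<le> fps_conv_radius f" "R \<le> fps_conv_radius g"
  shows "R \<le> fps_conv_radius (f * g)"
  using assms fps_conv_radius_mult[of f g] by (meson min.boundedI order_trans)

lemma fps_conv_radius_ge_add:
  fixes f g :: "complex fps"
  assumes "R \<le> fps_conv_radius f" "R \<le> fps_conv_radius g"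
  shows "R \<le> fps_conv_radius (f + g)"
  using assms fps_conv_radius_add[of f g] by (meson min.boundedI order_trans)

lemma fps_conv_radius_ge_diff:
  fixes f g :: "complex fps"
  assumes "R \<le> fps_conv_radius f" "R \<le> fps_conv_radius g"
  shows "R \<le> fps_conv_radius (f - g)"
  using assms fps_conv_radius_diff[of f g] by (meson min.boundedI order_trans)

lemma fps_conv_radius_ge_power:
  fixes f :: "complex fps"
  assumes "R \<le> fps_conv_radius f"
  shows "R \<le> fps_conv_radius (f ^ n)"
  using assms fps_conv_radius_power[of f n] by (rule order_trans)

lemmas fps_conv_radius_geI = fps_conv_radius_ge_mult fps_conv_radius_ge_add
  fps_conv_radius_ge_diff fps_conv_radius_ge_power

lemma fps_conv_radius_inverse_one_plus_X: "1 \<le> fps_conv_radius (inverse (1 + fps_X :: complex fps))"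
  unfolding fps_binomial_minus_one [symmetric] fps_conv_radius_binomial by simp

lemma fps_conv_radius_inverse_one_minus_X: "1 \<le> fps_conv_radius (inverse (1 - fps_X :: complex fps))"
proof -
  have "inverse (1 - fps_X :: complex fps) = Abs_fps (\<lambda>_. 1)"
    using fps_inverse_idempotent[of "Abs_fps (\<lambda>_. 1) :: complex fps"] by (simp add: fps_inverse_gp')
  moreover have "summable (\<lambda>n. (1 :: complex) * of_real r ^ n)" if "0 < r" "ereal r < 1" for r
    using that by (auto intro!: summable_geometric)
  ultimately show ?thesis
    by (auto simp: fps_conv_radius_def intro!: conv_radius_geI_ex')
qed

section \<open>Coefficients and differential equation of the regularized series\<close>

lemma fps_hyp2F1_reg_nth:
  "fps_hyp2F1_reg a b c $ n = pochhammer a n * pochhammer b n * rGamma (c + of_nat n) / fact n"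
  by (simp add: fps_hyp2F1_reg_def)

lemma fps_hyp2F1_reg_commute: "fps_hyp2F1_reg a b c = fps_hyp2F1_reg b a c"
  by (simp add: fps_eq_iff fps_hyp2F1_reg_nth mult_ac)

text \<open>The factor c + n stays on the left because it vanishes for some n when c is a
  nonpositive integer; \<open>rGamma_plus1\<close> covers that case as well.\<close>

lemma fps_hyp2F1_reg_nth_Suc:
  "of_nat (Suc n) * (c + of_nat n) * fps_hyp2F1_reg a b c $ Suc n =
     (a + of_nat n) * (b + of_nat n) * fps_hyp2F1_reg a b c $ n"
proof -
  have 1: "rGamma (c + of_nat n) = (c + of_nat n) * rGamma (c + of_nat (Suc n))"
    using rGamma_plus1[of "c + of_nat n"] by (simp add: add_ac)
  have "of_nat (Suc n) / fact (Suc n) = (1 / fact n :: complex)"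
    by (simp add: divide_simps del: of_nat_Suc)
  moreover have "x * y * (p * q * r / f) = p * q * (y * r) * (x / f)" for x y p q r f :: complex
    by simp
  ultimately have "of_nat (Suc n) * (c + of_nat n) * fps_hyp2F1_reg a b c $ Suc n =
      pochhammer a (Suc n) * pochhammer b (Suc n) * ((c + of_nat n) * rGamma (c + of_nat (Suc n))) * (1 / fact n)"
    unfolding fps_hyp2F1_reg_nth by (simp only:)
  then show ?thesis
    unfolding 1[symmetric] fps_hyp2F1_reg_nth pochhammer_Suc by simp
qed

lemma fps_hyp2F1_reg_ode:
  fixes a b c :: complex
  defines "A \<equiv> fps_hyp2F1_reg a b c"
  shows "fps_X * (1 - fps_X) * fps_deriv (fps_deriv A) +
    (fps_const c - fps_const (a + b + 1) * fps_X) * fps_deriv A - fps_const (a * b) * A = 0"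
    (is "?L = 0")
proof (rule fps_ext)
  fix n
  have 1: "(fps_X * fps_deriv (fps_deriv A)) $ n = of_nat n * (of_nat (Suc n) * A $ Suc n)"
    by (cases n) auto
  have 2: "(fps_X * (fps_X * fps_deriv (fps_deriv A))) $ n = of_nat n * (of_nat n - 1) * A $ n"
  proof (cases n)
    case (Suc m)
    then show ?thesis
    proof (cases m)
      case (Suc k)
      then show ?thesis using \<open>n = Suc m\<close> by (simp add: algebra_simps)
    qed auto
  qed auto
  have 3: "(fps_X * fps_deriv A) $ n = of_nat n * A $ n"
    by (cases n) auto
  have "?L = fps_X * fps_deriv (fps_deriv A) - fps_X * (fps_X * fps_deriv (fps_deriv A)) +
     fps_const c * fps_deriv A - fps_const (a + b + 1) * (fps_X * fps_deriv A) - fps_const (a * b) * A"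
    by (simp add: algebra_simps)
  then have "?L $ n = of_nat n * (of_nat (Suc n) * A $ Suc n) - of_nat n * (of_nat n - 1) * A $ n +
     c * (of_nat (Suc n) * A $ Suc n) - (a + b + 1) * (of_nat n * A $ n) - a * b * A $ n"
    by (simp only: fps_sub_nth fps_add_nth fps_mult_left_const_nth 1 2 3 fps_deriv_nth) simp
  also have "\<dots> = of_nat (Suc n) * (c + of_nat n) * A $ Suc n - (a + of_nat n) * (b + of_nat n) * A $ n"
    by (simp add: algebra_simps)
  also have "\<dots> = 0" unfolding A_def fps_hyp2F1_reg_nth_Suc by simp
  finally show "?L $ n = 0 $ n" by simp
qed

text \<open>Dividing the equation by 1 - X, whose inverse has radius 1, gives the shape of
  \<open>fps_conv_radius_regular_singular\<close>. This treats all parameters alike, including those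
  with vanishing coefficients, where ratios of coefficients make no sense.\<close>

lemma fps_conv_radius_hyp2F1_reg: "1 \<le> fps_conv_radius (fps_hyp2F1_reg a b c)"
proof -
  define A where "A = fps_hyp2F1_reg a b c"
  define i where "i = inverse (1 - fps_X :: complex fps)"
  have i: "i * (1 - fps_X) = 1" unfolding i_def by (rule inverse_mult_eq_1) simp
  have "i * (fps_X * (1 - fps_X) * fps_deriv (fps_deriv A) +
    (fps_const c - fps_const (a + b + 1) * fps_X) * fps_deriv A - fps_const (a * b) * A) = 0"
    using fps_hyp2F1_reg_ode[of a b c] by (simp add: A_def)
  moreover have "i * (fps_X * (1 - fps_X) * A2 + (k - m * fps_X) * A1 - l * A) =
      (i * (1 - fps_X)) * (fps_X * A2) + (i * (k - m * fps_X)) * A1 + (- (l * i)) * A"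
    for A1 A2 k l m by (simp add: algebra_simps)
  ultimately have "fps_X * fps_deriv (fps_deriv A) +
    (i * (fps_const c - fps_const (a + b + 1) * fps_X)) * fps_deriv A + (- (fps_const (a * b) * i)) * A = 0"
    unfolding i by simp
  note ode = this
  have "1 \<le> fps_conv_radius i" unfolding i_def by (rule fps_conv_radius_inverse_one_minus_X)
  then show ?thesis unfolding A_def[symmetric]
    by (intro fps_conv_radius_regular_singular[OF ode])
       (auto intro!: fps_conv_radius_geI simp del: fps_const_add fps_const_mult)
qed

text \<open>The change of variables \<open>W = 4X / (1 + X)\<^sup>2\<close>; \<open>W1\<close>, \<open>W2\<close> are the derivatives of \<open>W\<close>, and
  \<open>A0\<close>, \<open>A1\<close>, \<open>A2\<close> those of the solution, composed with \<open>W\<close>.\<close>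

lemma hypergeo_ode_pullback:
  fixes X Y W W1 W2 A0 A1 A2 c s p :: "'a :: idom"
  assumes ode: "W * (1 - W) * A2 + (c - s * W) * A1 - p * A0 = 0"
    and Y: "Y = 1 + X" and W: "W * Y\<^sup>2 = 4 * X" and W1: "W1 * Y ^ 3 = 4 * (1 - X)"
    and W2: "W2 * Y ^ 3 = - 4 - 3 * Y\<^sup>2 * W1"
  shows "Y ^ 4 * (X * (1 - X) * Y\<^sup>2 * (A2 * W1\<^sup>2 + A1 * W2) +
    Y * (3 * X * (1 - X) + X * Y + c * Y\<^sup>2 - 4 * s * X) * (A1 * W1) - 4 * p * (1 - X) * A0) = 0"
    (is "?L = 0")
proof -
  have "?L = X * (1 - X) * (W1 * Y ^ 3)\<^sup>2 * A2 + X * (1 - X) * Y ^ 3 * (W2 * Y ^ 3) * A1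
     + Y\<^sup>2 * (3 * X * (1 - X) + X * Y + c * Y\<^sup>2 - 4 * s * X) * (W1 * Y ^ 3) * A1 - 4 * p * (1 - X) * Y ^ 4 * A0"
    by algebra
  also have "\<dots> = 4 * (1 - X) * (4 * X * (1 - X)\<^sup>2 * A2 + Y\<^sup>2 * (c * Y\<^sup>2 - 4 * s * X) * A1 - p * Y ^ 4 * A0)
      + X * (1 - X) * (- 4 * Y ^ 3 - 12 * Y\<^sup>2 * (1 - X)) * A1 + Y\<^sup>2 * (3 * X * (1 - X) + X * Y) * (4 * (1 - X)) * A1"
  proof -
    have "Y ^ 3 * (W2 * Y ^ 3) = - 4 * Y ^ 3 - 3 * Y\<^sup>2 * (W1 * Y ^ 3)"
      unfolding W2 by (simp add: algebra_simps)
    also have "\<dots> = - 4 * Y ^ 3 - 12 * Y\<^sup>2 * (1 - X)" unfolding W1 by (simp add: algebra_simps)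
    finally have "X * (1 - X) * Y ^ 3 * (W2 * Y ^ 3) * A1 = X * (1 - X) * (- 4 * Y ^ 3 - 12 * Y\<^sup>2 * (1 - X)) * A1"
      by (simp only: mult.assoc)
    then show ?thesis unfolding W1 by (simp add: algebra_simps power2_eq_square)
  qed
  \<comment> \<open>The last two summands cancel: they are minus and plus 4 X (1 - X) Y^2 (3 (1 - X)
    + Y) A1.\<close>
  also have "\<dots> = 4 * (1 - X) * (4 * X * (1 - X)\<^sup>2 * A2 + Y\<^sup>2 * (c * Y\<^sup>2 - 4 * s * X) * A1 - p * Y ^ 4 * A0)"
    unfolding Y by algebra
  also have "4 * X * (1 - X)\<^sup>2 * A2 + Y\<^sup>2 * (c * Y\<^sup>2 - 4 * s * X) * A1 - p * Y ^ 4 * A0 =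
      (W * Y\<^sup>2) * (Y\<^sup>2 - W * Y\<^sup>2) * A2 + Y\<^sup>2 * (c * Y\<^sup>2 - s * (W * Y\<^sup>2)) * A1 - p * Y ^ 4 * A0"
    unfolding W unfolding Y by algebra
  also have "\<dots> = Y ^ 4 * (W * (1 - W) * A2 + (c - s * W) * A1 - p * A0)"
    by algebra
  finally show ?thesis by (simp add: ode)
qed

section \<open>Analytic continuation of the Gauss function\<close>

lemma holomorphic_eq_of_eventually_eq:
  fixes f g :: "complex \<Rightarrow> complex"
  assumes "eventually (\<lambda>z. f z = g z) (nhds z0)" "f holomorphic_on A" "g holomorphic_on A"
    and A: "open A" "connected A" "z0 \<in> A" and "z \<in> A"
  shows "f z = g z"
proof -
  obtain B where B: "open B" "z0 \<in> B" "\<And>z. z \<in> B \<Longrightarrow> f z = g z"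
    using assms(1) by (auto simp: eventually_nhds)
  show ?thesis
    by (rule analytic_continuation_open[of "A \<inter> B" A]) (use assms B in auto)
qed

section \<open>Geometry of the cut plane\<close>

lemma mem_cut_plane_iff: "w \<in> cut_plane \<longleftrightarrow> 1 - w \<notin> \<real>\<^sub>\<le>\<^sub>0"
  by (auto simp: cut_plane_def complex_nonpos_Reals_iff complex_eq_iff)

lemma open_cut_plane: "open cut_plane"
proof -
  have "cut_plane = (\<lambda>w. 1 - w) -` (- \<real>\<^sub>\<le>\<^sub>0)"
    by (auto simp: mem_cut_plane_iff)
  also have "open \<dots>" by (intro open_vimage continuous_intros) auto
  finally show ?thesis .
qed

lemma ball_subset_cut_plane: "ball 0 1 \<subseteq> cut_plane"
  by (auto simp: cut_plane_def norm_complex_def)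

lemma connected_cut_plane: "connected cut_plane"
proof (rule starlike_imp_connected)
  have "closed_segment 0 w \<subseteq> cut_plane" if w: "w \<in> cut_plane" for w
  proof
    fix z assume "z \<in> closed_segment 0 w"
    then obtain u where u: "0 \<le> u" "u \<le> 1" "z = of_real u * w"
      by (auto simp: closed_segment_def scaleR_conv_of_real)
    show "z \<in> cut_plane"
    proof (rule ccontr)
      assume "z \<notin> cut_plane"
      then have z: "Im z = 0" "Re z \<ge> 1" by (auto simp: mem_cut_plane_iff complex_nonpos_Reals_iff)
      then have "u * Im w = 0" "u * Re w \<ge> 1" using u by auto
      moreover from this have "u \<noteq> 0" by auto
      ultimately have "Im w = 0" "Re w \<ge> 1"
        using u by (auto simp: mult_le_one) (smt (verit) mult_left_le_one_le zero_less_mult_iff)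
      then show False using w by (auto simp: mem_cut_plane_iff complex_nonpos_Reals_iff)
    qed
  qed
  then show "starlike cut_plane"
    unfolding starlike_def using ball_subset_cut_plane by (intro bexI[of _ 0]) auto
qed

lemma Re_csqrt_pos:
  assumes "z \<notin> \<real>\<^sub>\<le>\<^sub>0"
  shows "Re (csqrt z) > 0"
proof (rule ccontr)
  assume "\<not> ?thesis"
  then have "Re (csqrt z) = 0" using Re_csqrt[of z] by linarith
  then have "Re ((csqrt z)\<^sup>2) \<le> 0" "Im ((csqrt z)\<^sup>2) = 0"
    by (auto simp: power2_eq_square simp del: csqrt.simps)
  then show False
    using assms unfolding power2_csqrt by (simp add: complex_nonpos_Reals_iff)
qed

text \<open>The substitution is -4 k(-u) for the Koebe function k(u) = u / (1 - u)^2. It moves the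
  singular points 1 and infinity to u = 1 and u = -1 on the unit circle. The radius of the pulled
  back series \<open>g\<close> is read off from its equation, not from its coefficients.\<close>

lemma hyp2F1_reg_extends:
  "\<exists>F. F holomorphic_on cut_plane \<and> (\<forall>w\<in>ball 0 1. F w = eval_fps (fps_hyp2F1_reg a b c) w)"
proof -
  define A where "A = fps_hyp2F1_reg a b c"
  define X :: "complex fps" where "X = fps_X"
  define Y where "Y = 1 + X"
  define j where "j = inverse Y"
  have jY: "j * Y = 1" unfolding j_def Y_def X_def by (rule inverse_mult_eq_1) simp
  define i where "i = inverse (1 - X)"
  have iX: "i * (1 - X) = 1" unfolding i_def X_def by (rule inverse_mult_eq_1) simp
  define W where "W = 4 * X * j\<^sup>2"
  have W0: "W $ 0 = 0" by (simp add: W_def X_def fps_mult_nth_0)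
  define g where "g = A oo W"
  define A1 A2 where "A1 = fps_deriv A oo W" and "A2 = fps_deriv (fps_deriv A) oo W"
  define W1 W2 where "W1 = fps_deriv W" and "W2 = fps_deriv W1"
  have dY: "fps_deriv Y = 1" by (simp add: Y_def X_def)
  have dX: "fps_deriv X = 1" by (simp add: X_def)
  have g1: "fps_deriv g = A1 * W1"
    unfolding g_def A1_def W1_def by (rule fps_compose_deriv[OF W0])
  have g2: "fps_deriv (fps_deriv g) = A2 * W1\<^sup>2 + A1 * W2"
    unfolding g1 unfolding A1_def A2_def W1_def W2_def
    by (simp add: fps_compose_deriv[OF W0] power2_eq_square algebra_simps)
  have WY: "W * Y\<^sup>2 = 4 * X"
    using jY unfolding W_def by algebra
  \<comment> \<open>Differentiating W Y^2 = 4 X, rather than \<open>W\<close> itself, keeps the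
    relations for \<open>W1\<close> and \<open>W2\<close> polynomial.\<close>
  have "fps_deriv (W * Y\<^sup>2) = fps_deriv (4 * X)" by (simp only: WY)
  then have "W1 * Y\<^sup>2 + W * (2 * Y) = 4"
    unfolding W1_def by (simp add: dY dX power2_eq_square algebra_simps)
  then have "W1 * Y\<^sup>2 = 4 - W * (2 * Y)" by (simp add: algebra_simps)
  then have "W1 * Y ^ 3 = Y * (4 - W * (2 * Y))"
    by (simp add: power_numeral_reduce mult_ac)
  also have "\<dots> = 4 * Y - 2 * (W * Y\<^sup>2)" by (simp add: algebra_simps power2_eq_square)
  also have "\<dots> = 4 * (1 - X)" unfolding WY unfolding Y_def by (simp add: algebra_simps)
  finally have W1Y: "W1 * Y ^ 3 = 4 * (1 - X)" .
  then have "fps_deriv (W1 * Y ^ 3) = fps_deriv (4 * (1 - X))" by simp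
  then have W2Y: "W2 * Y ^ 3 = - 4 - 3 * Y\<^sup>2 * W1"
    unfolding W2_def by (simp add: dY dX power2_eq_square power3_eq_cube algebra_simps)
  have ode: "W * (1 - W) * A2 + (fps_const c - fps_const (a + b + 1) * W) * A1 - fps_const (a * b) * g = 0"
  proof -
    have "(X * (1 - X) * fps_deriv (fps_deriv A) +
      (fps_const c - fps_const (a + b + 1) * X) * fps_deriv A - fps_const (a * b) * A) oo W = 0 oo W"
      unfolding A_def X_def by (simp only: fps_hyp2F1_reg_ode)
    then show ?thesis
      unfolding A1_def A2_def g_def X_def using W0
      by (simp add: fps_compose_add_distrib fps_compose_sub_distrib fps_compose_mult_distrib
          del: fps_const_add fps_const_mult)
  qed
  have Y0: "Y \<noteq> 0" using jY by auto
  define T where "T = 3 * X * (1 - X) + X * Y + fps_const c * Y\<^sup>2 - 4 * fps_const (a + b + 1) * X"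
  have "Y ^ 4 * (X * (1 - X) * Y\<^sup>2 * fps_deriv (fps_deriv g) + Y * T * fps_deriv g
     - 4 * fps_const (a * b) * (1 - X) * g) = 0"
    unfolding T_def unfolding g2 unfolding g1 by (rule hypergeo_ode_pullback[OF ode Y_def WY W1Y W2Y])
  then have *: "X * (1 - X) * Y\<^sup>2 * fps_deriv (fps_deriv g) + Y * T * fps_deriv g
     - 4 * fps_const (a * b) * (1 - X) * g = 0"
    using Y0 by simp
  \<comment> \<open>The factor i j^2 clears 1 - X and Y^2 from the leading coefficient; both
    inverses have radius at least 1.\<close>
  have "i * j\<^sup>2 * (X * (1 - X) * Y\<^sup>2 * G2 + Y * T * G1 - 4 * p * (1 - X) * G0) =
      (i * (1 - X)) * (j * Y)\<^sup>2 * (X * G2) + (j * Y) * (i * j * T) * G1 + (i * (1 - X)) * (- 4 * p * j\<^sup>2) * G0"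
    for G0 G1 G2 p :: "complex fps"
    by (simp add: algebra_simps power2_eq_square)
  from this[of "fps_deriv (fps_deriv g)" "fps_deriv g" "fps_const (a * b)" g]
  have "X * fps_deriv (fps_deriv g) + (i * j * T) * fps_deriv g + (- 4 * fps_const (a * b) * j\<^sup>2) * g = 0"
    unfolding * jY iX by simp
  then have *: "fps_X * fps_deriv (fps_deriv g) + (i * j * T) * fps_deriv g + (- 4 * fps_const (a * b) * j\<^sup>2) * g = 0"
    by (simp add: X_def)
  have [intro]: "1 \<le> fps_conv_radius i" "1 \<le> fps_conv_radius j"
    unfolding i_def j_def Y_def X_def
    by (rule fps_conv_radius_inverse_one_minus_X fps_conv_radius_inverse_one_plus_X)+
  have [intro]: "1 \<le> fps_conv_radius X" "1 \<le> fps_conv_radius Y" by (auto simp: X_def Y_def intro!: fps_conv_radius_geI)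
  have rg: "1 \<le> fps_conv_radius g"
    by (rule fps_conv_radius_regular_singular[OF *]) 
       (auto simp: T_def intro!: fps_conv_radius_geI simp del: fps_const_add fps_const_mult)
  have "(\<lambda>u. 4 * u * (inverse (1 + u))\<^sup>2) has_fps_expansion W"
    unfolding W_def j_def Y_def X_def power2_eq_square
    by (intro fps_expansion_intros) auto
  moreover have "eval_fps A has_fps_expansion A"
    using fps_conv_radius_hyp2F1_reg[of a b c] unfolding A_def
    by (intro eval_fps_has_fps_expansion) (auto intro: less_le_trans[of 0 1])
  ultimately have "(eval_fps A \<circ> (\<lambda>u. 4 * u * (inverse (1 + u))\<^sup>2)) has_fps_expansion g"
    unfolding g_def using W0 by (intro fps_expansion_intros)
  then have ev: "\<forall>\<^sub>F u in nhds 0. eval_fps g u = eval_fps A (4 * u * (inverse (1 + u))\<^sup>2)"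
    by (simp add: has_fps_expansion_def)
  \<comment> \<open>The inverse of the substitution: a Cayley transform of
    \<open>csqrt (1 - w)\<close>, whose positive real part places the value in the unit
    disc.\<close>
  define \<phi> :: "complex \<Rightarrow> complex" where "\<phi> = (\<lambda>w. (1 - csqrt (1 - w)) / (1 + csqrt (1 - w)))"
  define F where "F = (\<lambda>w. eval_fps g (\<phi> w))"
  have Re_pos: "Re (csqrt (1 - w)) > 0" if "w \<in> cut_plane" for w
    using that by (intro Re_csqrt_pos) (simp add: mem_cut_plane_iff)
  have nz: "1 + csqrt (1 - w) \<noteq> 0" if "w \<in> cut_plane" for w
  proof
    assume "1 + csqrt (1 - w) = 0"
    then have "csqrt (1 - w) = - 1" by (simp add: eq_neg_iff_add_eq_0 add.commute)
    then show False using Re_pos[OF that] by (simp del: csqrt.simps)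
  qed
  have norm_less: "norm (\<phi> w) < 1" if "w \<in> cut_plane" for w
  proof -
    have "norm (1 - csqrt (1 - w)) < norm (1 + csqrt (1 - w))"
      using Re_pos[OF that] unfolding norm_complex_def
      by (intro real_sqrt_less_mono) (simp add: power2_eq_square algebra_simps)
    then show ?thesis using nz[OF that] by (simp add: \<phi>_def norm_divide)
  qed
  have hol_\<phi>: "\<phi> holomorphic_on cut_plane"
    unfolding \<phi>_def using nz by (intro holomorphic_intros) (auto simp: mem_cut_plane_iff)
  have hol: "F holomorphic_on cut_plane"
  proof -
    have "(eval_fps g \<circ> \<phi>) holomorphic_on cut_plane"
    proof (rule holomorphic_on_compose_gen[OF hol_\<phi>])
      show "eval_fps g holomorphic_on ball 0 1"
        using rg by (intro holomorphic_on_eval_fps) (metis ball_eball_mono one_ereal_def)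
      show "\<phi> ` cut_plane \<subseteq> ball 0 1" using norm_less by auto
    qed
    then show ?thesis by (simp add: F_def o_def)
  qed
  have "isCont \<phi> 0"
    using hol_\<phi> open_cut_plane ball_subset_cut_plane
    by (meson centre_in_ball continuous_on_eq_continuous_at holomorphic_on_imp_continuous_on subsetD zero_less_one)
  moreover have "\<phi> 0 = 0" by (simp add: \<phi>_def)
  ultimately have "filterlim \<phi> (nhds 0) (nhds 0)"
    unfolding isCont_def tendsto_at_iff_tendsto_nhds by simp
  then have "\<forall>\<^sub>F w in nhds 0. eval_fps g (\<phi> w) = eval_fps A (4 * \<phi> w * (inverse (1 + \<phi> w))\<^sup>2)"
    using ev by (auto simp: filterlim_iff)
  moreover have "\<forall>\<^sub>F w in nhds 0. w \<in> cut_plane"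
    using ball_subset_cut_plane by (intro eventually_nhds_in_open open_cut_plane) auto
  ultimately have ev2: "\<forall>\<^sub>F w in nhds 0. F w = eval_fps A w"
  proof eventually_elim
    case (elim w)
    define r where "r = csqrt (1 - w)"
    have r: "1 + r \<noteq> 0" using nz[OF elim(2)] by (simp add: r_def)
    have "r\<^sup>2 = 1 - w" by (simp add: r_def)
    have "1 + \<phi> w = 2 / (1 + r)" using r by (simp add: \<phi>_def r_def[symmetric] field_simps)
    then have "4 * \<phi> w * (inverse (1 + \<phi> w))\<^sup>2 = (1 - r) * (1 + r)"
      using r by (simp add: \<phi>_def r_def[symmetric] power2_eq_square)
    also have "\<dots> = w" using \<open>r\<^sup>2 = 1 - w\<close> by (simp add: power2_eq_square algebra_simps)
    finally show ?case using elim(1) by (simp add: F_def)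
  qed
  have "F w = eval_fps A w" if "w \<in> ball 0 1" for w
  proof (rule holomorphic_eq_of_eventually_eq[OF ev2])
    show "F holomorphic_on ball 0 1" using hol ball_subset_cut_plane by (rule holomorphic_on_subset)
    show "eval_fps A holomorphic_on ball 0 1"
      using fps_conv_radius_hyp2F1_reg[of a b c] unfolding A_def
      by (intro holomorphic_on_eval_fps) (metis ball_eball_mono one_ereal_def)
  qed (use that in auto)
  then show ?thesis using hol unfolding A_def by blast
qed

text \<open>One candidate suffices: its existence makes the choice satisfy its specification, and
  the identity theorem identifies the two on the cut plane.\<close>

lemma continue_fps_eqI:
  assumes "F holomorphic_on cut_plane" "\<And>w. w \<in> ball 0 1 \<Longrightarrow> F w = eval_fps S w" "w \<in> cut_plane"
  shows "continue_fps S w = F w"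
proof -
  have "continue_fps S holomorphic_on cut_plane \<and> (\<forall>w\<in>ball 0 1. continue_fps S w = eval_fps S w)"
    unfolding continue_fps_def
    by (rule someI_ex[where P = "\<lambda>F. F holomorphic_on cut_plane \<and> (\<forall>w\<in>ball 0 1. F w = eval_fps S w)"])
       (rule exI[of _ F], use assms in auto)
  note * = this
  show ?thesis
    by (rule analytic_continuation_open[of "ball 0 1" cut_plane])
       (use * assms ball_subset_cut_plane open_cut_plane connected_cut_plane in simp_all)
qed

lemma holomorphic_hyp2F1_reg: "hyp2F1_reg a b c holomorphic_on cut_plane"
  and hyp2F1_reg_eq_eval_fps: "w \<in> ball 0 1 \<Longrightarrow> hyp2F1_reg a b c w = eval_fps (fps_hyp2F1_reg a b c) w"
proof -
  have "hyp2F1_reg a b c holomorphic_on cut_plane \<and>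
      (\<forall>w\<in>ball 0 1. hyp2F1_reg a b c w = eval_fps (fps_hyp2F1_reg a b c) w)"
    unfolding hyp2F1_reg_def continue_fps_def by (rule someI_ex[OF hyp2F1_reg_extends])
  then show "hyp2F1_reg a b c holomorphic_on cut_plane"
    "w \<in> ball 0 1 \<Longrightarrow> hyp2F1_reg a b c w = eval_fps (fps_hyp2F1_reg a b c) w" by auto
qed

lemma hyp2F1_reg_commute: "hyp2F1_reg a b c = hyp2F1_reg b a c"
  by (simp add: hyp2F1_reg_def fps_hyp2F1_reg_commute)

text \<open>The rescaled regularized function is the candidate that shows the choice in
  \<open>hyp2F1\<close> to be meaningful.\<close>

lemma hyp2F1_eq_Gamma_mult_reg:
  assumes c: "c \<notin> \<int>\<^sub>\<le>\<^sub>0" and w: "w \<in> cut_plane"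
  shows "hyp2F1 a b c w = Gamma c * hyp2F1_reg a b c w"
  unfolding hyp2F1_def
proof (rule continue_fps_eqI[OF _ _ w])
  show "(\<lambda>w. Gamma c * hyp2F1_reg a b c w) holomorphic_on cut_plane"
    by (intro holomorphic_intros holomorphic_hyp2F1_reg)
  fix z :: complex assume z: "z \<in> ball 0 1"
  have "fps_hypergeo [a, b] [c] 1 = fps_const (Gamma c) * fps_hyp2F1_reg a b c"
    using c by (simp add: fps_hyp2F1_reg_eq mult.assoc [symmetric] Gamma_eq_zero_iff)
  moreover have "ereal (norm z) < fps_conv_radius (fps_hyp2F1_reg a b c)"
    using z fps_conv_radius_hyp2F1_reg[of a b c]
    by (metis dist_0_norm ereal_less(3) less_le_trans mem_ball)
  ultimately show "Gamma c * hyp2F1_reg a b c z = eval_fps (fps_hypergeo [a, b] [c] 1) z"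
    using z by (simp add: hyp2F1_reg_eq_eval_fps eval_fps_mult)
qed

section \<open>The Pfaff and quadratic transformations\<close>

text \<open>Pascal's rule, arranged so that an induction on n acts on the summand alone.\<close>

lemma sum_binomial_Suc:
  fixes x :: "nat \<Rightarrow> 'a :: comm_ring_1"
  shows "(\<Sum>k\<le>Suc n. of_nat (Suc n choose k) * x k) = (\<Sum>k\<le>n. of_nat (n choose k) * (x k + x (Suc k)))"
proof -
  have "(\<Sum>k\<le>Suc n. of_nat (Suc n choose k) * x k) =
      x 0 + (\<Sum>k\<le>n. of_nat (Suc n choose Suc k) * x (Suc k))"
    by (subst sum.atMost_Suc_shift) simp
  also have "\<dots> = (x 0 + (\<Sum>k\<le>n. of_nat (n choose Suc k) * x (Suc k))) + (\<Sum>k\<le>n. of_nat (n choose k) * x (Suc k))"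
    by (simp add: sum.distrib algebra_simps)
  also have "x 0 + (\<Sum>k\<le>n. of_nat (n choose Suc k) * x (Suc k)) = (\<Sum>k\<le>Suc n. of_nat (n choose k) * x k)"
    by (subst sum.atMost_Suc_shift) simp
  also have "\<dots> = (\<Sum>k\<le>n. of_nat (n choose k) * x k)" by (simp add: binomial_eq_0)
  finally show ?thesis by (simp add: sum.distrib algebra_simps)
qed

text \<open>Regularized form of F(-n, B; c; 1) = (c - B)_n / (c)_n, valid for every c. In the
  induction the shifted sum has parameters B + 1 and c + 1; their difference is unchanged, so both
  sums share the factor (c - B)_n.\<close>

lemma Chu_Vandermonde_rGamma:
  fixes B c :: complex
  shows "(\<Sum>k\<le>n. of_nat (n choose k) * ((-1) ^ k * pochhammer B k * rGamma (c + of_nat k))) =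
     pochhammer (c - B) n * rGamma (c + of_nat n)"
proof (induction n arbitrary: B c)
  case (Suc n)
  have "(\<Sum>k\<le>Suc n. of_nat (Suc n choose k) * ((-1) ^ k * pochhammer B k * rGamma (c + of_nat k))) =
     (\<Sum>k\<le>n. of_nat (n choose k) * ((-1) ^ k * pochhammer B k * rGamma (c + of_nat k))) -
     B * (\<Sum>k\<le>n. of_nat (n choose k) * ((-1) ^ k * pochhammer (B + 1) k * rGamma ((c + 1) + of_nat k)))"
    unfolding sum_binomial_Suc
    by (simp add: sum_distrib_left pochhammer_rec algebra_simps sum_subtractf sum.distrib)
  also have "\<dots> = pochhammer (c - B) n * (rGamma (c + of_nat n) - B * rGamma (c + of_nat (Suc n)))"
    unfolding Suc.IH by (simp add: algebra_simps)
  also have "rGamma (c + of_nat n) = (c + of_nat n) * rGamma (c + of_nat (Suc n))"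
    using rGamma_plus1[of "c + of_nat n"] by (simp add: add_ac)
  finally show ?case by (simp add: pochhammer_Suc algebra_simps)
qed simp

text \<open>The binomial series of \<open>(1 - e * u) powr - d\<close>, with coefficients in the form
  in which they enter \<open>Chu_Vandermonde_rGamma\<close>.\<close>

definition fps_negpow :: "complex \<Rightarrow> complex \<Rightarrow> complex fps" where
  "fps_negpow e d = Abs_fps (\<lambda>n. e ^ n * pochhammer d n / fact n)"

lemma fps_negpow_nth: "fps_negpow e d $ n = e ^ n * pochhammer d n / fact n"
  by (simp add: fps_negpow_def)

lemma fps_negpow_conv_binomial: "fps_negpow e d = fps_binomial (- d) oo (fps_const (- e) * fps_X)"
  by (simp add: fps_compose_linear fps_eq_iff fps_negpow_nth gbinomial_pochhammer
      power_mult_distrib [symmetric] flip: times_divide_eq_right mult.assoc)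

lemma fps_negpow_add: "fps_negpow e (d + d') = fps_negpow e d * fps_negpow e d'"
  using fps_binomial_add_mult[of "- d" "- d'"]
  by (simp add: fps_negpow_conv_binomial fps_compose_mult_distrib)

lemma fps_negpow_power: "fps_negpow e d ^ n = fps_negpow e (of_nat n * d)"
proof (induction n)
  case 0
  show ?case by (simp add: fps_negpow_conv_binomial)
qed (simp_all add: fps_negpow_add algebra_simps)

lemma has_fps_expansion_negpow: "(\<lambda>u. (1 - e * u) powr (- d)) has_fps_expansion fps_negpow e d"
proof -
  have "((\<lambda>x. (1 + x) powr (- d)) \<circ> (\<lambda>u. (- e) * u)) has_fps_expansion fps_negpow e d"
    unfolding fps_negpow_conv_binomial by (intro fps_expansion_intros) auto
  then show ?thesis by (simp add: o_def)
qed

text \<open>Powers of k X (1 - e X)^(-m) are again monomials times binomial series, so the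
  coefficient of the composition collapses to a single sum, the form needed for
  Chu--Vandermonde.\<close>

lemma fps_compose_negpow_nth:
  "((A oo (fps_const \<kappa> * fps_X * fps_negpow e m)) * fps_negpow e d) $ n =
     (\<Sum>k\<le>n. A $ k * \<kappa> ^ k * fps_negpow e (d + of_nat k * m) $ (n - k))"
proof -
  define W where "W = fps_const \<kappa> * fps_X * fps_negpow e m"
  have W0: "W $ 0 = 0" by (simp add: W_def fps_mult_nth_0)
  have WV: "W ^ k * fps_negpow e d = fps_X ^ k * (fps_const (\<kappa> ^ k) * fps_negpow e (d + of_nat k * m))" for k
    by (simp add: W_def power_mult_distrib fps_negpow_power fps_negpow_add fps_const_power mult_ac)
  have "((A oo W) * fps_negpow e d) $ n = (\<Sum>i\<le>n. (A oo W) $ i * fps_negpow e d $ (n - i))"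
    by (simp add: fps_mult_nth atMost_atLeast0)
  also have "\<dots> = (\<Sum>i\<le>n. \<Sum>k\<le>n. A $ k * (W ^ k $ i * fps_negpow e d $ (n - i)))"
  proof (intro sum.cong refl)
    fix i assume i: "i \<in> {..n}"
    have "(A oo W) $ i = (\<Sum>k\<le>i. A $ k * W ^ k $ i)" by (simp add: fps_compose_nth atMost_atLeast0)
    \<comment> \<open>The added terms vanish because W^k has no coefficient below index k; a common
      range allows the exchange of the two sums.\<close>
    also have "\<dots> = (\<Sum>k\<le>n. A $ k * W ^ k $ i)"
      using i startsby_zero_power_prefix[OF W0] by (intro sum.mono_neutral_left) auto
    finally show "(A oo W) $ i * fps_negpow e d $ (n - i) = (\<Sum>k\<le>n. A $ k * (W ^ k $ i * fps_negpow e d $ (n - i)))"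
      by (simp add: sum_distrib_right mult.assoc)
  qed
  also have "\<dots> = (\<Sum>k\<le>n. A $ k * (W ^ k * fps_negpow e d) $ n)"
    by (subst sum.swap) (simp add: fps_mult_nth atMost_atLeast0 sum_distrib_left)
  also have "\<dots> = (\<Sum>k\<le>n. A $ k * \<kappa> ^ k * fps_negpow e (d + of_nat k * m) $ (n - k))"
    by (intro sum.cong refl) (simp add: WV fps_X_power_mult_nth)
  finally show ?thesis by (simp add: W_def)
qed

lemma choose_fact_div:
  assumes "k \<le> n"
  shows "of_nat (n choose k) / fact n = (1 / (fact k * fact (n - k)) :: complex)"
  using assms by (simp add: binomial_fact)

text \<open>Since (b)_k (b + k)_(n-k) = (b)_n, this factor leaves the sum, and what remains is
  Chu--Vandermonde with B = c - a.\<close>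

lemma fps_hyp2F1_reg_Pfaff:
  "(fps_hyp2F1_reg (c - a) b c oo (fps_const (- 1) * fps_X * fps_negpow 1 1)) * fps_negpow 1 b =
     fps_hyp2F1_reg a b c" (is "?L = _")
proof (rule fps_ext)
  fix n
  have "?L $ n = (\<Sum>k\<le>n. fps_hyp2F1_reg (c - a) b c $ k * (- 1) ^ k * fps_negpow 1 (b + of_nat k * 1) $ (n - k))"
    by (rule fps_compose_negpow_nth)
  also have "\<dots> = pochhammer b n / fact n *
     (\<Sum>k\<le>n. of_nat (n choose k) * ((-1) ^ k * pochhammer (c - a) k * rGamma (c + of_nat k)))"
    unfolding sum_distrib_left
  proof (intro sum.cong refl)
    fix k assume "k \<in> {..n}"
    then have k: "k \<le> n" by simp
    have "pochhammer b n / fact n * (of_nat (n choose k) * ((-1) ^ k * pochhammer (c - a) k * rGamma (c + of_nat k)))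
        = pochhammer b n * (of_nat (n choose k) / fact n) * ((-1) ^ k * pochhammer (c - a) k * rGamma (c + of_nat k))"
      by simp
    then show "fps_hyp2F1_reg (c - a) b c $ k * (- 1) ^ k * fps_negpow 1 (b + of_nat k * 1) $ (n - k) =
      pochhammer b n / fact n * (of_nat (n choose k) * ((-1) ^ k * pochhammer (c - a) k * rGamma (c + of_nat k)))"
      unfolding choose_fact_div[OF k] pochhammer_product[OF k, of b]
      by (simp add: fps_hyp2F1_reg_nth fps_negpow_nth)
  qed
  also have "\<dots> = pochhammer b n / fact n * (pochhammer a n * rGamma (c + of_nat n))"
    unfolding Chu_Vandermonde_rGamma by simp
  finally show "?L $ n = fps_hyp2F1_reg a b c $ n"
    by (simp add: fps_hyp2F1_reg_nth)
qed

text \<open>Here 4^k (a)_k (a + 1/2)_k = (2a)_(2k) combines with (2a + 2k)_(n-k) to (2a)_(n+k) =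
  (2a)_n (2a + n)_k. Chu--Vandermonde is thus applied with B = 2a + n, depending on n.\<close>

lemma fps_hyp2F1_reg_quadratic:
  "(fps_hyp2F1_reg a (a + 1 / 2) c oo (fps_const 4 * fps_X * fps_negpow (- 1) 2)) * fps_negpow (- 1) (2 * a) =
     fps_hyp2F1_reg (2 * a) (2 * a - c + 1) c" (is "?L = _")
proof (rule fps_ext)
  fix n
  have "?L $ n = (\<Sum>k\<le>n. fps_hyp2F1_reg a (a + 1 / 2) c $ k * 4 ^ k * fps_negpow (- 1) (2 * a + of_nat k * 2) $ (n - k))"
    by (rule fps_compose_negpow_nth)
  also have "\<dots> = (- 1) ^ n * pochhammer (2 * a) n / fact n *
     (\<Sum>k\<le>n. of_nat (n choose k) * ((-1) ^ k * pochhammer (2 * a + of_nat n) k * rGamma (c + of_nat k)))"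
    unfolding sum_distrib_left
  proof (intro sum.cong refl)
    fix k assume "k \<in> {..n}"
    then have k: "k \<le> n" by simp
    have p1: "pochhammer a k * pochhammer (a + 1 / 2) k * 4 ^ k = pochhammer (2 * a) (2 * k)"
      by (simp add: pochhammer_double power_mult)
    have p2: "pochhammer (2 * a) n * pochhammer (2 * a + of_nat n) k =
        pochhammer (2 * a) (2 * k) * pochhammer (2 * a + of_nat k * 2) (n - k)"
    proof -
      have eq: "2 * k + (n - k) = n + k" using k by simp
      show ?thesis
        using pochhammer_product'[of "2 * a" n k] pochhammer_product'[of "2 * a" "2 * k" "n - k", unfolded eq]
        by (simp add: mult.commute[of _ 2])
    qed
    have p3: "(- 1 :: complex) ^ (n - k) = (- 1) ^ n * (- 1) ^ k"
      using k by (metis (no_types, lifting) diff_add_inverse2 left_minus_one_mult_self le_add_diff_inverse2 mult.commute power_add)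
    have "(- 1) ^ n * pochhammer (2 * a) n / fact n * (of_nat (n choose k) * ((-1) ^ k * pochhammer (2 * a + of_nat n) k * rGamma (c + of_nat k)))
        = (- 1) ^ n * (-1) ^ k * (pochhammer (2 * a) n * pochhammer (2 * a + of_nat n) k) * (of_nat (n choose k) / fact n) * rGamma (c + of_nat k)"
      by simp
    also have "\<dots> = (- 1) ^ (n - k) * (pochhammer a k * pochhammer (a + 1 / 2) k * 4 ^ k * pochhammer (2 * a + of_nat k * 2) (n - k)) * (1 / (fact k * fact (n - k))) * rGamma (c + of_nat k)"
      unfolding choose_fact_div[OF k] p1 p2 p3 by (simp add: mult_ac)
    finally show "fps_hyp2F1_reg a (a + 1 / 2) c $ k * 4 ^ k * fps_negpow (- 1) (2 * a + of_nat k * 2) $ (n - k) =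
      (- 1) ^ n * pochhammer (2 * a) n / fact n *
      (of_nat (n choose k) * ((-1) ^ k * pochhammer (2 * a + of_nat n) k * rGamma (c + of_nat k)))"
      by (simp add: fps_hyp2F1_reg_nth fps_negpow_nth)
  qed
  \<comment> \<open>The argument c - 2a - n is written in the shape of
    \<open>pochhammer_minus'\<close>; the reflected symbol has a sign that cancels the leading
    one.\<close>
  also have "\<dots> = (- 1) ^ n * pochhammer (2 * a) n / fact n * (pochhammer (c - 2 * a - 1 - of_nat n + 1) n * rGamma (c + of_nat n))"
    unfolding Chu_Vandermonde_rGamma by (simp add: algebra_simps)
  also have "pochhammer (c - 2 * a - 1 - of_nat n + 1) n = (- 1) ^ n * pochhammer (2 * a - c + 1) n"
    unfolding pochhammer_minus' by (simp add: algebra_simps)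
  finally show "?L $ n = fps_hyp2F1_reg (2 * a) (2 * a - c + 1) c $ n"
    by (simp add: fps_hyp2F1_reg_nth)
qed

section \<open>From identities of formal series to identities of functions\<close>

lemma has_fps_expansion_hyp2F1_reg: "hyp2F1_reg a b c has_fps_expansion fps_hyp2F1_reg a b c"
proof -
  have "\<forall>\<^sub>F w in nhds (0 :: complex). w \<in> ball 0 1"
    by (intro eventually_nhds_in_open) auto
  then have "\<forall>\<^sub>F w in nhds (0::complex). eval_fps (fps_hyp2F1_reg a b c) w = hyp2F1_reg a b c w"
    by eventually_elim (simp add: hyp2F1_reg_eq_eval_fps)
  then show ?thesis
    using fps_conv_radius_hyp2F1_reg[of a b c]
    by (auto simp: has_fps_expansion_def intro: less_le_trans[of 0 1])
qed

lemma has_fps_expansion_imp_eq: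
  assumes "f has_fps_expansion F" "g has_fps_expansion F" "f holomorphic_on A" "g holomorphic_on A"
    and "open A" "connected A" "0 \<in> A" "z \<in> A"
  shows "f z = g z"
proof (rule holomorphic_eq_of_eventually_eq[of f g 0])
  have "\<forall>\<^sub>F z in nhds 0. eval_fps F z = f z" "\<forall>\<^sub>F z in nhds 0. eval_fps F z = g z"
    using assms by (auto simp: has_fps_expansion_def)
  then show "\<forall>\<^sub>F z in nhds 0. f z = g z" by eventually_elim simp
qed (use assms in auto)

text \<open>The map w / (w - 1) preserves the cut plane because it inverts 1 - w; both sides are
  therefore holomorphic there and share their expansion at 0.\<close>

lemma hyp2F1_reg_Pfaff:
  assumes "w \<in> cut_plane"
  shows "hyp2F1_reg a b c w = (1 - w) powr (- b) * hyp2F1_reg (c - a) b c (w / (w - 1))"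
proof -
  have e1: "hyp2F1_reg a b c has_fps_expansion fps_hyp2F1_reg a b c"
    by (rule has_fps_expansion_hyp2F1_reg)
  have "((hyp2F1_reg (c - a) b c \<circ> (\<lambda>u. - 1 * u * (1 - 1 * u) powr (- 1)))) has_fps_expansion
     (fps_hyp2F1_reg (c - a) b c oo (fps_const (- 1) * fps_X * fps_negpow 1 1))"
    by (intro fps_expansion_intros has_fps_expansion_hyp2F1_reg has_fps_expansion_negpow) auto
  then have "(\<lambda>u. (hyp2F1_reg (c - a) b c \<circ> (\<lambda>u. - 1 * u * (1 - 1 * u) powr (- 1))) u * (1 - 1 * u) powr (- b))
     has_fps_expansion fps_hyp2F1_reg a b c"
    unfolding fps_hyp2F1_reg_Pfaff[symmetric, of a b c]
    by (intro has_fps_expansion_mult has_fps_expansion_negpow)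
  also have "(\<lambda>u. (hyp2F1_reg (c - a) b c \<circ> (\<lambda>u. - 1 * u * (1 - 1 * u) powr (- 1))) u * (1 - 1 * u) powr (- b)) =
     (\<lambda>w. (1 - w) powr (- b) * hyp2F1_reg (c - a) b c (w / (w - 1)))"
  proof -
    have "- u * inverse (1 - u) = u / (u - 1)" for u :: complex
      by (metis divide_inverse inverse_minus_eq minus_diff_eq minus_mult_commute)
    then show ?thesis by (simp add: fun_eq_iff o_def powr_minus mult.commute)
  qed
  finally have e2: "(\<lambda>w. (1 - w) powr (- b) * hyp2F1_reg (c - a) b c (w / (w - 1))) has_fps_expansion fps_hyp2F1_reg a b c" .
  have "w / (w - 1) \<in> cut_plane" if "w \<in> cut_plane" for w
  proof -
    have "w \<noteq> 1" using that by (auto simp: mem_cut_plane_iff)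
    then have "1 - w / (w - 1) = inverse (1 - w)" by (simp add: field_simps)
    then show ?thesis using that by (simp add: mem_cut_plane_iff)
  qed
  moreover have "(\<lambda>w. w / (w - 1)) holomorphic_on cut_plane"
    by (intro holomorphic_intros) (auto simp: mem_cut_plane_iff)
  ultimately have "(hyp2F1_reg (c - a) b c \<circ> (\<lambda>w. w / (w - 1))) holomorphic_on cut_plane"
    by (intro holomorphic_on_compose_gen[OF _ holomorphic_hyp2F1_reg]) auto
  then have h: "(\<lambda>w. (1 - w) powr (- b) * hyp2F1_reg (c - a) b c (w / (w - 1))) holomorphic_on cut_plane"
    unfolding o_def by (intro holomorphic_intros) (auto simp: mem_cut_plane_iff)
  show ?thesis
    by (rule has_fps_expansion_imp_eq[OF e1 e2 holomorphic_hyp2F1_reg h open_cut_plane connected_cut_plane _ assms])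
       (use ball_subset_cut_plane in auto)
qed

lemma hyp2F1_reg_quadratic:
  assumes u: "norm u < 1"
  shows "hyp2F1_reg a (a + 1 / 2) c (4 * u / (1 + u)\<^sup>2) =
    (1 + u) powr (2 * a) * hyp2F1_reg (2 * a) (2 * a - c + 1) c u"
proof -
  have nz: "1 + u \<noteq> 0" "1 + u \<notin> \<real>\<^sub>\<le>\<^sub>0" if "u \<in> ball 0 1" for u :: complex
    using that abs_Re_le_cmod[of u] by (auto simp: complex_nonpos_Reals_iff complex_eq_iff)
  have cut: "4 * u / (1 + u)\<^sup>2 \<in> cut_plane" if "u \<in> ball 0 1" for u :: complex
  proof -
    \<comment> \<open>The Cayley transform takes the disc into the right half-plane, where squares
      avoid the nonpositive axis.\<close>
    define q where "q = (1 - u) / (1 + u)"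
    have "1 - 4 * u / (1 + u)\<^sup>2 = q\<^sup>2"
      using nz[OF that]
      by (simp add: q_def power_divide divide_simps) (simp add: power2_eq_square algebra_simps)
    have "Re q > 0"
    proof -
      have "Re ((1 - u) * cnj (1 + u)) = 1 - (norm u)\<^sup>2"
        unfolding cmod_power2 by (simp add: power2_eq_square algebra_simps)
      also have "\<dots> > 0" using that by (simp add: power_less_one_iff abs_square_less_1)
      finally show ?thesis
        using nz[OF that] by (simp add: q_def Re_complex_div_gt_0)
    qed
    have "q\<^sup>2 \<notin> \<real>\<^sub>\<le>\<^sub>0"
    proof
      assume "q\<^sup>2 \<in> \<real>\<^sub>\<le>\<^sub>0"
      then have "Re q * Im q = 0" "(Re q)\<^sup>2 - (Im q)\<^sup>2 \<le> 0"
        by (auto simp: complex_nonpos_Reals_iff power2_eq_square)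
      then show False using \<open>Re q > 0\<close> by auto
    qed
    then show ?thesis
      unfolding mem_cut_plane_iff \<open>1 - 4 * u / (1 + u)\<^sup>2 = q\<^sup>2\<close> .
  qed
  have "hyp2F1_reg (2 * a) (2 * a - c + 1) c u =
     (1 + u) powr (- (2 * a)) * hyp2F1_reg a (a + 1 / 2) c (4 * u / (1 + u)\<^sup>2)"
  proof -
    have e1: "hyp2F1_reg (2 * a) (2 * a - c + 1) c has_fps_expansion fps_hyp2F1_reg (2 * a) (2 * a - c + 1) c"
      by (rule has_fps_expansion_hyp2F1_reg)
    have "((hyp2F1_reg a (a + 1 / 2) c \<circ> (\<lambda>u. 4 * u * (1 - (- 1) * u) powr (- 2)))) has_fps_expansion
       (fps_hyp2F1_reg a (a + 1 / 2) c oo (fps_const 4 * fps_X * fps_negpow (- 1) 2))"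
      by (intro fps_expansion_intros has_fps_expansion_hyp2F1_reg has_fps_expansion_negpow) auto
    then have *: "(\<lambda>u. (hyp2F1_reg a (a + 1 / 2) c \<circ> (\<lambda>u. 4 * u * (1 - (- 1) * u) powr (- 2))) u * (1 - (- 1) * u) powr (- (2 * a)))
       has_fps_expansion fps_hyp2F1_reg (2 * a) (2 * a - c + 1) c"
      unfolding fps_hyp2F1_reg_quadratic[symmetric, of a c]
      by (intro has_fps_expansion_mult has_fps_expansion_negpow)
    have sq: "(x::complex) powr (- 2) = inverse (x\<^sup>2)" for x
      by (simp add: powr_minus)
    have neg: "1 - (- 1) * u = 1 + u" for u :: complex by simp
    have "(\<lambda>u. (hyp2F1_reg a (a + 1 / 2) c \<circ> (\<lambda>u. 4 * u * (1 - (- 1) * u) powr (- 2))) u * (1 - (- 1) * u) powr (- (2 * a))) =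
       (\<lambda>u. (1 + u) powr (- (2 * a)) * hyp2F1_reg a (a + 1 / 2) c (4 * u / (1 + u)\<^sup>2))"
      unfolding o_def neg sq divide_inverse by (simp only: mult.commute)
    with * have e2: "(\<lambda>u. (1 + u) powr (- (2 * a)) * hyp2F1_reg a (a + 1 / 2) c (4 * u / (1 + u)\<^sup>2)) has_fps_expansion
       fps_hyp2F1_reg (2 * a) (2 * a - c + 1) c"
      by simp
    have "(hyp2F1_reg a (a + 1 / 2) c \<circ> (\<lambda>u. 4 * u / (1 + u)\<^sup>2)) holomorphic_on ball 0 1"
    proof (rule holomorphic_on_compose_gen[OF _ holomorphic_hyp2F1_reg])
      show "(\<lambda>u. 4 * u / (1 + u)\<^sup>2) holomorphic_on ball 0 1"
      proof (intro holomorphic_intros)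
        show "(1 + u)\<^sup>2 \<noteq> 0" if "u \<in> ball 0 1" for u :: complex
          using nz(1)[OF that] by simp
      qed
      show "(\<lambda>u. 4 * u / (1 + u)\<^sup>2) ` ball 0 1 \<subseteq> cut_plane"
        using cut by (intro image_subsetI)
    qed
    moreover have "(\<lambda>u. (1 + u) powr (- (2 * a))) holomorphic_on ball 0 1"
      by (intro holomorphic_intros nz(2))
    ultimately have h: "(\<lambda>u. (1 + u) powr (- (2 * a)) * hyp2F1_reg a (a + 1 / 2) c (4 * u / (1 + u)\<^sup>2)) holomorphic_on ball 0 1"
      unfolding o_def by (intro holomorphic_on_mult)
    show ?thesis
      by (rule has_fps_expansion_imp_eq[OF e1 e2 holomorphic_on_subset[OF holomorphic_hyp2F1_reg ball_subset_cut_plane] h])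
         (use u in auto)
  qed
  then show ?thesis
    using u nz[of u] by (simp add: powr_minus)
qed

section \<open>Contiguous relations\<close>

lemma rGamma_pred_add: "rGamma (c - 1 + of_nat n) = (c - 1 + of_nat n) * rGamma (c + of_nat n)" for c :: complex
  using rGamma_plus1[of "c - 1 + of_nat n"] by (simp add: algebra_simps)

lemma rGamma_add_nat: "rGamma (c + of_nat n) = (c + of_nat n) * rGamma (c + 1 + of_nat n)" for c :: complex
  using rGamma_plus1[of "c + of_nat n"] by (simp add: algebra_simps)

lemma fps_X_deriv_nth: "(fps_X * fps_deriv F) $ n = of_nat n * F $ n" for F :: "complex fps"
  by (cases n) auto

text \<open>On X^n the operator acts as multiplication by c - 1 + n, which is the quotient of
  consecutive values of \<open>rGamma\<close>.\<close>

lemma fps_hyp2F1_reg_lower_c: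
  "fps_X * fps_deriv (fps_hyp2F1_reg a b c) + fps_const (c - 1) * fps_hyp2F1_reg a b c =
     fps_hyp2F1_reg a b (c - 1)"
proof (rule fps_ext)
  fix n
  have "of_nat n * F + (c - 1) * F = (c - 1 + of_nat n) * F" for F :: complex
    by (simp add: algebra_simps)
  then show "(fps_X * fps_deriv (fps_hyp2F1_reg a b c) + fps_const (c - 1) * fps_hyp2F1_reg a b c) $ n =
     fps_hyp2F1_reg a b (c - 1) $ n"
    unfolding fps_add_nth fps_X_deriv_nth fps_mult_left_const_nth
    by (simp only: fps_hyp2F1_reg_nth rGamma_pred_add) simp
qed

text \<open>Serves the solution F(a, b; 1 - (c - a - b); 1 - u) at 1, whose third parameter goes up
  when c goes down.\<close>

lemma fps_hyp2F1_reg_raise_c: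
  "(1 - fps_X) * fps_deriv (fps_hyp2F1_reg a b c) - fps_const (a + b - c) * fps_hyp2F1_reg a b c =
     fps_const ((c - a) * (c - b)) * fps_hyp2F1_reg a b (c + 1)" (is "?L = ?R")
proof (rule fps_ext)
  fix n
  define F where "F = fps_hyp2F1_reg a b c"
  define G where "G = pochhammer a n * pochhammer b n * rGamma (c + 1 + of_nat n) / fact n"
  have F: "F $ n = (c + of_nat n) * G"
    unfolding F_def G_def fps_hyp2F1_reg_nth rGamma_add_nat[of c] by simp
  have S: "c + of_nat (Suc n) = c + 1 + of_nat n" by simp
  have FS: "of_nat (Suc n) * F $ Suc n = (a + of_nat n) * (b + of_nat n) * G"
    unfolding F_def G_def fps_hyp2F1_reg_nth pochhammer_Suc S fact_Suc
    by (simp add: divide_simps del: of_nat_Suc)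
  have "?L = fps_deriv F - fps_X * fps_deriv F - fps_const (a + b - c) * F"
    by (simp add: F_def algebra_simps)
  then have "?L $ n = of_nat (Suc n) * F $ Suc n - of_nat n * F $ n - (a + b - c) * F $ n"
    by (simp only: fps_sub_nth fps_X_deriv_nth fps_mult_left_const_nth fps_deriv_nth Suc_eq_plus1)
  also have "\<dots> = (c - a) * (c - b) * G" unfolding FS F by (simp add: algebra_simps)
  also have "\<dots> = ?R $ n" by (simp add: fps_hyp2F1_reg_nth G_def)
  finally show "?L $ n = ?R $ n" .
qed

text \<open>Serves the other solution at 1, whose parameters c - a, c - b and 1 + (c - a - b) all
  drop with c. The form of the operator accounts for the derivative of the power of 1 - u in
  front.\<close>

lemma fps_hyp2F1_reg_lower_all:
  "(1 - fps_X) * (fps_X * fps_deriv (fps_hyp2F1_reg a b c) + fps_const (c - 1) * fps_hyp2F1_reg a b c)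
     - fps_const (a + b - c) * (fps_X * fps_hyp2F1_reg a b c) =
     fps_hyp2F1_reg (a - 1) (b - 1) (c - 1)" (is "?L = ?R")
proof (rule fps_ext)
  fix n
  define F where "F = fps_hyp2F1_reg a b c"
  define H where "H = fps_hyp2F1_reg a b (c - 1)"
  have L: "?L = H - fps_X * H - fps_const (a + b - c) * (fps_X * F)"
    unfolding H_def F_def fps_hyp2F1_reg_lower_c by (simp add: algebra_simps)
  show "?L $ n = ?R $ n"
  proof (cases n)
    case 0
    then show ?thesis unfolding L by (simp add: H_def fps_hyp2F1_reg_nth)
  next
    case (Suc m)
    define G where "G = pochhammer a m * pochhammer b m * rGamma (c + of_nat m) / fact (Suc m)"
    have h1: "H $ Suc m = (a + of_nat m) * (b + of_nat m) * G"
      unfolding H_def G_def fps_hyp2F1_reg_nth pochhammer_Suc by (simp add: add_ac)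
    have h2: "H $ m = (c - 1 + of_nat m) * (of_nat (Suc m) * G)"
      unfolding H_def G_def fps_hyp2F1_reg_nth rGamma_pred_add fact_Suc by (simp del: of_nat_Suc)
    have h3: "F $ m = of_nat (Suc m) * G"
      unfolding F_def G_def fps_hyp2F1_reg_nth fact_Suc by (simp del: of_nat_Suc)
    have h4: "?R $ Suc m = (a - 1) * (b - 1) * G"
      unfolding G_def fps_hyp2F1_reg_nth pochhammer_rec by (simp add: add_ac)
    have h5: "?L $ Suc m = H $ Suc m - H $ m - (a + b - c) * F $ m"
      unfolding L by simp
    show ?thesis unfolding Suc h5 h4 h1 h2 h3 by (simp add: algebra_simps)
  qed
qed

section \<open>Contiguous relations and differential equation on the cut plane\<close>

abbreviation hyp2F1_reg' :: "complex \<Rightarrow> complex \<Rightarrow> complex \<Rightarrow> complex \<Rightarrow> complex" where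
  "hyp2F1_reg' a b c \<equiv> deriv (hyp2F1_reg a b c)"

lemma holomorphic_hyp2F1_reg': "hyp2F1_reg' a b c holomorphic_on cut_plane"
  by (intro holomorphic_deriv holomorphic_hyp2F1_reg open_cut_plane)

lemma has_fps_expansion_hyp2F1_reg':
  "hyp2F1_reg' a b c has_fps_expansion fps_deriv (fps_hyp2F1_reg a b c)"
  by (intro has_fps_expansion_deriv has_fps_expansion_hyp2F1_reg)

lemmas hyp2F1_reg_expansions = has_fps_expansion_hyp2F1_reg has_fps_expansion_hyp2F1_reg'
lemmas hyp2F1_reg_holomorphic = holomorphic_hyp2F1_reg holomorphic_hyp2F1_reg'

lemma cut_plane_eqI:
  assumes "f has_fps_expansion F" "g has_fps_expansion G" "F = G"
    and "f holomorphic_on cut_plane" "g holomorphic_on cut_plane" "w \<in> cut_plane"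
  shows "f w = g w"
proof -
  have "0 \<in> cut_plane" by (simp add: mem_cut_plane_iff)
  then show ?thesis
    using has_fps_expansion_imp_eq[of f F g cut_plane w] assms open_cut_plane connected_cut_plane by simp
qed

lemma hyp2F1_reg_lower_c:
  assumes "w \<in> cut_plane"
  shows "w * hyp2F1_reg' a b c w + (c - 1) * hyp2F1_reg a b c w = hyp2F1_reg a b (c - 1) w"
  by (rule cut_plane_eqI[where f = "\<lambda>w. w * hyp2F1_reg' a b c w + (c - 1) * hyp2F1_reg a b c w"
        and g = "hyp2F1_reg a b (c - 1)", OF _ _ fps_hyp2F1_reg_lower_c[of a b c] _ _ assms];
      intro fps_expansion_intros hyp2F1_reg_expansions holomorphic_intros hyp2F1_reg_holomorphic open_cut_plane)

lemma hyp2F1_reg_raise_c: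
  assumes "w \<in> cut_plane"
  shows "(1 - w) * hyp2F1_reg' a b c w - (a + b - c) * hyp2F1_reg a b c w =
     (c - a) * (c - b) * hyp2F1_reg a b (c + 1) w"
  by (rule cut_plane_eqI[where f = "\<lambda>w. (1 - w) * hyp2F1_reg' a b c w - (a + b - c) * hyp2F1_reg a b c w"
        and g = "\<lambda>w. (c - a) * (c - b) * hyp2F1_reg a b (c + 1) w",
        OF _ _ fps_hyp2F1_reg_raise_c[of a b c] _ _ assms];
      intro fps_expansion_intros hyp2F1_reg_expansions holomorphic_intros hyp2F1_reg_holomorphic open_cut_plane)

lemma hyp2F1_reg_lower_all:
  assumes "w \<in> cut_plane"
  shows "(1 - w) * (w * hyp2F1_reg' a b c w + (c - 1) * hyp2F1_reg a b c w) - (a + b - c) * (w * hyp2F1_reg a b c w) =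
     hyp2F1_reg (a - 1) (b - 1) (c - 1) w"
  by (rule cut_plane_eqI[where f = "\<lambda>w. (1 - w) * (w * hyp2F1_reg' a b c w + (c - 1) * hyp2F1_reg a b c w)
         - (a + b - c) * (w * hyp2F1_reg a b c w)"
        and g = "hyp2F1_reg (a - 1) (b - 1) (c - 1)", OF _ _ fps_hyp2F1_reg_lower_all[of a b c] _ _ assms];
      intro fps_expansion_intros hyp2F1_reg_expansions holomorphic_intros hyp2F1_reg_holomorphic open_cut_plane)

lemma hyp2F1_reg_ode:
  assumes "w \<in> cut_plane"
  shows "w * (1 - w) * deriv (hyp2F1_reg' a b c) w + (c - (a + b + 1) * w) * hyp2F1_reg' a b c w
    - a * b * hyp2F1_reg a b c w = 0"
  by (rule cut_plane_eqI[where f = "\<lambda>w. w * (1 - w) * deriv (hyp2F1_reg' a b c) w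
        + (c - (a + b + 1) * w) * hyp2F1_reg' a b c w - a * b * hyp2F1_reg a b c w" and g = "\<lambda>_. 0",
        OF _ _ fps_hyp2F1_reg_ode[of a b c] _ _ assms];
      intro fps_expansion_intros hyp2F1_reg_expansions holomorphic_intros hyp2F1_reg_holomorphic
        has_fps_expansion_deriv open_cut_plane)

lemma has_field_derivative_hyp2F1_reg:
  "w \<in> cut_plane \<Longrightarrow> (hyp2F1_reg a b c has_field_derivative hyp2F1_reg' a b c w) (at w)"
  by (rule holomorphic_derivI[OF holomorphic_hyp2F1_reg open_cut_plane])

lemma has_field_derivative_hyp2F1_reg':
  "w \<in> cut_plane \<Longrightarrow> (hyp2F1_reg' a b c has_field_derivative deriv (hyp2F1_reg' a b c) w) (at w)"
  by (rule holomorphic_derivI[OF holomorphic_hyp2F1_reg' open_cut_plane])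

lemma hyp2F1_reg_0: "hyp2F1_reg a b c 0 = rGamma c"
  by (simp add: hyp2F1_reg_eq_eval_fps eval_fps_at_0 fps_hyp2F1_reg_nth)

section \<open>Connection formula\<close>

definition doubly_cut_plane :: "complex set" where
  "doubly_cut_plane = {u. u \<in> cut_plane \<and> 1 - u \<in> cut_plane}"

lemma mem_doubly_cut_plane_iff: "u \<in> doubly_cut_plane \<longleftrightarrow> u \<notin> \<real>\<^sub>\<le>\<^sub>0 \<and> 1 - u \<notin> \<real>\<^sub>\<le>\<^sub>0"
  by (auto simp: doubly_cut_plane_def mem_cut_plane_iff)

lemma doubly_cut_planeD:
  assumes "u \<in> doubly_cut_plane"
  shows "u \<in> cut_plane" "1 - u \<in> cut_plane" "u \<notin> \<real>\<^sub>\<le>\<^sub>0" "1 - u \<notin> \<real>\<^sub>\<le>\<^sub>0" "u \<noteq> 0" "1 - u \<noteq> 0"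
  using assms by (auto simp: doubly_cut_plane_def mem_cut_plane_iff)

lemma open_doubly_cut_plane: "open doubly_cut_plane"
proof -
  have "doubly_cut_plane = cut_plane \<inter> (\<lambda>u. 1 - u) -` cut_plane"
    by (auto simp: doubly_cut_plane_def)
  also have "open \<dots>" by (intro open_Int open_vimage open_cut_plane continuous_intros)
  finally show ?thesis .
qed

lemma connected_doubly_cut_plane: "connected doubly_cut_plane"
proof (rule starlike_imp_connected)
  have "closed_segment (1 / 2) w \<subseteq> doubly_cut_plane" if w: "w \<in> doubly_cut_plane" for w
  proof
    fix z assume "z \<in> closed_segment (1 / 2) w"
    then obtain t where t: "0 \<le> t" "t \<le> 1" "z = (1 - t) *\<^sub>R (1 / 2) + t *\<^sub>R w"
      by (auto simp: closed_segment_def)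
    have z: "Im z = t * Im w" "Re z = (1 - t) / 2 + t * Re w" using t by auto
    show "z \<in> doubly_cut_plane"
    proof (cases "t = 0")
      case False
      with t have t0: "t > 0" by simp
      show ?thesis
      proof (cases "Im w = 0")
        case True
        with w have "0 < Re w" "Re w < 1"
          by (auto simp: mem_doubly_cut_plane_iff complex_nonpos_Reals_iff)
        then have "0 < t * Re w" "t * Re w < t" using t0 by auto
        then have "0 < Re z" "Re z < 1" using t(1,2) unfolding z by (simp_all add: field_simps)
        then show ?thesis by (auto simp: mem_doubly_cut_plane_iff complex_nonpos_Reals_iff)
      qed (use z t0 in \<open>auto simp: mem_doubly_cut_plane_iff complex_nonpos_Reals_iff\<close>)
    qed (use z in \<open>auto simp: mem_doubly_cut_plane_iff complex_nonpos_Reals_iff\<close>)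
  qed
  then show "starlike doubly_cut_plane"
    unfolding starlike_def
    by (intro bexI[of _ "1 / 2"]) (auto simp: mem_doubly_cut_plane_iff complex_nonpos_Reals_iff)
qed

text \<open>The first derivative is an explicit argument, since Wronskians are formed from it; the
  second is only asserted to exist pointwise, because it serves to eliminate terms in the
  equation.\<close>

definition hypergeo_solution ::
    "complex \<Rightarrow> complex \<Rightarrow> complex \<Rightarrow> (complex \<Rightarrow> complex) \<Rightarrow> (complex \<Rightarrow> complex) \<Rightarrow> bool" where
  "hypergeo_solution a b c y y' \<longleftrightarrow> (\<forall>u\<in>doubly_cut_plane. (y has_field_derivative y' u) (at u) \<and>
     (\<exists>y2. (y' has_field_derivative y2) (at u) \<and>
        u * (1 - u) * y2 + (c - (a + b + 1) * u) * y' u - a * b * y u = 0))"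

lemma hypergeo_solution_at_0: "hypergeo_solution a b c (hyp2F1_reg a b c) (hyp2F1_reg' a b c)"
  unfolding hypergeo_solution_def
  using has_field_derivative_hyp2F1_reg has_field_derivative_hyp2F1_reg' hyp2F1_reg_ode
  by (blast dest: doubly_cut_planeD(1))

lemma DERIV_one_minus:
  fixes f :: "complex \<Rightarrow> complex"
  assumes "(f has_field_derivative D) (at (1 - u))"
  shows "((\<lambda>u. f (1 - u)) has_field_derivative - D) (at u)"
proof -
  have "((\<lambda>u. 1 - u) has_field_derivative - 1) (at u)"
    by (auto intro!: derivative_eq_intros)
  from DERIV_chain2[OF assms this] show ?thesis by simp
qed

lemma powr_derivative_one_minus:
  fixes u d :: complex
  assumes "1 - u \<notin> \<real>\<^sub>\<le>\<^sub>0"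
  shows "((\<lambda>u. (1 - u) powr d) has_field_derivative - d * ((1 - u) powr d / (1 - u))) (at u)"
proof -
  have "1 - u \<noteq> 0" using assms by auto
  then show ?thesis
    using DERIV_one_minus[OF has_field_derivative_powr[OF assms, of d]] by (simp add: powr_diff)
qed

text \<open>The equation is invariant under u -> 1 - u together with c -> a + b + 1 - c.\<close>

lemma hypergeo_solution_at_1:
  "hypergeo_solution a b c (\<lambda>u. hyp2F1_reg a b (1 - (c - a - b)) (1 - u))
     (\<lambda>u. - hyp2F1_reg' a b (1 - (c - a - b)) (1 - u))"
  unfolding hypergeo_solution_def
proof (intro ballI conjI exI)
  fix u assume "u \<in> doubly_cut_plane"
  note u = doubly_cut_planeD[OF this]
  let ?c = "1 - (c - a - b)"
  show "((\<lambda>u. hyp2F1_reg a b ?c (1 - u)) has_field_derivative - hyp2F1_reg' a b ?c (1 - u)) (at u)"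
    by (intro DERIV_one_minus has_field_derivative_hyp2F1_reg u)
  show "((\<lambda>u. - hyp2F1_reg' a b ?c (1 - u)) has_field_derivative deriv (hyp2F1_reg' a b ?c) (1 - u)) (at u)"
    using DERIV_minus[OF DERIV_one_minus[OF has_field_derivative_hyp2F1_reg'[OF u(2), of a b ?c]]] by simp
  show "u * (1 - u) * deriv (hyp2F1_reg' a b ?c) (1 - u) +
      (c - (a + b + 1) * u) * - hyp2F1_reg' a b ?c (1 - u) - a * b * hyp2F1_reg a b ?c (1 - u) = 0"
    using hyp2F1_reg_ode[OF u(2), of a b ?c] by (simp add: algebra_simps)
qed

text \<open>The solution belonging to the exponent d = c - a - b at 1.\<close>

lemma hypergeo_solution_at_1':
  fixes a b c :: complex
  defines "d \<equiv> c - a - b"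
  defines "h \<equiv> hyp2F1_reg (c - a) (c - b) (1 + d)" and "h' \<equiv> hyp2F1_reg' (c - a) (c - b) (1 + d)"
  shows "hypergeo_solution a b c (\<lambda>u. (1 - u) powr d * h (1 - u))
     (\<lambda>u. - ((1 - u) powr d * (d * h (1 - u) / (1 - u) + h' (1 - u))))"
  unfolding hypergeo_solution_def
proof (intro ballI conjI exI)
  fix u assume "u \<in> doubly_cut_plane"
  note u = doubly_cut_planeD[OF this]
  define h2 where "h2 = deriv h' (1 - u)"
  have dh: "((\<lambda>u. h (1 - u)) has_field_derivative - h' (1 - u)) (at u)"
    unfolding h_def h'_def by (intro DERIV_one_minus has_field_derivative_hyp2F1_reg u)
  have dh': "((\<lambda>u. h' (1 - u)) has_field_derivative - h2) (at u)"
    unfolding h_def h'_def h2_def by (intro DERIV_one_minus has_field_derivative_hyp2F1_reg' u)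
  note dp = powr_derivative_one_minus[OF u(4), of d]
  show "((\<lambda>u. (1 - u) powr d * h (1 - u)) has_field_derivative
      - ((1 - u) powr d * (d * h (1 - u) / (1 - u) + h' (1 - u)))) (at u)"
    by (rule DERIV_cong[OF DERIV_mult[OF dp dh]]) (simp add: algebra_simps)
  define p k k1 v where "p = (1 - u) powr d" and "k = h (1 - u)" and "k1 = h' (1 - u)" and "v = 1 - u"
  have v: "v \<noteq> 0" "u = 1 - v" using u by (auto simp: v_def)
  have dq: "((\<lambda>u. d * h (1 - u) / (1 - u) + h' (1 - u)) has_field_derivative
     (d * (- k1) / v + d * k / v\<^sup>2 - h2)) (at u)"
  proof -
    have d1: "((\<lambda>u. 1 - u) has_field_derivative - 1) (at u)"
      by (auto intro!: derivative_eq_intros)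
    show ?thesis
      by (rule DERIV_cong[OF DERIV_add[OF DERIV_divide[OF DERIV_cmult[OF dh, of d] d1 u(6)] dh']])
         (use v(1) in \<open>simp add: k_def k1_def v_def[symmetric] power2_eq_square field_simps\<close>)
  qed
  show "((\<lambda>u. - ((1 - u) powr d * (d * h (1 - u) / (1 - u) + h' (1 - u)))) has_field_derivative
     p * (d * (d - 1) * k / v\<^sup>2 + 2 * d * k1 / v + h2)) (at u)"
    by (rule DERIV_cong[OF DERIV_minus[OF DERIV_mult[OF dp dq]]])
       (use v(1) in \<open>simp add: p_def k_def k1_def v_def[symmetric] power2_eq_square field_simps\<close>)
  have "v * (1 - v) * h2 + ((1 + d) - (2 * d + a + b + 1) * v) * k1 - (d + a) * (d + b) * k = 0"
    using hyp2F1_reg_ode[OF u(2), of "c - a" "c - b" "1 + d"]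
    unfolding h2_def k_def k1_def v_def h_def h'_def d_def by (simp add: algebra_simps)
  then have *: "p * (v * (1 - v) * h2 + ((1 + d) - (2 * d + a + b + 1) * v) * k1 - (d + a) * (d + b) * k) = 0"
    by simp
  have c: "c = d + a + b" by (simp add: d_def)
  \<comment> \<open>With k = m v the quotients by v disappear, and the claim becomes p times the
    hypergeometric equation of \<open>h\<close> at v.\<close>
  define m where "m = k / v"
  have m: "k = m * v" "k / v\<^sup>2 = m / v" using v(1) by (auto simp: m_def power2_eq_square)
  have "v * (d * (d - 1) * k / v\<^sup>2 + 2 * d * k1 / v + h2) = d * (d - 1) * m + 2 * d * k1 + v * h2"
    using v(1) by (simp add: m field_simps power2_eq_square)
  then have "(1 - v) * v * (p * (d * (d - 1) * k / v\<^sup>2 + 2 * d * k1 / v + h2)) +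
      (d + a + b - (a + b + 1) * (1 - v)) * (- (p * (d * k / v + k1))) - a * b * (p * k) =
      (1 - v) * p * (d * (d - 1) * m + 2 * d * k1 + v * h2) +
      (d + a + b - (a + b + 1) * (1 - v)) * (- (p * (d * m + k1))) - a * b * (p * (m * v))"
    by (simp add: m_def[symmetric] m(1)[symmetric] mult.left_commute[of v] mult.assoc flip: times_divide_eq_right)
  also have "\<dots> = p * (v * (1 - v) * h2 + ((1 + d) - (2 * d + a + b + 1) * v) * k1 - (d + a) * (d + b) * (m * v))"
    by (simp add: algebra_simps)
  also have "\<dots> = 0" using * unfolding m(1) .
  finally show "u * (1 - u) * (p * (d * (d - 1) * k / v\<^sup>2 + 2 * d * k1 / v + h2)) +
      (c - (a + b + 1) * u) * (- ((1 - u) powr d * (d * h (1 - u) / (1 - u) + h' (1 - u)))) -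
      a * b * ((1 - u) powr d * h (1 - u)) = 0"
    unfolding p_def[symmetric] k_def[symmetric] k1_def[symmetric]
    unfolding v_def[symmetric]
    unfolding v(2) c .
qed

text \<open>Abel's identity: with e = a + b + 1 - c, subtracting the two equations gives u (1 - u)
  W' = - (c (1 - u) - e u) W, and u^c (1 - u)^e is the integrating factor. Connectedness of the
  domain yields a single constant.\<close>

lemma Wronskian_constant:
  assumes "hypergeo_solution a b c y y'" "hypergeo_solution a b c z z'"
  obtains K where "\<And>u. u \<in> doubly_cut_plane \<Longrightarrow>
    u powr c * (1 - u) powr (a + b + 1 - c) * (y u * z' u - y' u * z u) = K"
proof -
  define e where "e = a + b + 1 - c"
  define w where "w = (\<lambda>u. u powr c * (1 - u) powr e * (y u * z' u - y' u * z u))"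
  have d: "(w has_field_derivative 0) (at u)" if "u \<in> doubly_cut_plane" for u
  proof -
    note u = doubly_cut_planeD[OF that]
    from assms that obtain y2 z2 where
      y: "(y has_field_derivative y' u) (at u)" "(y' has_field_derivative y2) (at u)"
         "u * (1 - u) * y2 + (c - (a + b + 1) * u) * y' u - a * b * y u = 0" and
      z: "(z has_field_derivative z' u) (at u)" "(z' has_field_derivative z2) (at u)"
         "u * (1 - u) * z2 + (c - (a + b + 1) * u) * z' u - a * b * z u = 0"
      unfolding hypergeo_solution_def by blast
    have dp: "((\<lambda>u. u powr c) has_field_derivative c * (u powr c / u)) (at u)"
      using u by (auto intro!: derivative_eq_intros simp: powr_diff)
    note dq = powr_derivative_one_minus[OF u(4), of e]
    define W where "W = y u * z' u - y' u * z u"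
    define p where "p = u powr c * (1 - u) powr e"
    have dW: "((\<lambda>u. y u * z' u - y' u * z u) has_field_derivative y u * z2 - y2 * z u) (at u)"
      by (rule DERIV_cong[OF DERIV_diff[OF DERIV_mult[OF y(1) z(2)] DERIV_mult[OF y(2) z(1)]]])
         (simp add: algebra_simps)
    have "u * (1 - u) * (y u * z2 - y2 * z u) = y u * (u * (1 - u) * z2) - (u * (1 - u) * y2) * z u"
      by (simp add: algebra_simps)
    also have "u * (1 - u) * y2 = a * b * y u - (c - (a + b + 1) * u) * y' u"
      using y(3) by (simp add: algebra_simps)
    also have "u * (1 - u) * z2 = a * b * z u - (c - (a + b + 1) * u) * z' u"
      using z(3) by (simp add: algebra_simps)
    finally have *: "u * (1 - u) * (y u * z2 - y2 * z u) = - (c * (1 - u) - e * u) * W"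
      by (simp add: W_def e_def algebra_simps)
    have "(w has_field_derivative p * (c / u - e / (1 - u)) * W + p * (y u * z2 - y2 * z u)) (at u)"
      unfolding w_def
      by (rule DERIV_cong[OF DERIV_mult[OF DERIV_mult[OF dp dq] dW]])
         (use u in \<open>simp add: W_def[symmetric] p_def field_simps\<close>)
    also have "p * (c / u - e / (1 - u)) * W + p * (y u * z2 - y2 * z u) =
        p / (u * (1 - u)) * ((c * (1 - u) - e * u) * W + u * (1 - u) * (y u * z2 - y2 * z u))"
      using u by (simp add: field_simps)
    also have "\<dots> = 0" unfolding * by (simp add: algebra_simps)
    finally show ?thesis .
  qed
  obtain K where "\<And>u. u \<in> doubly_cut_plane \<Longrightarrow> w u = K"
  proof (rule DERIV_zero_connected_constant[of doubly_cut_plane "{}" w])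
    show "continuous_on doubly_cut_plane w"
      using d by (meson DERIV_isCont continuous_at_imp_continuous_on)
  qed (use d open_doubly_cut_plane connected_doubly_cut_plane in auto)
  then show ?thesis using that unfolding w_def e_def by blast
qed

definition hypergeo_connection :: "complex \<Rightarrow> complex \<Rightarrow> complex \<Rightarrow> complex \<Rightarrow> complex \<Rightarrow> bool" where
  "hypergeo_connection a b c \<alpha> \<beta> \<longleftrightarrow> (\<forall>u\<in>doubly_cut_plane. hyp2F1_reg a b c u =
     \<alpha> * hyp2F1_reg a b (1 - (c - a - b)) (1 - u) +
     \<beta> * ((1 - u) powr (c - a - b) * hyp2F1_reg (c - a) (c - b) (1 + (c - a - b)) (1 - u)))"

lemma rGamma_nonzero: "z \<notin> \<int> \<Longrightarrow> rGamma z \<noteq> 0" for z :: complex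
  by (auto simp: rGamma_eq_zero_iff elim: nonpos_Ints_cases)

text \<open>Approaches 1 from inside the interval (0, 1); n + 2 makes the first point 1/2, which
  also serves as a base point for \<open>hypergeo_connection_unique\<close>.\<close>

lemma unit_interval_sequence:
  shows "(\<lambda>n. complex_of_real (1 / real (n + 2))) \<longlonglongrightarrow> 0"
    and "1 - complex_of_real (1 / real (n + 2)) \<in> doubly_cut_plane"
proof -
  have "(\<lambda>n. 1 / real (n + 2)) \<longlonglongrightarrow> 0" by real_asymp
  then show "(\<lambda>n. complex_of_real (1 / real (n + 2))) \<longlonglongrightarrow> 0"
    using tendsto_of_real[where 'a = complex] by fastforce
  have "0 < 1 / real (n + 2)" "1 / real (n + 2) < 1" by auto
  then show "1 - complex_of_real (1 / real (n + 2)) \<in> doubly_cut_plane"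
    by (auto simp: mem_doubly_cut_plane_iff complex_nonpos_Reals_iff)
qed

text \<open>The constant is found by letting u tend to 1. The weight contributes (1 - u)^(1 - d) and
  the second solution (1 - u)^d; together they are just 1 - u, which leaves an expression continuous
  at u = 1.\<close>

lemma Wronskian_at_1:
  fixes a b c :: complex
  defines "d \<equiv> c - a - b"
  defines "k \<equiv> hyp2F1_reg a b (1 - d)" and "k' \<equiv> hyp2F1_reg' a b (1 - d)"
    and "h \<equiv> hyp2F1_reg (c - a) (c - b) (1 + d)" and "h' \<equiv> hyp2F1_reg' (c - a) (c - b) (1 + d)"
  assumes u: "u \<in> doubly_cut_plane"
  shows "u powr c * (1 - u) powr (a + b + 1 - c) *
    (k (1 - u) * (- ((1 - u) powr d * (d * h (1 - u) / (1 - u) + h' (1 - u))))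
      - (- k' (1 - u)) * ((1 - u) powr d * h (1 - u))) = - d * rGamma (1 - d) * rGamma (1 + d)"
    (is "?w u = _")
proof -
  obtain K where K: "\<And>u. u \<in> doubly_cut_plane \<Longrightarrow> ?w u = K"
    using Wronskian_constant[OF hypergeo_solution_at_1[of a b c] hypergeo_solution_at_1'[of a b c]]
    unfolding d_def k_def k'_def h_def h'_def by metis
  define \<psi> where "\<psi> = (\<lambda>v. (1 - v) powr c * (v * k' v * h v - k v * (d * h v + v * h' v)))"
  have \<psi>: "?w u = \<psi> (1 - u)" if "u \<in> doubly_cut_plane" for u
  proof -
    note u = doubly_cut_planeD[OF that]
    define v where "v = 1 - u"
    have "v powr (a + b + 1 - c) * v powr d = v powr (1 + 0)"
      unfolding powr_add[symmetric] by (simp add: d_def)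
    also have "\<dots> = v" using u by (simp add: v_def)
    finally have v: "v powr (a + b + 1 - c) * v powr d = v" .
    have v0: "v \<noteq> 0" using u by (simp add: v_def)
    have "?w u = u powr c * (v powr (a + b + 1 - c) * v powr d) * (k' v * h v - k v * (d * h v / v + h' v))"
      unfolding v_def[symmetric] by (simp add: algebra_simps)
    also have "\<dots> = u powr c * (v * k' v * h v - k v * (d * h v + v * h' v))"
      unfolding v using v0 by (simp add: field_simps)
    finally show ?thesis by (simp add: \<psi>_def v_def)
  qed
  have z: "0 \<in> cut_plane" by (simp add: mem_cut_plane_iff)
  have "isCont f 0" if "f holomorphic_on cut_plane" for f
    using that z open_cut_plane
    by (meson continuous_on_eq_continuous_at holomorphic_on_imp_continuous_on)
  then have [continuous_intros]: "isCont k 0" "isCont k' 0" "isCont h 0" "isCont h' 0"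
    unfolding k_def k'_def h_def h'_def by (simp_all add: hyp2F1_reg_holomorphic)
  have "isCont \<psi> 0"
    unfolding \<psi>_def by (intro continuous_intros) auto
  then have "(\<lambda>n. \<psi> (complex_of_real (1 / real (n + 2)))) \<longlonglongrightarrow> \<psi> 0"
    using unit_interval_sequence(1) by (rule isCont_tendsto_compose)
  moreover have "\<psi> (complex_of_real (1 / real (n + 2))) = K" for n
    using \<psi>[OF unit_interval_sequence(2)[of n]] K[OF unit_interval_sequence(2)[of n]]
    by (metis add_diff_cancel_left' diff_add_cancel)
  ultimately have "\<psi> 0 = K" by (simp add: LIMSEQ_const_iff)
  then have "K = - d * rGamma (1 - d) * rGamma (1 + d)"
    by (simp add: \<psi>_def k_def h_def hyp2F1_reg_0 mult_ac)
  then show ?thesis using K[OF u] by simp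
qed

text \<open>Cramer's rule: f W(g1, g2) = g1 W(f, g2) - g2 W(f, g1) holds pointwise, and times the
  weight of Abel's identity all three Wronskians are constant. As d is not an integer,
  \<open>rGamma (1 - d)\<close> and \<open>rGamma (1 + d)\<close> are nonzero, so W(g1, g2) can be
  divided out.\<close>

lemma hypergeo_connection_exists:
  assumes d: "c - a - b \<notin> \<int>"
  obtains \<alpha> \<beta> where "hypergeo_connection a b c \<alpha> \<beta>"
proof -
  define d where "d = c - a - b"
  define f f' where "f = hyp2F1_reg a b c" and "f' = hyp2F1_reg' a b c"
  define g1 g1' where "g1 = (\<lambda>u. hyp2F1_reg a b (1 - d) (1 - u))"
    and "g1' = (\<lambda>u. - hyp2F1_reg' a b (1 - d) (1 - u))"
  define g2 g2' where "g2 = (\<lambda>u. (1 - u) powr d * hyp2F1_reg (c - a) (c - b) (1 + d) (1 - u))"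
    and "g2' = (\<lambda>u. - ((1 - u) powr d * (d * hyp2F1_reg (c - a) (c - b) (1 + d) (1 - u) / (1 - u)
        + hyp2F1_reg' (c - a) (c - b) (1 + d) (1 - u))))"
  have sol: "hypergeo_solution a b c f f'" "hypergeo_solution a b c g1 g1'" "hypergeo_solution a b c g2 g2'"
    using hypergeo_solution_at_0 hypergeo_solution_at_1 hypergeo_solution_at_1'
    by (simp_all add: f_def f'_def g1_def g1'_def g2_def g2'_def d_def)
  define p where "p = (\<lambda>u. u powr c * (1 - u) powr (a + b + 1 - c))"
  obtain K1 where K1: "\<And>u. u \<in> doubly_cut_plane \<Longrightarrow> p u * (f u * g1' u - f' u * g1 u) = K1"
    unfolding p_def using Wronskian_constant[OF sol(1,2)] by metis
  obtain K2 where K2: "\<And>u. u \<in> doubly_cut_plane \<Longrightarrow> p u * (f u * g2' u - f' u * g2 u) = K2"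
    unfolding p_def using Wronskian_constant[OF sol(1,3)] by metis
  define K where "K = - d * rGamma (1 - d) * rGamma (1 + d)"
  have K: "p u * (g1 u * g2' u - g1' u * g2 u) = K" if "u \<in> doubly_cut_plane" for u
    using Wronskian_at_1[OF that, of c a b]
    by (simp add: p_def K_def g1_def g1'_def g2_def g2'_def d_def)
  have "d \<noteq> 0" "1 - d \<notin> \<int>" "1 + d \<notin> \<int>"
    using d by (auto simp: d_def Ints_diff add.commute[of 1] dest: Ints_diff[OF Ints_1])
  then have "K \<noteq> 0" using rGamma_nonzero by (simp add: K_def)
  have "f u = (K2 / K) * g1 u + (- K1 / K) * g2 u" if "u \<in> doubly_cut_plane" for u
  proof -
    have "K * f u = K2 * g1 u - K1 * g2 u"
      unfolding K1[OF that, symmetric] K2[OF that, symmetric] K[OF that, symmetric]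
      by (simp add: algebra_simps)
    then show ?thesis using \<open>K \<noteq> 0\<close> by (simp add: field_simps)
  qed
  then have "hypergeo_connection a b c (K2 / K) (- K1 / K)"
    unfolding hypergeo_connection_def f_def g1_def g2_def d_def by blast
  then show ?thesis by (rule that)
qed

text \<open>The differences of the coefficients solve a homogeneous linear system, formed by values
  and derivatives at u = 1/2, whose determinant is the nonzero Wronskian.\<close>

lemma hypergeo_connection_unique:
  assumes d: "c - a - b \<notin> \<int>"
    and 1: "hypergeo_connection a b c \<alpha> \<beta>" and 2: "hypergeo_connection a b c \<alpha>' \<beta>'"
  shows "\<alpha> = \<alpha>'" "\<beta> = \<beta>'"
proof -
  define d where "d = c - a - b"
  define g1 g1' where "g1 = (\<lambda>u. hyp2F1_reg a b (1 - d) (1 - u))"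
    and "g1' = (\<lambda>u. - hyp2F1_reg' a b (1 - d) (1 - u))"
  define g2 g2' where "g2 = (\<lambda>u. (1 - u) powr d * hyp2F1_reg (c - a) (c - b) (1 + d) (1 - u))"
    and "g2' = (\<lambda>u. - ((1 - u) powr d * (d * hyp2F1_reg (c - a) (c - b) (1 + d) (1 - u) / (1 - u)
        + hyp2F1_reg' (c - a) (c - b) (1 + d) (1 - u))))"
  define A B where "A = \<alpha> - \<alpha>'" and "B = \<beta> - \<beta>'"
  have zero: "A * g1 u + B * g2 u = 0" if "u \<in> doubly_cut_plane" for u
    using 1 2 that unfolding hypergeo_connection_def A_def B_def g1_def g2_def d_def
    by (simp add: algebra_simps)
  define u :: complex where "u = 1 - complex_of_real (1 / real (0 + 2))"
  have u: "u \<in> doubly_cut_plane" unfolding u_def by (rule unit_interval_sequence)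
  have "(g1 has_field_derivative g1' u) (at u)" "(g2 has_field_derivative g2' u) (at u)"
    using hypergeo_solution_at_1[of a b c] hypergeo_solution_at_1'[of a b c] u
    unfolding hypergeo_solution_def g1_def g1'_def g2_def g2'_def d_def by blast+
  then have "((\<lambda>u. A * g1 u + B * g2 u) has_field_derivative A * g1' u + B * g2' u) (at u)"
    by (intro DERIV_add DERIV_cmult)
  moreover have "((\<lambda>u. A * g1 u + B * g2 u) has_field_derivative 0) (at u)"
    by (rule has_field_derivative_transform_within_open[OF DERIV_const open_doubly_cut_plane u, of 0])
       (simp add: zero)
  ultimately have zero': "A * g1' u + B * g2' u = 0" by (rule DERIV_unique)
  define W where "W = g1 u * g2' u - g1' u * g2 u"
  define K where "K = - d * rGamma (1 - d) * rGamma (1 + d)"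
  have K: "u powr c * (1 - u) powr (a + b + 1 - c) * W = K"
    using Wronskian_at_1[OF u, of c a b]
    by (simp add: W_def K_def g1_def g1'_def g2_def g2'_def d_def)
  have "d \<noteq> 0" "1 - d \<notin> \<int>" "1 + d \<notin> \<int>"
    using d by (auto simp: d_def Ints_diff add.commute[of 1] dest: Ints_diff[OF Ints_1])
  then have "K \<noteq> 0" using rGamma_nonzero by (simp add: K_def)
  then have "W \<noteq> 0" using K by auto
  have "A * W = (A * g1 u + B * g2 u) * g2' u - (A * g1' u + B * g2' u) * g2 u"
    by (simp add: W_def algebra_simps)
  then have "A = 0" using zero[OF u] zero' \<open>W \<noteq> 0\<close> by simp
  have "B * W = (A * g1' u + B * g2' u) * g1 u - (A * g1 u + B * g2 u) * g1' u"
    by (simp add: W_def algebra_simps)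
  then have "B = 0" using zero[OF u] zero' \<open>W \<noteq> 0\<close> by simp
  show "\<alpha> = \<alpha>'" "\<beta> = \<beta>'" using \<open>A = 0\<close> \<open>B = 0\<close> by (auto simp: A_def B_def)
qed

text \<open>Apply u d/du + c to both sides. In the variable v = 1 - u the operator turns into minus
  the raising relation on the first solution and minus the lowering relation on the second, hence
  the signs; the product (c - a) (c - b) comes from the raising relation.\<close>

lemma hypergeo_connection_lower:
  assumes "hypergeo_connection a b (c + 1) \<alpha> \<beta>"
  shows "hypergeo_connection a b c (- \<alpha> * (c - a) * (c - b)) (- \<beta>)"
  unfolding hypergeo_connection_def
proof
  fix u assume uu: "u \<in> doubly_cut_plane"
  note u = doubly_cut_planeD[OF uu]
  define d where "d = c - a - b"
  define v where "v = 1 - u"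
  have dd: "c + 1 - a - b = d + 1" "1 - (d + 1) = - d" "1 + (d + 1) = d + 2" by (auto simp: d_def)
  define k h k' h' where "k = hyp2F1_reg a b (- d)" and "h = hyp2F1_reg (c + 1 - a) (c + 1 - b) (d + 2)"
    and "k' = hyp2F1_reg' a b (- d)" and "h' = hyp2F1_reg' (c + 1 - a) (c + 1 - b) (d + 2)"
  have eq: "hyp2F1_reg a b (c + 1) u = \<alpha> * k (1 - u) + \<beta> * ((1 - u) powr (d + 1) * h (1 - u))"
    if "u \<in> doubly_cut_plane" for u
    using assms that unfolding hypergeo_connection_def dd k_def h_def by blast
  have dh: "((\<lambda>u. h (1 - u)) has_field_derivative - h' (1 - u)) (at u)"
    and dk: "((\<lambda>u. k (1 - u)) has_field_derivative - k' (1 - u)) (at u)"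
    unfolding h_def h'_def k_def k'_def by (intro DERIV_one_minus has_field_derivative_hyp2F1_reg u)+
  note dp = powr_derivative_one_minus[OF u(4), of "d + 1"]
  have "((\<lambda>u. \<alpha> * k (1 - u) + \<beta> * ((1 - u) powr (d + 1) * h (1 - u))) has_field_derivative
     (\<alpha> * (- k' v) + \<beta> * (- (d + 1) * (v powr (d + 1) / v) * h v + - h' v * v powr (d + 1)))) (at u)"
    unfolding v_def by (intro DERIV_add DERIV_cmult DERIV_mult dp dh dk)
  then have "(hyp2F1_reg a b (c + 1) has_field_derivative
     (\<alpha> * (- k' v) + \<beta> * (- (d + 1) * (v powr (d + 1) / v) * h v + - h' v * v powr (d + 1)))) (at u)"
    by (rule has_field_derivative_transform_within_open[OF _ open_doubly_cut_plane uu]) (simp add: eq)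
  with has_field_derivative_hyp2F1_reg[OF u(1), of a b "c + 1"]
  have D: "hyp2F1_reg' a b (c + 1) u =
     \<alpha> * (- k' v) + \<beta> * (- (d + 1) * (v powr (d + 1) / v) * h v + - h' v * v powr (d + 1))"
    by (rule DERIV_unique)
  have v0: "v \<noteq> 0" using u by (simp add: v_def)
  have pv: "v powr (d + 1) = v powr d * v" using v0 by (simp add: powr_add)
  have "hyp2F1_reg a b c u = u * hyp2F1_reg' a b (c + 1) u + c * hyp2F1_reg a b (c + 1) u"
    using hyp2F1_reg_lower_c[OF u(1), of a b "c + 1"] by simp
  also have "\<dots> = - \<alpha> * ((1 - v) * k' v - c * k v) -
      \<beta> * (v powr d * ((1 - v) * (v * h' v + (d + 1) * h v) - c * (v * h v)))"
  proof -
    have uv: "u = 1 - v" by (simp add: v_def)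
    have "v powr d * v / v = v powr d" using v0 by simp
    then show ?thesis
      unfolding D eq[OF uu] v_def[symmetric] pv unfolding uv by (simp add: algebra_simps)
  qed
  also have "(1 - v) * k' v - c * k v = (- d - a) * (- d - b) * hyp2F1_reg a b (- d + 1) v"
    unfolding k_def k'_def
    using hyp2F1_reg_raise_c[of v a b "- d"] u(2) by (simp add: v_def d_def)
  also have "(1 - v) * (v * h' v + (d + 1) * h v) - c * (v * h v) = hyp2F1_reg (c - a) (c - b) (d + 1) v"
  proof -
    have "d + 2 - 1 = d + 1" "c + 1 - a + (c + 1 - b) - (d + 2) = c" "c + 1 - a - 1 = c - a" "c + 1 - b - 1 = c - b"
      by (simp_all add: d_def)
    with hyp2F1_reg_lower_all[of v "c + 1 - a" "c + 1 - b" "d + 2"] u(2)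
    show ?thesis unfolding h_def h'_def v_def by (simp only:)
  qed
  finally show "hyp2F1_reg a b c u =
     - \<alpha> * (c - a) * (c - b) * hyp2F1_reg a b (1 - (c - a - b)) (1 - u) +
     - \<beta> * ((1 - u) powr (c - a - b) * hyp2F1_reg (c - a) (c - b) (1 + (c - a - b)) (1 - u))"
    by (simp add: d_def v_def add_ac algebra_simps)
qed

text \<open>Only the first coefficient is tracked; the second will be obtained from Euler's
  transformation.\<close>

lemma hypergeo_connection_lower_n:
  assumes "hypergeo_connection a b (c + of_nat n) \<alpha> \<beta>"
  shows "\<exists>\<beta>'. hypergeo_connection a b c ((- 1) ^ n * \<alpha> * pochhammer (c - a) n * pochhammer (c - b) n) \<beta>'"
  using assms
proof (induction n arbitrary: \<alpha> \<beta>)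
  case (Suc n)
  have "hypergeo_connection a b ((c + of_nat n) + 1) \<alpha> \<beta>"
    using Suc.prems by (simp add: add_ac)
  from Suc.IH[OF hypergeo_connection_lower[OF this]] show ?case
    by (simp add: pochhammer_Suc algebra_simps)
qed auto

text \<open>Pfaff's transformation twice, the second time with c - a in the role of the exponent; w
  / (w - 1) is an involution, so the argument returns to w.\<close>

lemma hyp2F1_reg_Euler:
  assumes w: "w \<in> cut_plane"
  shows "hyp2F1_reg a b c w = (1 - w) powr (c - a - b) * hyp2F1_reg (c - a) (c - b) c w"
proof -
  define z where "z = w / (w - 1)"
  have w1: "1 - w \<notin> \<real>\<^sub>\<le>\<^sub>0" "w \<noteq> 1" using w by (auto simp: mem_cut_plane_iff)
  then have z1: "1 - z = inverse (1 - w)" by (simp add: z_def field_simps)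
  then have z: "z \<in> cut_plane" using w1 by (simp add: mem_cut_plane_iff)
  have zw: "z / (z - 1) = w"
  proof -
    have "z - 1 = 1 / (w - 1)" using w1 by (simp add: z_def field_simps)
    then show ?thesis using w1 by (simp add: z_def)
  qed
  have "hyp2F1_reg a b c w = (1 - w) powr (- b) * hyp2F1_reg b (c - a) c z"
    using hyp2F1_reg_Pfaff[OF w, of a b c] by (simp add: z_def hyp2F1_reg_commute)
  also have "hyp2F1_reg b (c - a) c z = (1 - z) powr (- (c - a)) * hyp2F1_reg (c - b) (c - a) c w"
    using hyp2F1_reg_Pfaff[OF z, of b "c - a" c] by (simp add: zw)
  also have "(1 - z) powr (- (c - a)) = (1 - w) powr (c - a)"
    unfolding z1 using w1 by (simp add: powr_def Ln_inverse algebra_simps)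
  also have "(1 - w) powr - b * ((1 - w) powr (c - a) * hyp2F1_reg (c - b) (c - a) c w) =
      (1 - w) powr (- b + (c - a)) * hyp2F1_reg (c - b) (c - a) c w"
    by (simp only: powr_add mult.assoc)
  finally show ?thesis by (simp add: hyp2F1_reg_commute[of "c - a"] algebra_simps)
qed

section \<open>The series at 1 for large c\<close>

lemma Re_pos_imp_not_nonpos_Int: "Re z > 0 \<Longrightarrow> z \<notin> \<int>\<^sub>\<le>\<^sub>0"
  by (auto elim!: nonpos_Ints_cases)

text \<open>The bound equals 1 at j = 0, telescopes, and is independent of c. Consecutive bounds
  have ratio (j + 1) / (j + 3), so the step needs (K + j)^2 (j + 3) \<le> (C + j) (j + 1)^2 with C =
  Re c. The threshold for Re c makes this true coefficient by coefficient in j.\<close>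

lemma hypergeo_coeff_bound:
  fixes a b c :: complex and K :: real
  assumes K: "1 \<le> K" "norm a \<le> K" "norm b \<le> K" "3 * K\<^sup>2 + 6 * K + 1 \<le> Re c"
  shows "norm (pochhammer a j * pochhammer b j / (pochhammer c j * fact j)) \<le>
    2 / ((real j + 1) * (real j + 2))"
proof (induction j)
  case (Suc j)
  define J where "J = real j"
  define C where "C = Re c"
  have J: "J \<ge> 0" by (simp add: J_def)
  have C: "3 * K\<^sup>2 + 6 * K + 1 \<le> C" using K by (simp add: C_def)
  moreover have "0 \<le> K\<^sup>2" by simp
  ultimately have C: "3 * K\<^sup>2 + 6 * K + 1 \<le> C" "C > 0" using K(1) by linarith+
  have na: "norm (a + of_nat j) \<le> K + J" "norm (b + of_nat j) \<le> K + J"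
    using norm_triangle_ineq[of a "of_nat j"] norm_triangle_ineq[of b "of_nat j"] K by (auto simp: J_def)
  have nc: "C + J \<le> norm (c + of_nat j)"
    using complex_Re_le_cmod[of "c + of_nat j"] by (simp add: C_def J_def)
  have "(K + J)\<^sup>2 * (J + 3) = J ^ 3 + (2 * K + 3) * J\<^sup>2 + (K\<^sup>2 + 6 * K) * J + 3 * K\<^sup>2"
    by (simp add: power2_eq_square power3_eq_cube algebra_simps)
  also have "\<dots> \<le> J ^ 3 + (C + 2) * J\<^sup>2 + (2 * C + 1) * J + C"
  proof -
    have "0 \<le> K\<^sup>2" by simp
    with C(1) K(1) have 1: "2 * K + 3 \<le> C + 2" and 2: "K\<^sup>2 + 6 * K \<le> 2 * C + 1" and 3: "3 * K\<^sup>2 \<le> C"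
      by linarith+
    have 1: "(2 * K + 3) * J\<^sup>2 \<le> (C + 2) * J\<^sup>2" and 2: "(K\<^sup>2 + 6 * K) * J \<le> (2 * C + 1) * J"
      using J by (auto intro!: mult_right_mono 1 2)
    show ?thesis by (intro add_mono order_refl 1 2 3)
  qed
  also have "\<dots> = (C + J) * (J + 1) * (J + 1)"
    by (simp add: power2_eq_square power3_eq_cube algebra_simps)
  finally have ineq: "(K + J)\<^sup>2 / ((C + J) * (J + 1)) \<le> (J + 1) / (J + 3)"
    using C(2) J by (simp add: divide_simps mult_ac)
  have "norm (pochhammer a (Suc j) * pochhammer b (Suc j) / (pochhammer c (Suc j) * fact (Suc j))) =
     norm (pochhammer a j * pochhammer b j / (pochhammer c j * fact j)) *
     ((norm (a + of_nat j) * norm (b + of_nat j)) / (norm (c + of_nat j) * (J + 1)))"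
    by (simp add: pochhammer_Suc norm_mult norm_divide J_def norm_fact flip: of_nat_Suc) (simp add: algebra_simps)
  also have "(norm (a + of_nat j) * norm (b + of_nat j)) / (norm (c + of_nat j) * (J + 1)) \<le>
     (K + J)\<^sup>2 / ((C + J) * (J + 1))"
    unfolding power2_eq_square using na nc J C(2) K(1)
    by (intro frac_le mult_mono mult_pos_pos mult_nonneg_nonneg) auto
  also note ineq
  also have "norm (pochhammer a j * pochhammer b j / (pochhammer c j * fact j)) * ((J + 1) / (J + 3)) \<le>
     2 / ((J + 1) * (J + 2)) * ((J + 1) / (J + 3))"
    using Suc.IH J by (intro mult_right_mono) (auto simp: J_def)
  also have "\<dots> = 2 / ((real (Suc j) + 1) * (real (Suc j) + 2))"
    using J by (simp add: J_def[symmetric] divide_simps) (simp add: algebra_simps)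
  finally show ?case by (simp add: mult_left_mono)
qed simp

lemma summable_telescoping_bound: "summable (\<lambda>j. 2 / ((real j + 1) * (real j + 2)))"
proof -
  have "(\<lambda>j. 2 / (real j + 1)) \<longlonglongrightarrow> 0" by real_asymp
  then have "summable (\<lambda>j. 2 / (real j + 1) - 2 / (real (Suc j) + 1))"
    by (rule telescope_summable')
  also have "(\<lambda>j. 2 / (real j + 1) - 2 / (real (Suc j) + 1)) = (\<lambda>j. 2 / ((real j + 1) * (real j + 2)))"
    by (auto simp: fun_eq_iff divide_simps)
  finally show ?thesis .
qed

text \<open>Apart from the first term, which is 1, every term contains the factor a b / (c + n); the
  remaining series has raised parameters and a summable majorant independent of n.\<close>

lemma hypergeo_sum_tendsto_1:
  fixes a b c :: complex
  shows "(\<lambda>n. \<Sum>j. pochhammer a j * pochhammer b j / (pochhammer (c + of_nat n) j * fact j)) \<longlonglongrightarrow> 1"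
proof -
  define t :: "complex \<Rightarrow> complex \<Rightarrow> complex \<Rightarrow> nat \<Rightarrow> complex" where
    "t = (\<lambda>a b c j. pochhammer a j * pochhammer b j / (pochhammer c j * fact j))"
  define M :: "nat \<Rightarrow> real" where "M = (\<lambda>j. 2 / ((real j + 1) * (real j + 2)))"
  \<comment> \<open>The summand 1 leaves room for a + 1 and b + 1, to which the bound is applied as
    well.\<close>
  define K where "K = 1 + (norm a + norm b)"
  have K: "1 \<le> K" "norm a \<le> K" "norm b \<le> K" "norm (a + 1) \<le> K" "norm (b + 1) \<le> K"
    using norm_triangle_ineq[of a 1] norm_triangle_ineq[of b 1]
      norm_ge_zero[of a] norm_ge_zero[of b] unfolding K_def norm_one by linarith+
  have sM: "summable M" unfolding M_def by (rule summable_telescoping_bound)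
  have M0: "M j \<ge> 0" for j by (simp add: M_def)
  obtain N where N: "3 * K\<^sup>2 + 6 * K + 1 - Re c \<le> real N" using real_arch_simple by blast
  have est: "norm ((\<Sum>j. t a b (c + of_nat n) j) - 1) \<le> norm (a * b) * suminf M / (Re c + real n)" if n: "n \<ge> N" for n
  proof -
    let ?c = "c + of_nat n"
    have c: "3 * K\<^sup>2 + 6 * K + 1 \<le> Re ?c" using N n by simp
    then have c0: "Re ?c > 0" using K(1) by (smt (verit) zero_le_power2)
    have b1: "norm (t a b ?c j) \<le> M j" for j
      unfolding t_def M_def by (rule hypergeo_coeff_bound) (use K c in auto)
    have b2: "norm (t (a + 1) (b + 1) (?c + 1) j) \<le> M j" for j
      unfolding t_def M_def by (rule hypergeo_coeff_bound[of K]) (use K c in auto)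
    have sum: "summable (t a b ?c)" by (rule summable_comparison_test'[OF sM, of 0]) (rule b1)
    have "(\<Sum>j. t a b ?c j) - 1 = (\<Sum>j. t a b ?c (Suc j))"
      using suminf_split_head[OF sum] by (simp add: t_def)
    also have "norm \<dots> \<le> (\<Sum>j. norm (a * b) / Re ?c * M j)"
    proof (rule norm_suminf_le)
      show "summable (\<lambda>j. norm (a * b) / Re ?c * M j)" by (intro summable_mult sM)
      fix j
      have "t a b ?c (Suc j) = (a * b / ?c) * (t (a + 1) (b + 1) (?c + 1) j / of_nat (Suc j))"
        unfolding t_def pochhammer_rec by (simp add: mult_ac)
      also have "norm \<dots> = norm (a * b) / norm ?c * (norm (t (a + 1) (b + 1) (?c + 1) j) / real (Suc j))"
        by (simp only: norm_mult norm_divide norm_of_nat)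
      also have "\<dots> \<le> norm (a * b) / Re ?c * M j"
      proof (intro mult_mono)
        show "norm (a * b) / norm ?c \<le> norm (a * b) / Re ?c"
          using c0 complex_Re_le_cmod[of ?c] by (intro divide_left_mono) (auto intro!: mult_pos_pos)
        have "norm (t (a + 1) (b + 1) (?c + 1) j) / real (Suc j) \<le> norm (t (a + 1) (b + 1) (?c + 1) j)"
          using mult_left_mono[of 1 "1 + real j" "norm (t (a + 1) (b + 1) (?c + 1) j)"]
          by (simp add: divide_simps)
        also note b2
        finally show "norm (t (a + 1) (b + 1) (?c + 1) j) / real (Suc j) \<le> M j" .
      qed (use c0 in auto)
      finally show "norm (t a b ?c (Suc j)) \<le> norm (a * b) / Re ?c * M j" .
    qed
    also have "\<dots> = norm (a * b) / Re ?c * suminf M" by (rule suminf_mult[OF sM])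
    finally show ?thesis by simp
  qed
  have "(\<lambda>n. X / (Y + real n)) \<longlonglongrightarrow> 0" for X Y :: real
    by real_asymp
  then have "(\<lambda>n. norm (a * b) * suminf M / (Re c + real n)) \<longlonglongrightarrow> 0" .
  then have "(\<lambda>n. (\<Sum>j. t a b (c + of_nat n) j) - 1) \<longlonglongrightarrow> 0"
    by (rule Lim_null_comparison[rotated]) (rule eventually_mono[OF eventually_ge_at_top[of N]], rule est)
  then show ?thesis unfolding t_def by (simp add: LIM_zero_iff)
qed

text \<open>The first connection coefficient is read off from the limit of the series at \<open>1\<close>, which
  exists as soon as the real part of \<open>c\<close> is large.\<close>

lemma hypergeo_connection_large_c:
  fixes a b c :: complex and K :: real
  assumes K: "1 \<le> K" "norm a \<le> K" "norm b \<le> K" "3 * K\<^sup>2 + 6 * K + 1 \<le> Re c"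
    and conn: "hypergeo_connection a b c \<alpha> \<beta>"
  shows "\<alpha> * rGamma (1 - (c - a - b)) =
    rGamma c * (\<Sum>j. pochhammer a j * pochhammer b j / (pochhammer c j * fact j))"
proof -
  define d where "d = c - a - b"
  have "2 * K < Re c" using K(1,4) by (smt (verit) zero_le_power2)
  then have d: "Re d > 0"
    using K(2,3) complex_Re_le_cmod[of a] complex_Re_le_cmod[of b] by (simp add: d_def)
  have c0: "Re c > 0" using \<open>2 * K < Re c\<close> K(1) by simp
  define t where "t = (\<lambda>j. pochhammer a j * pochhammer b j / (pochhammer c j * fact j))"
  define M :: "nat \<Rightarrow> real" where "M = (\<lambda>j. 2 / ((real j + 1) * (real j + 2)))"
  have sM: "summable M" unfolding M_def by (rule summable_telescoping_bound)
  have tM: "norm (t j) \<le> M j" for j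
    unfolding t_def M_def by (rule hypergeo_coeff_bound) (use K in auto)
  have nth: "fps_hyp2F1_reg a b c $ j = rGamma c * t j" for j
  proof -
    have "c \<notin> \<int>\<^sub>\<le>\<^sub>0" using c0 by (rule Re_pos_imp_not_nonpos_Int)
    then have "pochhammer c j \<noteq> 0" by (auto dest: pochhammer_eq_0_imp_nonpos_Int)
    then show ?thesis
      unfolding pochhammer_rGamma[of c j] by (simp add: fps_hyp2F1_reg_nth t_def)
  qed
  define v where "v = (\<lambda>n. complex_of_real (1 / real (n + 2)))"
  have v: "v \<longlonglongrightarrow> 0" "1 - v n \<in> doubly_cut_plane" for n
    unfolding v_def by (rule unit_interval_sequence)+
  have nv: "norm (1 - v n) < 1" for n
  proof -
    have "1 - v n = complex_of_real (1 - 1 / real (n + 2))" by (simp add: v_def)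
    then have "norm (1 - v n) = \<bar>1 - 1 / real (n + 2)\<bar>" by (simp only: norm_of_real)
    moreover have "0 < 1 / real (n + 2)" "1 / real (n + 2) \<le> 1" by auto
    ultimately show ?thesis by simp
  qed
  \<comment> \<open>Abel's limit at 1 by dominated convergence: the telescoping majorant does not
    depend on n.\<close>
  have L1: "(\<lambda>n. \<Sum>j. t j * (1 - v n) ^ j) \<longlonglongrightarrow> (\<Sum>j. t j)"
  proof -
    have "(\<lambda>n. t j * (1 - v n) ^ j) \<longlonglongrightarrow> t j * (1 - 0) ^ j" for j
      by (intro tendsto_intros v)
    then have lim: "(\<lambda>n. t j * (1 - v n) ^ j) \<longlonglongrightarrow> t j" for j by simp
    have bound: "norm (t j * (1 - v n) ^ j) \<le> M j" for j n
    proof -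
      have "norm (t j * (1 - v n) ^ j) \<le> norm (t j) * 1"
        unfolding norm_mult norm_power using nv[of n] by (intro mult_left_mono power_le_one) auto
      then show ?thesis using tM[of j] by simp
    qed
    show ?thesis
      using tannerys_theorem[of "\<lambda>j n. t j * (1 - v n) ^ j" t sequentially M, OF lim _ sM] bound
      by (simp add: case_prod_unfold)
  qed
  have f: "hyp2F1_reg a b c (1 - v n) = rGamma c * (\<Sum>j. t j * (1 - v n) ^ j)" for n
  proof -
    have "hyp2F1_reg a b c (1 - v n) = (\<Sum>j. rGamma c * (t j * (1 - v n) ^ j))"
      using nv[of n] by (simp add: hyp2F1_reg_eq_eval_fps eval_fps_def nth mult.assoc)
    also have "\<dots> = rGamma c * (\<Sum>j. t j * (1 - v n) ^ j)"
    proof (rule suminf_mult)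
      have "norm (t j * (1 - v n) ^ j) \<le> M j" for j
      proof -
        have "norm (t j * (1 - v n) ^ j) \<le> norm (t j) * 1"
          unfolding norm_mult norm_power using nv[of n] by (intro mult_left_mono power_le_one) auto
        then show ?thesis using tM[of j] by simp
      qed
      then show "summable (\<lambda>j. t j * (1 - v n) ^ j)"
        by (intro summable_comparison_test'[OF sM, of 0])
    qed
    finally show ?thesis .
  qed
  have cont: "(\<lambda>n. hyp2F1_reg A B C (v n)) \<longlonglongrightarrow> rGamma C" for A B C
  proof -
    have "0 \<in> cut_plane" by (simp add: mem_cut_plane_iff)
    then have "isCont (hyp2F1_reg A B C) 0" by (rule DERIV_isCont[OF has_field_derivative_hyp2F1_reg])
    from isCont_tendsto_compose[OF this v(1)] show ?thesis by (simp add: hyp2F1_reg_0)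
  qed
  \<comment> \<open>As Re d > 0, the second solution at 1 tends to 0, so the limit isolates
    \<alpha>.\<close>
  have "(\<lambda>n. (1 / real (n + 2)) powr Re d) \<longlonglongrightarrow> 0"
    using d by real_asymp
  moreover have "norm (v n powr d) = (1 / real (n + 2)) powr Re d" for n
    unfolding v_def by (subst norm_powr_real_powr) auto
  ultimately have "(\<lambda>n. norm (v n powr d)) \<longlonglongrightarrow> 0" by (simp only:)
  then have vd: "(\<lambda>n. v n powr d) \<longlonglongrightarrow> 0" by (rule tendsto_norm_zero_cancel)
  have "(\<lambda>n. \<alpha> * hyp2F1_reg a b (1 - d) (v n) + \<beta> * (v n powr d * hyp2F1_reg (c - a) (c - b) (1 + d) (v n)))
     \<longlonglongrightarrow> \<alpha> * rGamma (1 - d) + \<beta> * (0 * rGamma (1 + d))"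
    by (intro tendsto_intros cont vd)
  also have "(\<lambda>n. \<alpha> * hyp2F1_reg a b (1 - d) (v n) + \<beta> * (v n powr d * hyp2F1_reg (c - a) (c - b) (1 + d) (v n))) =
      (\<lambda>n. hyp2F1_reg a b c (1 - v n))"
  proof
    fix n show "\<alpha> * hyp2F1_reg a b (1 - d) (v n) + \<beta> * (v n powr d * hyp2F1_reg (c - a) (c - b) (1 + d) (v n)) =
       hyp2F1_reg a b c (1 - v n)"
      using conn v(2)[of n] unfolding hypergeo_connection_def d_def by simp
  qed
  finally have "(\<lambda>n. rGamma c * (\<Sum>j. t j * (1 - v n) ^ j)) \<longlonglongrightarrow> \<alpha> * rGamma (1 - d)"
    by (simp add: f)
  moreover have "(\<lambda>n. rGamma c * (\<Sum>j. t j * (1 - v n) ^ j)) \<longlonglongrightarrow> rGamma c * (\<Sum>j. t j)"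
    by (intro tendsto_intros L1)
  ultimately show ?thesis unfolding t_def d_def by (rule LIMSEQ_unique)
qed

section \<open>Values of the connection coefficients\<close>

lemma rGamma_one_minus_diff_nat: "rGamma (1 - (d + of_nat n)) = (- 1) ^ n * pochhammer d n * rGamma (1 - d)"
  for d :: complex
proof -
  have "rGamma (1 - d - of_nat n) = pochhammer (1 - d - of_nat n) n * rGamma (1 - d - of_nat n + of_nat n)"
    by (rule pochhammer_rGamma)
  also have "pochhammer (1 - d - of_nat n) n = (- 1) ^ n * pochhammer d n"
    using pochhammer_minus'[of "- d" n] by (simp add: algebra_simps)
  finally show ?thesis by (simp add: algebra_simps)
qed

text \<open>Gauss's product for 1 / Gamma: it turns quotients of Pochhammer symbols into
  limits.\<close>

lemma rGamma_series_conv: "pochhammer z (Suc n) = rGamma_series z n * (fact n * exp (z * of_real (ln (of_nat n))))"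
  for z :: complex
  by (simp add: rGamma_series_def)

text \<open>By uniqueness the coefficient at c is the one at c + n times Pochhammer symbols; letting
  n tend to infinity turns these into \<open>rGamma\<close> and the series at 1 into 1. The product
  form avoids dividing by \<open>rGamma\<close> of c - a or c - b, which may vanish.\<close>

lemma hypergeo_connection_coeff:
  assumes d: "c - a - b \<notin> \<int>" and conn: "hypergeo_connection a b c \<alpha> \<beta>"
  shows "\<alpha> * (rGamma (c - a - b) * rGamma (1 - (c - a - b))) = rGamma (c - a) * rGamma (c - b)"
proof -
  have step: "\<alpha> = (- 1) ^ n * \<alpha>' * pochhammer (c - a) n * pochhammer (c - b) n"
    if "hypergeo_connection a b (c + of_nat n) \<alpha>' \<beta>'" "c - a - b \<notin> \<int>" "hypergeo_connection a b c \<alpha> \<beta>" for c \<alpha> \<beta> n \<alpha>' \<beta>'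
    using hypergeo_connection_lower_n[OF that(1)] hypergeo_connection_unique(1)[OF that(2,3)] by blast
  have shift: "c + of_nat n - a - b \<notin> \<int>" "c + of_nat n - a - b = (c - a - b) + of_nat n" if "c - a - b \<notin> \<int>" for c n
  proof -
    show eq: "c + of_nat n - a - b = (c - a - b) + of_nat n" by simp
    show "c + of_nat n - a - b \<notin> \<int>" using that unfolding eq by (metis Ints_diff Ints_of_nat add_diff_cancel_right')
  qed
  have main: "\<alpha> * (rGamma (c - a - b) * rGamma (1 - (c - a - b))) = rGamma (c - a) * rGamma (c - b)"
    if d: "c - a - b \<notin> \<int>" and conn: "hypergeo_connection a b c \<alpha> \<beta>" and c: "c \<notin> \<int>\<^sub>\<le>\<^sub>0" for c \<alpha> \<beta>
  proof -
    define d where "d = c - a - b"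
    define T where "T = (\<lambda>n. \<Sum>j. pochhammer a j * pochhammer b j / (pochhammer (c + of_nat n) j * fact j))"
    define K where "K = 1 + (norm a + norm b)"
    obtain N where N: "3 * K\<^sup>2 + 6 * K + 1 - Re c \<le> real N" using real_arch_simple by blast
    \<comment> \<open>The coefficient at c + n is eliminated between its value for large parameters
      and the recurrence.\<close>
    have eq: "\<alpha> * rGamma (1 - d) * (pochhammer d n * pochhammer c n) =
       pochhammer (c - a) n * pochhammer (c - b) n * (rGamma c * T n)" if n: "n \<ge> N" for n
    proof -
      obtain \<alpha>' \<beta>' where conn': "hypergeo_connection a b (c + of_nat n) \<alpha>' \<beta>'"
        using hypergeo_connection_exists[OF shift(1)[OF d]] by blast
      have "\<alpha>' * rGamma (1 - (d + of_nat n)) = rGamma (c + of_nat n) * T n"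
        unfolding T_def d_def shift(2)[OF d, symmetric]
        by (rule hypergeo_connection_large_c[OF _ _ _ _ conn', of K]) (use N n in \<open>auto simp: K_def\<close>)
      then have "\<alpha>' * ((- 1) ^ n * pochhammer d n * rGamma (1 - d)) = rGamma (c + of_nat n) * T n"
        by (simp only: rGamma_one_minus_diff_nat)
      then have "\<alpha>' * ((- 1) ^ n * pochhammer d n * rGamma (1 - d)) * (pochhammer c n * pochhammer (c - a) n * pochhammer (c - b) n)
         = (pochhammer c n * rGamma (c + of_nat n)) * T n * (pochhammer (c - a) n * pochhammer (c - b) n)"
        by simp
      then show ?thesis
        unfolding step[OF conn' d conn] pochhammer_rGamma[of c n, symmetric] by (simp add: mult_ac)
    qed
    have ev: "\<alpha> * rGamma (1 - d) * (rGamma_series d n * rGamma_series c n) =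
       rGamma_series (c - a) n * rGamma_series (c - b) n * (rGamma c * T (Suc n))" if n: "n \<ge> N" for n
    proof -
      define L where "L = complex_of_real (ln (of_nat n))"
      \<comment> \<open>The powers of n in Gauss's product cancel because d + c = (c - a) + (c -
        b).\<close>
      have "exp (d * L) * exp (c * L) = exp ((c - a) * L) * exp ((c - b) * L)"
        unfolding exp_add[symmetric] d_def by (simp add: algebra_simps)
      moreover have "(\<alpha> * rGamma (1 - d) * (rGamma_series d n * rGamma_series c n)) * (fact n * fact n * (exp (d * L) * exp (c * L))) =
        (rGamma_series (c - a) n * rGamma_series (c - b) n * (rGamma c * T (Suc n))) * (fact n * fact n * (exp ((c - a) * L) * exp ((c - b) * L)))"
        using eq[of "Suc n"] n unfolding rGamma_series_conv L_def by (simp add: mult_ac)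
      ultimately show ?thesis by simp
    qed
    have "(\<lambda>n. \<alpha> * rGamma (1 - d) * (rGamma_series d n * rGamma_series c n)) \<longlonglongrightarrow>
       \<alpha> * rGamma (1 - d) * (rGamma d * rGamma c)"
      by (intro tendsto_intros)
    moreover have "(\<lambda>n. rGamma_series (c - a) n * rGamma_series (c - b) n * (rGamma c * T (Suc n))) \<longlonglongrightarrow>
       rGamma (c - a) * rGamma (c - b) * (rGamma c * 1)"
      unfolding T_def by (intro tendsto_intros LIMSEQ_Suc hypergeo_sum_tendsto_1)
    then have "(\<lambda>n. \<alpha> * rGamma (1 - d) * (rGamma_series d n * rGamma_series c n)) \<longlonglongrightarrow>
       rGamma (c - a) * rGamma (c - b) * (rGamma c * 1)"
      by (rule Lim_transform_eventually)
         (rule eventually_mono[OF eventually_ge_at_top[of N]], rule ev[symmetric])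
    ultimately have "\<alpha> * rGamma (1 - d) * (rGamma d * rGamma c) = rGamma (c - a) * rGamma (c - b) * (rGamma c * 1)"
      by (rule LIMSEQ_unique)
    moreover have "rGamma c \<noteq> 0" using c by (simp add: rGamma_eq_zero_iff)
    ultimately show ?thesis by (simp add: d_def mult_ac)
  qed
  \<comment> \<open>The limit argument leaves a factor \<open>rGamma c\<close> on both sides, which
    is zero for nonpositive integers c; the recurrence therefore carries the result down from c + n
    with positive real part.\<close>
  obtain n where n: "\<bar>Re c\<bar> < real n" using reals_Archimedean2 by blast
  then have "Re (c + of_nat n) > 0" by simp
  then have cn: "c + of_nat n \<notin> \<int>\<^sub>\<le>\<^sub>0" by (rule Re_pos_imp_not_nonpos_Int)
  obtain \<alpha>' \<beta>' where conn': "hypergeo_connection a b (c + of_nat n) \<alpha>' \<beta>'"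
    using hypergeo_connection_exists[OF shift(1)[OF d]] by blast
  from main[OF shift(1)[OF d] conn' cn]
  have "\<alpha>' * (rGamma ((c - a - b) + of_nat n) * rGamma (1 - ((c - a - b) + of_nat n))) =
     rGamma ((c - a) + of_nat n) * rGamma ((c - b) + of_nat n)"
    by (simp add: algebra_simps)
  then have "\<alpha>' * (rGamma ((c - a - b) + of_nat n) * rGamma (1 - ((c - a - b) + of_nat n))) * (pochhammer (c - a) n * pochhammer (c - b) n) =
     (pochhammer (c - a) n * rGamma ((c - a) + of_nat n)) * (pochhammer (c - b) n * rGamma ((c - b) + of_nat n))"
    by simp
  then have *: "\<alpha>' * (rGamma ((c - a - b) + of_nat n) * ((- 1) ^ n * pochhammer (c - a - b) n * rGamma (1 - (c - a - b)))) *
     (pochhammer (c - a) n * pochhammer (c - b) n) = rGamma (c - a) * rGamma (c - b)"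
    by (simp only: rGamma_one_minus_diff_nat pochhammer_rGamma[of "c - a" n, symmetric] pochhammer_rGamma[of "c - b" n, symmetric])
  show ?thesis
    unfolding step[OF conn' d conn] *[symmetric] pochhammer_rGamma[of "c - a - b" n] by (simp add: mult_ac)
qed

text \<open>Replacing a, b by c - a, c - b changes d to -d, and the factor (1 - u)^d from Euler's
  transformation restores the original pair of solutions with their roles exchanged. The second
  coefficient is thus the first one for the new parameters.\<close>

theorem hyp2F1_reg_connection:
  fixes a b c :: complex
  defines "d \<equiv> c - a - b"
  assumes d: "d \<notin> \<int>" and u: "u \<in> doubly_cut_plane"
  shows "rGamma d * rGamma (1 - d) * hyp2F1_reg a b c u =
     rGamma (c - a) * rGamma (c - b) * hyp2F1_reg a b (1 - d) (1 - u) -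
     rGamma a * rGamma b * ((1 - u) powr d * hyp2F1_reg (c - a) (c - b) (1 + d) (1 - u))"
proof -
  have d': "c - (c - a) - (c - b) = - d" "- d \<notin> \<int>"
    using d by (simp add: d_def, metis Ints_minus minus_minus)
  obtain \<alpha> \<beta> where 1: "hypergeo_connection a b c \<alpha> \<beta>"
    using hypergeo_connection_exists d unfolding d_def by blast
  obtain \<alpha>' \<beta>' where 2: "hypergeo_connection (c - a) (c - b) c \<alpha>' \<beta>'"
    using hypergeo_connection_exists[of c "c - a" "c - b"] d' by metis
  have "hypergeo_connection a b c \<beta>' \<alpha>'"
    unfolding hypergeo_connection_def
  proof
    fix u assume uu: "u \<in> doubly_cut_plane"
    note u = doubly_cut_planeD[OF uu]
    have "hyp2F1_reg a b c u = (1 - u) powr d * hyp2F1_reg (c - a) (c - b) c u"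
      unfolding d_def by (rule hyp2F1_reg_Euler[OF u(1)])
    also have "hyp2F1_reg (c - a) (c - b) c u = \<alpha>' * hyp2F1_reg (c - a) (c - b) (1 - - d) (1 - u) +
       \<beta>' * ((1 - u) powr - d * hyp2F1_reg (c - (c - a)) (c - (c - b)) (1 + - d) (1 - u))"
      using 2 uu unfolding hypergeo_connection_def d' by blast
    also have "(1 - u) powr d * (\<alpha>' * hyp2F1_reg (c - a) (c - b) (1 - - d) (1 - u) +
       \<beta>' * ((1 - u) powr - d * hyp2F1_reg (c - (c - a)) (c - (c - b)) (1 + - d) (1 - u))) =
       \<beta>' * hyp2F1_reg a b (1 - d) (1 - u) + \<alpha>' * ((1 - u) powr d * hyp2F1_reg (c - a) (c - b) (1 + d) (1 - u))"
    proof -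
      have "(1 - u) powr d * (1 - u) powr - d = 1"
        using u by (simp flip: powr_add)
      then have *: "(1 - u) powr d * (\<beta>' * ((1 - u) powr - d * x)) = \<beta>' * x" for x
        by (metis mult.assoc mult.left_commute mult_1)
      show ?thesis unfolding distrib_left * by (simp add: mult_ac add.commute)
    qed
    finally show "hyp2F1_reg a b c u = \<beta>' * hyp2F1_reg a b (1 - (c - a - b)) (1 - u) +
       \<alpha>' * ((1 - u) powr (c - a - b) * hyp2F1_reg (c - a) (c - b) (1 + (c - a - b)) (1 - u))"
      unfolding d_def .
  qed
  then have "\<beta> = \<alpha>'" using hypergeo_connection_unique(2)[OF _ 1] d unfolding d_def by blast
  have "\<alpha> * (rGamma d * rGamma (1 - d)) = rGamma (c - a) * rGamma (c - b)"
    unfolding d_def using hypergeo_connection_coeff[OF _ 1] d unfolding d_def by blast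
  moreover have "\<beta> * (rGamma d * rGamma (1 - d)) = - (rGamma a * rGamma b)"
  proof -
    have "\<beta> * (rGamma (- d) * rGamma (1 - - d)) = rGamma (c - (c - a)) * rGamma (c - (c - b))"
      unfolding \<open>\<beta> = \<alpha>'\<close> d'(1)[symmetric]
      by (rule hypergeo_connection_coeff[OF _ 2]) (use d' in simp)
    \<comment> \<open>The minus sign in front of the second coefficient originates here.\<close>
    moreover have "rGamma d = d * rGamma (1 + d)" "rGamma (- d) = - d * rGamma (1 - d)"
      using rGamma_plus1[of d] rGamma_plus1[of "- d"] by (auto simp: add.commute)
    then have "rGamma (- d) * rGamma (1 - - d) = - (rGamma d * rGamma (1 - d))" by simp
    ultimately show ?thesis by (simp add: minus_equation_iff)
  qed
  moreover have "hyp2F1_reg a b c u = \<alpha> * hyp2F1_reg a b (1 - d) (1 - u) +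
     \<beta> * ((1 - u) powr d * hyp2F1_reg (c - a) (c - b) (1 + d) (1 - u))"
    using 1 u unfolding hypergeo_connection_def d_def by blast
  then have "rGamma d * rGamma (1 - d) * hyp2F1_reg a b c u =
     (\<alpha> * (rGamma d * rGamma (1 - d))) * hyp2F1_reg a b (1 - d) (1 - u) +
     (\<beta> * (rGamma d * rGamma (1 - d))) * ((1 - u) powr d * hyp2F1_reg (c - a) (c - b) (1 + d) (1 - u))"
    by (simp add: algebra_simps)
  ultimately show ?thesis by simp
qed

section \<open>Boundary values of the Legendre function\<close>

lemma exp_not_nonpos_Real:
  assumes "\<bar>Im w\<bar> < pi"
  shows "exp w \<notin> \<real>\<^sub>\<le>\<^sub>0"
proof
  assume w: "exp w \<in> \<real>\<^sub>\<le>\<^sub>0"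
  have "Ln (exp w) = w" using assms by (intro Ln_exp) auto
  moreover have "Im (Ln (exp w)) = pi"
  proof -
    have "\<not> (Re (exp w) = 0 \<and> Im (exp w) = 0)"
      using exp_not_eq_zero[of w] unfolding complex_eq_iff by simp
    then have "Re (exp w) < 0 \<and> Im (exp w) = 0"
      using w unfolding complex_nonpos_Reals_iff by linarith
    then show ?thesis using Im_Ln_eq_pi[of "exp w"] by simp
  qed
  ultimately show False using assms by simp
qed

lemma exp_mem_cut_plane:
  assumes "0 < \<bar>Im w\<bar>" "\<bar>Im w\<bar> < 2 * pi"
  shows "exp w \<in> cut_plane"
proof (rule ccontr)
  assume "exp w \<notin> cut_plane"
  then have *: "Im (exp w) = 0" "Re (exp w) \<ge> 1"
    by (auto simp: mem_cut_plane_iff complex_nonpos_Reals_iff)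
  then have "exp w = of_real (Re (exp w))" by (simp add: complex_eq_iff)
  also have "\<dots> = exp (of_real (ln (Re (exp w))))" using * by (simp add: exp_of_real)
  finally have e: "exp w = exp (of_real (ln (Re (exp w))))" .
  have "w = of_real (ln (Re (exp w)))"
    by (rule exp_complex_eqI[OF _ e]) (use assms in simp)
  then have "Im w = 0" by (metis Im_complex_of_real)
  then show False using assms by simp
qed

lemma Im_Ln_bounds_signed:
  fixes s :: real
  assumes "s \<in> {1, -1}" "s * Im z > 0"
  shows "0 < s * Im (Ln z)" "s * Im (Ln z) < pi"
proof -
  have "0 < s * Im (Ln z) \<and> s * Im (Ln z) < pi"
  proof (cases "s = 1")
    case True
    then show ?thesis using assms Im_Ln_pos_lt_imp[of z] by simp
  next
    case False
    then have s: "s = - 1" "Im z < 0" using assms by auto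
    then have "z \<notin> \<real>\<^sub>\<le>\<^sub>0" by (auto simp: complex_nonpos_Reals_iff)
    then have "Ln (cnj z) = cnj (Ln z)" by (simp add: cnj_Ln)
    moreover have "0 < Im (Ln (cnj z)) \<and> Im (Ln (cnj z)) < pi"
      using s Im_Ln_pos_lt_imp[of "cnj z"] by simp
    ultimately show ?thesis using s by simp
  qed
  then show "0 < s * Im (Ln z)" "s * Im (Ln z) < pi" by auto
qed

lemma Re_sin_pos: "0 < Re \<theta> \<Longrightarrow> Re \<theta> < pi \<Longrightarrow> 0 < Re (sin \<theta>)"
  by (auto simp: Re_sin intro!: mult_pos_pos sin_gt_zero add_pos_pos)

text \<open>The sign is reversed: the upper half-plane corresponds to the lower half of the
  strip.\<close>

lemma Im_cos_signed:
  fixes s :: real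
  assumes "0 < Re \<theta>" "Re \<theta> < pi" "s \<in> {1, -1}"
  shows "s * Im (cos \<theta>) > 0 \<longleftrightarrow> s * Im \<theta> < 0"
proof -
  have "sin (Re \<theta>) > 0" using assms by (intro sin_gt_zero) auto
  then have "s * Im (cos \<theta>) > 0 \<longleftrightarrow> s * (exp (- Im \<theta>) - exp (Im \<theta>)) > 0"
    by (simp add: Im_cos zero_less_mult_iff mult_less_0_iff)
  then show ?thesis using assms(3) by auto
qed

lemma nonpos_Real_pos_Re: "Re z > 0 \<Longrightarrow> z \<notin> \<real>\<^sub>\<le>\<^sub>0"
  by (auto simp: complex_nonpos_Reals_iff)

text \<open>With z = cos theta it suffices that Ln (z + 1) + Ln (z - 1) = 2 Ln (sin theta) + i s pi.
  Both sides exponentiate to z^2 - 1, so only the imaginary parts must be compared.\<close>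

lemma legendre_factor_cos:
  fixes s :: real and \<mu> \<theta> :: complex
  assumes s: "s \<in> {1, -1}" and \<theta>: "0 < Re \<theta>" "Re \<theta> < pi" "s * Im \<theta> < 0"
  shows "(cos \<theta> + 1) powr (\<mu> / 2) * (cos \<theta> - 1) powr (\<mu> / 2) =
    sin \<theta> powr \<mu> * exp (\<i> * s * pi * \<mu> / 2)"
proof -
  define z where "z = cos \<theta>"
  have Im: "s * Im z > 0" using Im_cos_signed[OF \<theta>(1,2) s] \<theta>(3) by (simp add: z_def)
  then have nz: "z + 1 \<noteq> 0" "z - 1 \<noteq> 0" by (auto simp: complex_eq_iff)
  have sin: "Re (sin \<theta>) > 0" using Re_sin_pos[OF \<theta>(1,2)] .
  then have sin0: "sin \<theta> \<noteq> 0" by auto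
  have "Ln (z + 1) + Ln (z - 1) = 2 * Ln (sin \<theta>) + \<i> * s * pi"
  proof (rule exp_complex_eqI)
    have "exp (\<i> * s * pi) = -1" using s by (auto simp: exp_minus)
    then have "exp (2 * Ln (sin \<theta>) + \<i> * s * pi) = - (sin \<theta>)\<^sup>2"
      using sin0 by (simp add: exp_add exp_double)
    also have "\<dots> = (z + 1) * (z - 1)"
      by (simp add: z_def sin_squared_eq power2_eq_square algebra_simps)
    finally show "exp (Ln (z + 1) + Ln (z - 1)) = exp (2 * Ln (sin \<theta>) + \<i> * s * pi)"
      using nz by (simp add: exp_add)
    have 1: "0 < s * Im (Ln (z + 1))" "s * Im (Ln (z + 1)) < pi"
      by (rule Im_Ln_bounds_signed[OF s]; use Im in simp)+
    have 2: "0 < s * Im (Ln (z - 1))" "s * Im (Ln (z - 1)) < pi"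
      by (rule Im_Ln_bounds_signed[OF s]; use Im in simp)+
    have 3: "\<bar>Im (Ln (sin \<theta>))\<bar> < pi / 2" using sin Re_Ln_pos_lt[OF sin0] by simp
    \<comment> \<open>Multiplied by s, both imaginary parts lie strictly between 0 and 2 pi.\<close>
    show "\<bar>Im (Ln (z + 1) + Ln (z - 1)) - Im (2 * Ln (sin \<theta>) + \<i> * s * pi)\<bar> < 2 * pi"
      using s 1 2 3 by auto
  qed
  then have "exp (\<mu> / 2 * (Ln (z + 1) + Ln (z - 1))) = exp (\<mu> / 2 * (2 * Ln (sin \<theta>) + \<i> * s * pi))"
    by simp
  also have "\<mu> / 2 * (2 * Ln (sin \<theta>) + \<i> * s * pi) = \<mu> * Ln (sin \<theta>) + \<i> * s * pi * \<mu> / 2"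
    by (simp add: algebra_simps)
  finally show ?thesis
    using nz sin0 unfolding z_def[symmetric] powr_def by (simp add: exp_add[symmetric] algebra_simps)
qed

lemma cos_conv_exp_signed:
  fixes s :: real
  assumes "s \<in> {1, -1}"
  shows "1 + exp (- 2 * \<i> * s * \<theta>) = 2 * exp (- \<i> * s * \<theta>) * cos \<theta>"
proof -
  have "exp (- 2 * \<i> * s * \<theta>) = exp (- \<i> * s * \<theta>) * exp (- \<i> * s * \<theta>)"
    by (simp add: mult_ac flip: exp_add)
  moreover have "2 * cos \<theta> = exp (\<i> * s * \<theta>) + exp (- \<i> * s * \<theta>)"
    using assms by (auto simp: cos_exp_eq)
  moreover have "exp (- \<i> * s * \<theta>) * exp (\<i> * s * \<theta>) = 1" by (simp flip: exp_add)
  moreover have "2 * E * C = 1 + X" if "X = E * E" "2 * C = E' + E" "E * E' = 1" for X C E E' :: complex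
  proof -
    have "2 * E * C = E * (2 * C)" by simp
    then show ?thesis unfolding that by (simp add: distrib_left that)
  qed
  ultimately show ?thesis by metis
qed

text \<open>The candidate logarithm W has s Im W equal to a number in (0, pi) minus Re theta, hence
  in (-pi, pi), so it is the principal one.\<close>

lemma one_plus_exp_powr:
  fixes s :: real
  assumes s: "s \<in> {1, -1}" and \<theta>: "0 < Re \<theta>" "Re \<theta> < pi" "s * Im \<theta> < 0"
  shows "(1 + exp (- 2 * \<i> * s * \<theta>)) powr k = 2 powr k * exp (- \<i> * s * \<theta> * k) * cos \<theta> powr k"
proof -
  have Im: "s * Im (cos \<theta>) > 0" using Im_cos_signed[OF \<theta>(1,2) s] \<theta>(3) by simp
  then have z0: "cos \<theta> \<noteq> 0" by auto
  define W where "W = of_real (ln 2) - \<i> * s * \<theta> + Ln (cos \<theta>)"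
  have eW: "exp W = 1 + exp (- 2 * \<i> * s * \<theta>)"
    unfolding cos_conv_exp_signed[OF s] W_def using z0
    by (simp add: exp_add exp_diff exp_minus divide_inverse exp_of_real)
  have "0 < s * Im (Ln (cos \<theta>))" "s * Im (Ln (cos \<theta>)) < pi"
    by (rule Im_Ln_bounds_signed[OF s Im])+
  then have "Ln (1 + exp (- 2 * \<i> * s * \<theta>)) = W"
    unfolding eW[symmetric] using s \<theta> by (intro Ln_exp) (auto simp: W_def)
  moreover have "1 + exp (- 2 * \<i> * s * \<theta>) \<noteq> 0" unfolding eW[symmetric] by simp
  ultimately have "(1 + exp (- 2 * \<i> * s * \<theta>)) powr k = exp (k * W)"
    by (simp add: powr_def)
  also have "k * W = k * Ln 2 + (- \<i> * s * \<theta> * k) + k * Ln (cos \<theta>)"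
    using Ln_of_real[of 2] by (simp add: W_def algebra_simps)
  finally have "(1 + exp (- 2 * \<i> * s * \<theta>)) powr k =
      exp (k * Ln 2) * exp (- \<i> * s * \<theta> * k) * exp (k * Ln (cos \<theta>))"
    by (simp only: exp_add)
  moreover have "(2::complex) powr k = exp (k * Ln 2)" "cos \<theta> powr k = exp (k * Ln (cos \<theta>))"
    using z0 by (simp_all add: powr_def)
  ultimately show ?thesis by (simp only:)
qed

text \<open>The boundary values of \<open>legendreQ\<close> at \<open>cos \<theta>\<close> from the upper (\<open>s = 1\<close>) and lower
  (\<open>s = -1\<close>) half-plane, continued to complex \<open>\<theta>\<close>.\<close>

definition legendreQ_boundary :: "complex \<Rightarrow> complex \<Rightarrow> real \<Rightarrow> complex \<Rightarrow> complex" where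
  "legendreQ_boundary \<nu> \<mu> s \<theta> =
     of_real (sqrt pi) * exp (\<i> * of_real pi * \<mu>) * Gamma (\<nu> + \<mu> + 1) * 2 powr \<mu> * sin \<theta> powr \<mu>
       * exp (\<i> * s * pi * \<mu> / 2) * (exp (- \<i> * s * \<theta> * (\<nu> + \<mu> + 1))
       * hyp2F1_reg (\<nu> + \<mu> + 1) (\<mu> + 1 / 2) (\<nu> + 3 / 2) (exp (- 2 * \<i> * s * \<theta>)))"

text \<open>On the chosen side u = exp (-2 i s theta) lies in the unit disc and 1 / (cos theta)^2 =
  4u / (1 + u)^2. The power of 1 + u produced by the quadratic transformation contains the very
  power of cos theta that stands in the denominator of \<open>legendreQ\<close>, so the singularity
  at z = 0 disappears.\<close>

lemma legendreQ_cos: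
  fixes s :: real
  assumes s: "s \<in> {1, -1}" and \<theta>: "0 < Re \<theta>" "Re \<theta> < pi" "s * Im \<theta> < 0"
  shows "legendreQ \<nu> \<mu> (cos \<theta>) = legendreQ_boundary \<nu> \<mu> s \<theta>"
proof -
  define u where "u = exp (- 2 * \<i> * s * \<theta>)"
  have u: "norm u < 1" using s \<theta>(3) by (auto simp: u_def)
  have Im: "s * Im (cos \<theta>) > 0" using Im_cos_signed[OF \<theta>(1,2) s] \<theta>(3) by simp
  then have z0: "cos \<theta> \<noteq> 0" by auto
  have "(1 + u)\<^sup>2 = 4 * u * (cos \<theta>)\<^sup>2"
    unfolding u_def cos_conv_exp_signed[OF s] by (simp add: power2_eq_square mult_ac flip: exp_add)
  moreover have "u \<noteq> 0" by (simp add: u_def)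
  ultimately have zu: "1 / (cos \<theta>)\<^sup>2 = 4 * u / (1 + u)\<^sup>2" using z0 by simp
  define k where "k = \<nu> + \<mu> + 1"
  have "hyp2F1_reg ((\<nu> + \<mu> + 2) / 2) ((\<nu> + \<mu> + 1) / 2) (\<nu> + 3 / 2) (1 / (cos \<theta>)\<^sup>2) =
     hyp2F1_reg (k / 2) (k / 2 + 1 / 2) (\<nu> + 3 / 2) (4 * u / (1 + u)\<^sup>2)"
    unfolding zu by (subst hyp2F1_reg_commute) (simp add: k_def field_simps)
  also have "\<dots> = (1 + u) powr k * hyp2F1_reg k (\<mu> + 1 / 2) (\<nu> + 3 / 2) u"
  proof -
    have "2 * (k / 2) = k" "k - (\<nu> + 3 / 2) + 1 = \<mu> + 1 / 2" by (simp_all add: k_def field_simps)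
    then show ?thesis
      using hyp2F1_reg_quadratic[OF u, of "k / 2" "\<nu> + 3 / 2"] by (simp only:)
  qed
  also have "(1 + u) powr k = 2 powr k * exp (- \<i> * s * \<theta> * k) * cos \<theta> powr k"
    unfolding u_def by (rule one_plus_exp_powr[OF s \<theta>])
  finally have F: "hyp2F1_reg ((\<nu> + \<mu> + 2) / 2) ((\<nu> + \<mu> + 1) / 2) (\<nu> + 3 / 2) (1 / (cos \<theta>)\<^sup>2) =
     2 powr k * exp (- \<i> * s * \<theta> * k) * cos \<theta> powr k * hyp2F1_reg k (\<mu> + 1 / 2) (\<nu> + 3 / 2) u" .
  have "(2::complex) powr k = 2 powr (\<nu> + 1) * 2 powr \<mu>"
    unfolding powr_add[symmetric] k_def by (simp add: add_ac)
  moreover have "cos \<theta> powr k \<noteq> 0" using z0 by (simp add: powr_def)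
  ultimately show ?thesis
    unfolding legendreQ_def legendreQ_boundary_def F legendre_factor_cos[OF s \<theta>]
    unfolding k_def[symmetric] u_def[symmetric] by (simp add: field_simps)
qed

text \<open>Across the strip the argument 2 Re theta stays strictly between 0 and 2 pi, so exp (-2 i
  s theta) avoids the cut. Real theta, where \<open>legendreQ\<close> has only one-sided limits, are
  included.\<close>

lemma holomorphic_legendreQ_boundary:
  assumes s: "s \<in> {1, -1}"
  shows "legendreQ_boundary \<nu> \<mu> s holomorphic_on {\<theta>. 0 < Re \<theta> \<and> Re \<theta> < pi}" (is "_ holomorphic_on ?S")
proof -
  have "(\<lambda>\<theta>. exp (- 2 * \<i> * s * \<theta>)) holomorphic_on ?S" by (intro holomorphic_intros)
  moreover have "exp (- 2 * \<i> * s * \<theta>) \<in> cut_plane" if "\<theta> \<in> ?S" for \<theta>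
    using s that by (intro exp_mem_cut_plane) auto
  ultimately have "(hyp2F1_reg (\<nu> + \<mu> + 1) (\<mu> + 1 / 2) (\<nu> + 3 / 2) \<circ> (\<lambda>\<theta>. exp (- 2 * \<i> * s * \<theta>))) holomorphic_on ?S"
    by (rule holomorphic_on_compose_gen[OF _ holomorphic_hyp2F1_reg image_subsetI])
  then have h1: "(\<lambda>\<theta>. hyp2F1_reg (\<nu> + \<mu> + 1) (\<mu> + 1 / 2) (\<nu> + 3 / 2) (exp (- 2 * \<i> * s * \<theta>))) holomorphic_on ?S"
    by (simp only: o_def)
  have h2: "(\<lambda>\<theta>. sin \<theta> powr \<mu>) holomorphic_on ?S"
    by (intro holomorphic_intros) (auto intro!: nonpos_Real_pos_Re Re_sin_pos)
  have h3: "(\<lambda>\<theta>. exp (- \<i> * s * \<theta> * (\<nu> + \<mu> + 1))) holomorphic_on ?S"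
    by (intro holomorphic_intros)
  show ?thesis
    unfolding legendreQ_boundary_def by (intro holomorphic_on_mult holomorphic_on_const h1 h2 h3)
qed

section \<open>The domain of the Ferrers function and the inverse cosine\<close>

lemma mem_D1_iff: "z \<in> D1 \<longleftrightarrow> (Im z = 0 \<longrightarrow> \<bar>Re z\<bar> < 1)"
  by (auto simp: D1_def complex_eq_iff image_iff abs_less_iff not_le)

lemma D1_imp_not_nonpos_Real:
  assumes "z \<in> D1"
  shows "1 - z\<^sup>2 \<notin> \<real>\<^sub>\<le>\<^sub>0"
proof
  assume "1 - z\<^sup>2 \<in> \<real>\<^sub>\<le>\<^sub>0"
  then have *: "1 - (Re z)\<^sup>2 + (Im z)\<^sup>2 \<le> 0" "Re z * Im z = 0"
    by (auto simp: complex_nonpos_Reals_iff power2_eq_square)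
  have "Im z = 0"
  proof (rule ccontr)
    assume "Im z \<noteq> 0"
    then have "Re z = 0" using * by simp
    then show False using * by (simp add: add_nonneg_pos not_le) (smt (verit) zero_le_power2)
  qed
  then have "\<bar>Re z\<bar> < 1" "1 \<le> (Re z)\<^sup>2" using assms * by (auto simp: mem_D1_iff)
  then show False by (simp add: abs_square_less_1 [symmetric])
qed

text \<open>For w = z + i r one has w - 1/w = 2 i r, with imaginary part 2 Re r > 0. As w and w -
  1/w have imaginary parts of the same sign, the argument of w, which is the real part of
  \<open>Arccos z\<close>, lies in (0, pi).\<close>

lemma Re_Arccos_D1:
  assumes "z \<in> D1"
  shows "0 < Re (Arccos z)" "Re (Arccos z) < pi"
proof -
  define r where "r = csqrt (1 - z\<^sup>2)"
  define w where "w = z + \<i> * r"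
  have r: "Re r > 0" unfolding r_def by (rule Re_csqrt_pos[OF D1_imp_not_nonpos_Real[OF assms]])
  have r2: "r\<^sup>2 = 1 - z\<^sup>2" by (simp add: r_def)
  have "w * (z - \<i> * r) = z\<^sup>2 + r\<^sup>2" by (simp add: w_def power2_eq_square algebra_simps)
  then have "w * (z - \<i> * r) = 1" by (simp add: r2)
  then have inv: "inverse w = z - \<i> * r" by (rule inverse_unique)
  have "w - inverse w = 2 * \<i> * r" unfolding inv by (simp add: w_def)
  then have "Im (w - inverse w) = Im (2 * \<i> * r)" by (simp only:)
  then have "Im w * (1 + 1 / ((Re w)\<^sup>2 + (Im w)\<^sup>2)) > 0"
    using r by (simp add: Im_inverse algebra_simps)
  moreover have "1 + 1 / ((Re w)\<^sup>2 + (Im w)\<^sup>2) > 0" by (intro add_pos_nonneg) auto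
  ultimately have "Im w > 0" by (simp only: zero_less_mult_iff) auto
  then show "0 < Re (Arccos z)" "Re (Arccos z) < pi"
    using Im_Ln_pos_lt_imp[of w] unfolding Re_Arccos w_def r_def by auto
qed

lemma open_D1: "open D1"
proof -
  have "D1 = cut_plane \<inter> uminus -` cut_plane"
    by (auto simp: mem_D1_iff mem_cut_plane_iff complex_nonpos_Reals_iff)
  also have "open \<dots>" by (intro open_Int open_vimage open_cut_plane continuous_intros)
  finally show ?thesis .
qed

lemma connected_D1: "connected D1"
proof (rule starlike_imp_connected)
  have "closed_segment 0 w \<subseteq> D1" if w: "w \<in> D1" for w
  proof
    fix z assume "z \<in> closed_segment 0 w"
    then obtain t where t: "0 \<le> t" "t \<le> 1" "z = of_real t * w"
      by (auto simp: closed_segment_def scaleR_conv_of_real)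
    have "\<bar>Re z\<bar> < 1" if "Im z = 0"
    proof (cases "t = 0")
      case False
      then have "\<bar>Re w\<bar> < 1" using that w t by (auto simp: mem_D1_iff)
      then show ?thesis
        using t by (simp add: abs_mult) (metis abs_ge_zero dual_order.strict_trans2 mult_left_le_one_le)
    qed (use t in auto)
    then show "z \<in> D1" by (simp add: mem_D1_iff)
  qed
  then show "starlike D1" unfolding starlike_def by (intro bexI[of _ 0]) (auto simp: mem_D1_iff)
qed

lemma holomorphic_Arccos_D1: "Arccos holomorphic_on D1"
  by (rule holomorphic_on_Arccos) (auto simp: mem_D1_iff)

lemma at_within_half_plane_neq_bot:
  fixes s :: real
  assumes "s \<in> {1, -1}"
  shows "at (complex_of_real x) within {z. s * Im z > 0} \<noteq> bot"
proof -
  have "of_real x islimpt {z. s * Im z > 0}"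
    unfolding islimpt_approachable
  proof (intro allI impI)
    fix e :: real assume "e > 0"
    then show "\<exists>z\<in>{z. s * Im z > 0}. z \<noteq> of_real x \<and> dist z (of_real x) < e"
      using assms
      by (intro bexI[of _ "of_real x + \<i> * of_real (s * e / 2)"]) (auto simp: dist_norm norm_mult complex_eq_iff)
  qed
  then show ?thesis by (simp add: trivial_limit_within)
qed

text \<open>On the half-plane \<open>legendreQ\<close> agrees with a function holomorphic on all of
  \<open>D1\<close>, whose continuity at x gives the limit. \<open>Lim\<close> denotes this value
  only because the filter is nontrivial.\<close>

lemma Lim_legendreQ:
  fixes s :: real
  assumes s: "s \<in> {1, -1}" and x: "-1 < x" "x < 1"
  shows "Lim (at (complex_of_real x) within {z. s * Im z > 0}) (legendreQ \<nu> \<mu>) =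
    legendreQ_boundary \<nu> \<mu> s (Arccos x)"
proof (rule tendsto_Lim[OF at_within_half_plane_neq_bot[OF s]])
  have xD: "complex_of_real x \<in> D1" using x by (simp add: mem_D1_iff)
  have "open {\<theta>. 0 < Re \<theta> \<and> Re \<theta> < pi}"
    by (intro open_Collect_conj open_Collect_less continuous_intros)
  then have "(legendreQ_boundary \<nu> \<mu> s \<circ> Arccos) holomorphic_on D1"
    using Re_Arccos_D1
    by (intro holomorphic_on_compose_gen[OF holomorphic_Arccos_D1 holomorphic_legendreQ_boundary[OF s]]) auto
  then have "isCont (legendreQ_boundary \<nu> \<mu> s \<circ> Arccos) x"
    using open_D1 xD by (meson continuous_on_eq_continuous_at holomorphic_on_imp_continuous_on)
  then have "((\<lambda>z. legendreQ_boundary \<nu> \<mu> s (Arccos z)) \<longlongrightarrow> legendreQ_boundary \<nu> \<mu> s (Arccos x))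
      (at (complex_of_real x) within {z. s * Im z > 0})"
    unfolding isCont_def o_def by (rule tendsto_within_subset) simp
  moreover have "\<forall>\<^sub>F z in at (complex_of_real x) within {z. s * Im z > 0}.
      legendreQ_boundary \<nu> \<mu> s (Arccos z) = legendreQ \<nu> \<mu> z"
    unfolding eventually_at_filter
  proof (rule always_eventually, intro allI impI)
    fix z assume "z \<in> {z. s * Im z > 0}"
    then have z: "s * Im z > 0" by simp
    then have "z \<in> D1" by (auto simp: mem_D1_iff)
    note * = Re_Arccos_D1[OF this]
    have "s * Im (Arccos z) < 0" using Im_cos_signed[OF * s] z by simp
    from legendreQ_cos[OF s * this, of \<nu> \<mu>]
    show "legendreQ_boundary \<nu> \<mu> s (Arccos z) = legendreQ \<nu> \<mu> z" by simp
  qed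
  ultimately show "(legendreQ \<nu> \<mu> \<longlongrightarrow> legendreQ_boundary \<nu> \<mu> s (Arccos x))
      (at (complex_of_real x) within {z. s * Im z > 0})"
    by (rule Lim_transform_eventually)
qed

section \<open>The Ferrers function in terms of the angle\<close>

definition ferrersQ_theta :: "complex \<Rightarrow> complex \<Rightarrow> complex \<Rightarrow> complex" where
  "ferrersQ_theta \<nu> \<mu> \<theta> =
     1 / 2 * (exp (- (1 / 2) * \<i> * of_real pi * \<mu>) * exp (- \<i> * of_real pi * \<mu>) * legendreQ_boundary \<nu> \<mu> 1 \<theta>
       + exp (1 / 2 * \<i> * of_real pi * \<mu>) * exp (- \<i> * of_real pi * \<mu>) * legendreQ_boundary \<nu> \<mu> (- 1) \<theta>)"

lemma ferrersQ_real_eq: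
  assumes "-1 < x" "x < 1"
  shows "ferrersQ_real \<nu> \<mu> x = ferrersQ_theta \<nu> \<mu> (Arccos x)"
  using Lim_legendreQ[of 1 x \<nu> \<mu>] Lim_legendreQ[of "- 1" x \<nu> \<mu>] assms
  by (simp add: ferrersQ_real_def ferrersQ_theta_def upper_limit_def lower_limit_def)

text \<open>\<open>ferrersQ_theta\<close> composed with \<open>Arccos\<close> is the candidate for
  the choice in \<open>ferrersQ\<close>; it agrees with the chosen function on (-1, 1), which
  accumulates at 0 inside \<open>D1\<close>.\<close>

lemma ferrersQ_cos:
  assumes \<theta>: "0 < Re \<theta>" "Re \<theta> < pi"
  shows "ferrersQ \<nu> \<mu> (cos \<theta>) = ferrersQ_theta \<nu> \<mu> \<theta>"
proof -
  let ?P = "\<lambda>F. F holomorphic_on D1 \<and> (\<forall>x\<in>{-1<..<1}. F (complex_of_real x) = ferrersQ_real \<nu> \<mu> x)"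
  define G where "G = (\<lambda>z. ferrersQ_theta \<nu> \<mu> (Arccos z))"
  have "ferrersQ_theta \<nu> \<mu> holomorphic_on {\<theta>. 0 < Re \<theta> \<and> Re \<theta> < pi}"
    unfolding ferrersQ_theta_def
    by (intro holomorphic_on_add holomorphic_on_mult holomorphic_on_const holomorphic_legendreQ_boundary) auto
  then have "(ferrersQ_theta \<nu> \<mu> \<circ> Arccos) holomorphic_on D1"
    using Re_Arccos_D1 by (intro holomorphic_on_compose_gen[OF holomorphic_Arccos_D1]) auto
  then have G: "?P G" by (simp add: G_def o_def ferrersQ_real_eq)
  then have Q: "?P (ferrersQ \<nu> \<mu>)"
    unfolding ferrersQ_def by (rule someI[of ?P])
  have "cos \<theta> \<in> D1"
  proof -
    have "\<bar>Re (cos \<theta>)\<bar> < 1" if "Im (cos \<theta>) = 0"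
    proof -
      have s: "sin (Re \<theta>) > 0" using \<theta> by (rule sin_gt_zero)
      then have "Im \<theta> = 0" using that by (simp add: Im_cos)
      then have "Re (cos \<theta>) = cos (Re \<theta>)" by (simp add: Re_cos)
      moreover have "(cos (Re \<theta>))\<^sup>2 < 1" using s by (simp add: cos_squared_eq)
      ultimately show ?thesis by (simp add: abs_square_less_1)
    qed
    then show ?thesis by (simp add: mem_D1_iff)
  qed
  then have "ferrersQ \<nu> \<mu> (cos \<theta>) - G (cos \<theta>) = 0"
  proof (rule analytic_continuation[where U = "complex_of_real ` {-1<..<1}" and \<xi> = 0, rotated -1])
    show "(\<lambda>z. ferrersQ \<nu> \<mu> z - G z) holomorphic_on D1" using G Q by (intro holomorphic_on_diff) auto
    show "0 islimpt complex_of_real ` {-1<..<1}"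
      unfolding islimpt_approachable
    proof (intro allI impI)
      fix e :: real assume "e > 0"
      then show "\<exists>z\<in>complex_of_real ` {-1<..<1}. z \<noteq> 0 \<and> dist z 0 < e"
        by (intro bexI[of _ "complex_of_real (min (e / 2) (1 / 2))"]) (auto simp: min_def)
    qed
  qed (use G Q open_D1 connected_D1 in \<open>auto simp: mem_D1_iff\<close>)
  moreover have "Arccos (cos \<theta>) = \<theta>" using \<theta> by (intro Arccos_cos) auto
  ultimately show ?thesis by (simp add: G_def)
qed

section \<open>Expansion of the Ferrers function\<close>

text \<open>Call the sides H s and T s'. Pfaff's transformation with exponent m + 1/2 gives H s = T
  (-s). With exponent n + m + 1 it gives H s = H (-s), because m + 1/2 equals its own reflection c -
  (m + 1/2) for c = 1 + 2m. So all four expressions coincide.\<close>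

lemma hyp2F1_reg_even:
  fixes s s' :: real and m n \<theta> :: complex
  assumes s: "s \<in> {1, -1}" "s' \<in> {1, -1}" and \<theta>: "0 < Re \<theta>" "Re \<theta> < pi / 2"
  shows "exp (- \<i> * s * \<theta> * (n + m + 1)) * hyp2F1_reg (n + m + 1) (m + 1 / 2) (1 + 2 * m) (1 - exp (- 2 * \<i> * s * \<theta>)) =
    exp (\<i> * s' * (n - m) * \<theta>) * hyp2F1_reg (1 / 2 + m) (m - n) (1 + 2 * m) (1 - exp (- 2 * \<i> * s' * \<theta>))"
proof -
  define H where "H = (\<lambda>s::real. exp (- \<i> * s * \<theta> * (n + m + 1)) *
    hyp2F1_reg (n + m + 1) (m + 1 / 2) (1 + 2 * m) (1 - exp (- 2 * \<i> * s * \<theta>)))"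
  define T where "T = (\<lambda>s::real. exp (\<i> * s * (n - m) * \<theta>) *
    hyp2F1_reg (1 / 2 + m) (m - n) (1 + 2 * m) (1 - exp (- 2 * \<i> * s * \<theta>)))"
  have Pfaff: "hyp2F1_reg a b c (1 - exp (- 2 * \<i> * s * \<theta>)) =
      exp (2 * \<i> * s * \<theta> * b) * hyp2F1_reg (c - a) b c (1 - exp (- 2 * \<i> * (- s) * \<theta>))"
    if s: "s \<in> {1, -1}" for a b c and s :: real
  proof -
    define u where "u = exp (- 2 * \<i> * s * \<theta>)"
    \<comment> \<open>Re theta < pi/2 makes -2 i s theta the principal logarithm of u.\<close>
    have Im: "\<bar>Im (- 2 * \<i> * s * \<theta>)\<bar> < pi" using s \<theta> by auto
    have cut: "1 - u \<in> cut_plane"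
      using exp_not_nonpos_Real[OF Im] by (simp add: mem_cut_plane_iff u_def)
    have "Ln u = - 2 * \<i> * s * \<theta>" unfolding u_def using Im by (intro Ln_exp) auto
    moreover have u0: "u \<noteq> 0" by (simp add: u_def)
    ultimately have p: "u powr - b = exp (2 * \<i> * s * \<theta> * b)"
      by (simp add: powr_def mult_ac)
    have "(1 - u) / (1 - u - 1) = 1 - inverse u" using u0 by (simp add: field_simps)
    also have "inverse u = exp (- 2 * \<i> * (- s) * \<theta>)" by (simp add: u_def exp_minus)
    finally have q: "(1 - u) / (1 - u - 1) = 1 - exp (- 2 * \<i> * (- s) * \<theta>)" .
    show ?thesis
      using hyp2F1_reg_Pfaff[OF cut, of a b c] unfolding q u_def[symmetric] by (simp add: p)
  qed
  have HT: "H s = T (- s)" if s: "s \<in> {1, -1}" for s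
  proof -
    have c: "1 + 2 * m - (n + m + 1) = m - n" by simp
    have "H s = exp (- \<i> * s * \<theta> * (n + m + 1)) * exp (2 * \<i> * s * \<theta> * (m + 1 / 2)) *
        hyp2F1_reg (m - n) (m + 1 / 2) (1 + 2 * m) (1 - exp (- 2 * \<i> * (- s) * \<theta>))"
      unfolding H_def Pfaff[OF s] c by (simp only: mult.assoc)
    also have "exp (- \<i> * s * \<theta> * (n + m + 1)) * exp (2 * \<i> * s * \<theta> * (m + 1 / 2)) =
        exp (\<i> * (- s) * (n - m) * \<theta>)"
      unfolding exp_add[symmetric] by (simp add: algebra_simps)
    finally show ?thesis
      unfolding T_def by (subst hyp2F1_reg_commute) (simp add: add.commute)
  qed
  have HH: "H s = H (- s)" if s: "s \<in> {1, -1}" for s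
  proof -
    have c: "1 + 2 * m - (m + 1 / 2) = m + 1 / 2" by (simp add: field_simps)
    have "H s = exp (- \<i> * s * \<theta> * (n + m + 1)) * exp (2 * \<i> * s * \<theta> * (n + m + 1)) *
        hyp2F1_reg (m + 1 / 2) (n + m + 1) (1 + 2 * m) (1 - exp (- 2 * \<i> * (- s) * \<theta>))"
      unfolding H_def hyp2F1_reg_commute[of "n + m + 1"] Pfaff[OF s] c by (simp only: mult.assoc)
    also have "exp (- \<i> * s * \<theta> * (n + m + 1)) * exp (2 * \<i> * s * \<theta> * (n + m + 1)) =
        exp (- \<i> * (- s) * \<theta> * (n + m + 1))"
      unfolding exp_add[symmetric] by (simp add: algebra_simps)
    finally show ?thesis
      unfolding H_def by (subst hyp2F1_reg_commute) simp
  qed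
  have "H s = T s'"
    using HT[of 1] HT[of "- 1"] HH[of 1] s by auto
  then show ?thesis by (simp only: H_def T_def)
qed

text \<open>The base is 2 exp (-i s theta) (i s) sin theta with i s = exp (i s pi / 2). Both s (pi/2
  - Re theta) and the argument of sin theta are below pi/2 in modulus, so the logarithms add up to
  the principal one.\<close>

lemma one_minus_exp_powr:
  fixes s :: real
  assumes s: "s \<in> {1, -1}" and \<theta>: "0 < Re \<theta>" "Re \<theta> < pi / 2"
  shows "(1 - exp (- 2 * \<i> * s * \<theta>)) powr k =
    exp (- \<i> * s * \<theta> * k) * 2 powr k * sin \<theta> powr k * exp (\<i> * s * pi * k / 2)"
proof -
  have sin: "Re (sin \<theta>) > 0" using \<theta> pi_gt_zero by (intro Re_sin_pos) linarith+
  then have sin0: "sin \<theta> \<noteq> 0" by auto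
  define W where "W = - \<i> * s * \<theta> + of_real (ln 2) + Ln (sin \<theta>) + \<i> * s * pi / 2"
  have "exp (\<i> * s * pi / 2) = cis (s * pi / 2)" by (simp add: cis_conv_exp mult_ac)
  also have "\<dots> = \<i> * s" using s by (auto simp: complex_eq_iff)
  finally have "exp W = 2 * exp (- \<i> * s * \<theta>) * (\<i> * s * sin \<theta>)"
    unfolding W_def exp_add using sin0 by (simp add: exp_of_real)
  also have "2 * (\<i> * s * sin \<theta>) = exp (\<i> * s * \<theta>) - exp (- \<i> * s * \<theta>)"
    using s by (auto simp: sin_exp_eq field_simps)
  then have "2 * exp (- \<i> * s * \<theta>) * (\<i> * s * sin \<theta>) =
      exp (- \<i> * s * \<theta>) * (exp (\<i> * s * \<theta>) - exp (- \<i> * s * \<theta>))"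
    by (simp add: mult_ac)
  also have "\<dots> = 1 - exp (- 2 * \<i> * s * \<theta>)"
    unfolding right_diff_distrib exp_add[symmetric] by (simp add: mult_ac)
  finally have eW: "exp W = 1 - exp (- 2 * \<i> * s * \<theta>)" .
  have "\<bar>Im (Ln (sin \<theta>))\<bar> < pi / 2" using sin Re_Ln_pos_lt[OF sin0] by simp
  then have "Ln (1 - exp (- 2 * \<i> * s * \<theta>)) = W"
    unfolding eW[symmetric] using s \<theta> by (intro Ln_exp) (auto simp: W_def)
  moreover have "1 - exp (- 2 * \<i> * s * \<theta>) \<noteq> 0" unfolding eW[symmetric] by simp
  ultimately have "(1 - exp (- 2 * \<i> * s * \<theta>)) powr k = exp (k * W)"
    by (simp add: powr_def)
  also have "k * W = - \<i> * s * \<theta> * k + k * Ln 2 + k * Ln (sin \<theta>) + \<i> * s * pi * k / 2"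
    using Ln_of_real[of 2] by (simp add: W_def algebra_simps)
  also have "exp \<dots> = exp (- \<i> * s * \<theta> * k) * exp (k * Ln 2) * exp (k * Ln (sin \<theta>)) * exp (\<i> * s * pi * k / 2)"
    by (simp only: exp_add)
  finally have "(1 - exp (- 2 * \<i> * s * \<theta>)) powr k =
      exp (- \<i> * s * \<theta> * k) * exp (k * Ln 2) * exp (k * Ln (sin \<theta>)) * exp (\<i> * s * pi * k / 2)" .
  moreover have "(2::complex) powr k = exp (k * Ln 2)" "sin \<theta> powr k = exp (k * Ln (sin \<theta>))"
    using sin0 by (simp_all add: powr_def)
  ultimately show ?thesis by (simp only:)
qed

text \<open>The exponential prefactor is distributed so that \<open>hyp2F1_reg_even\<close> applies
  to the first solution with m = mu and, after absorbing part of (1 - u)^(-2 mu), to the second with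
  m = -mu. The phase exp (-i s pi mu) is all of s that survives on the right.\<close>

lemma legendreQ_boundary_connection:
  fixes s s' :: real and \<nu> \<mu> \<theta> :: complex
  assumes s: "s \<in> {1, -1}" "s' \<in> {1, -1}" and \<theta>: "0 < Re \<theta>" "Re \<theta> < pi / 2" and \<mu>: "2 * \<mu> \<notin> \<int>"
  shows "rGamma (- 2 * \<mu>) * rGamma (1 + 2 * \<mu>) * (exp (- \<i> * s * \<theta> * (\<nu> + \<mu> + 1)) *
      hyp2F1_reg (\<nu> + \<mu> + 1) (\<mu> + 1 / 2) (\<nu> + 3 / 2) (exp (- 2 * \<i> * s * \<theta>))) =
    rGamma (1 / 2 - \<mu>) * rGamma (\<nu> - \<mu> + 1) *
      (exp (\<i> * s' * (\<nu> - \<mu>) * \<theta>) * hyp2F1_reg (1 / 2 + \<mu>) (\<mu> - \<nu>) (1 + 2 * \<mu>) (1 - exp (- 2 * \<i> * s' * \<theta>))) -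
    rGamma (\<nu> + \<mu> + 1) * rGamma (\<mu> + 1 / 2) * (2 powr (- 2 * \<mu>) * sin \<theta> powr (- 2 * \<mu>)) * exp (- \<i> * s * pi * \<mu>) *
      (exp (\<i> * s' * (\<nu> + \<mu>) * \<theta>) * hyp2F1_reg (1 / 2 - \<mu>) (- \<nu> - \<mu>) (1 - 2 * \<mu>) (1 - exp (- 2 * \<i> * s' * \<theta>)))"
proof -
  define u where "u = exp (- 2 * \<i> * s * \<theta>)"
  have Im: "\<bar>Im (- 2 * \<i> * s * \<theta>)\<bar> < pi" "0 < \<bar>Im (- 2 * \<i> * s * \<theta>)\<bar>" using s \<theta> by auto
  have u: "u \<in> doubly_cut_plane"
    using exp_not_nonpos_Real[OF Im(1)] exp_mem_cut_plane[OF Im(2)] Im(1)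
    by (auto simp: doubly_cut_plane_def mem_cut_plane_iff u_def)
  define a b c where "a = \<nu> + \<mu> + 1" and "b = \<mu> + 1 / 2" and "c = \<nu> + 3 / 2"
  have ca: "c - a = 1 / 2 - \<mu>" "c - b = \<nu> - \<mu> + 1" "c - a - b = - 2 * \<mu>"
    by (simp_all add: a_def b_def c_def field_simps)
  have "- 2 * \<mu> \<notin> \<int>" using \<mu> Ints_minus[of "- 2 * \<mu>"] by auto
  then have "rGamma (- 2 * \<mu>) * rGamma (1 - - 2 * \<mu>) * hyp2F1_reg a b c u =
     rGamma (1 / 2 - \<mu>) * rGamma (\<nu> - \<mu> + 1) * hyp2F1_reg a b (1 - - 2 * \<mu>) (1 - u) -
     rGamma a * rGamma b * ((1 - u) powr (- 2 * \<mu>) * hyp2F1_reg (1 / 2 - \<mu>) (\<nu> - \<mu> + 1) (1 + - 2 * \<mu>) (1 - u))"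
    using hyp2F1_reg_connection[of c a b u] u unfolding ca(3) unfolding ca(1,2) by blast
  then have conn: "rGamma (- 2 * \<mu>) * rGamma (1 + 2 * \<mu>) * hyp2F1_reg a b c u =
     rGamma (1 / 2 - \<mu>) * rGamma (\<nu> - \<mu> + 1) * hyp2F1_reg a b (1 + 2 * \<mu>) (1 - u) -
     rGamma a * rGamma b * ((1 - u) powr (- 2 * \<mu>) * hyp2F1_reg (1 / 2 - \<mu>) (\<nu> - \<mu> + 1) (1 - 2 * \<mu>) (1 - u))"
    by simp
  define E where "E = exp (- \<i> * s * \<theta> * a)"
  have 1: "E * hyp2F1_reg a b (1 + 2 * \<mu>) (1 - u) =
      exp (\<i> * s' * (\<nu> - \<mu>) * \<theta>) * hyp2F1_reg (1 / 2 + \<mu>) (\<mu> - \<nu>) (1 + 2 * \<mu>) (1 - exp (- 2 * \<i> * s' * \<theta>))"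
    unfolding E_def a_def b_def u_def by (rule hyp2F1_reg_even[OF s \<theta>])
  have "exp (- \<i> * s * \<theta> * (\<nu> + - \<mu> + 1)) * hyp2F1_reg (\<nu> + - \<mu> + 1) (- \<mu> + 1 / 2) (1 + 2 * - \<mu>) (1 - u) =
      exp (\<i> * s' * (\<nu> - - \<mu>) * \<theta>) * hyp2F1_reg (1 / 2 + - \<mu>) (- \<mu> - \<nu>) (1 + 2 * - \<mu>) (1 - exp (- 2 * \<i> * s' * \<theta>))"
    unfolding u_def by (rule hyp2F1_reg_even[OF s \<theta>])
  moreover have "hyp2F1_reg (\<nu> + - \<mu> + 1) (- \<mu> + 1 / 2) (1 + 2 * - \<mu>) = hyp2F1_reg (1 / 2 - \<mu>) (\<nu> - \<mu> + 1) (1 - 2 * \<mu>)"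
    by (subst hyp2F1_reg_commute) simp
  moreover have "- \<mu> - \<nu> = - \<nu> - \<mu>" by simp
  ultimately have 2: "exp (- \<i> * s * \<theta> * (\<nu> - \<mu> + 1)) * hyp2F1_reg (1 / 2 - \<mu>) (\<nu> - \<mu> + 1) (1 - 2 * \<mu>) (1 - u) =
      exp (\<i> * s' * (\<nu> + \<mu>) * \<theta>) * hyp2F1_reg (1 / 2 - \<mu>) (- \<nu> - \<mu>) (1 - 2 * \<mu>) (1 - exp (- 2 * \<i> * s' * \<theta>))"
    by simp
  have "E * (1 - u) powr (- 2 * \<mu>) = (E * exp (- \<i> * s * \<theta> * (- 2 * \<mu>))) *
      (2 powr (- 2 * \<mu>) * sin \<theta> powr (- 2 * \<mu>)) * exp (\<i> * s * pi * (- 2 * \<mu>) / 2)"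
    unfolding u_def one_minus_exp_powr[OF s(1) \<theta>] by (simp only: mult_ac)
  also have "E * exp (- \<i> * s * \<theta> * (- 2 * \<mu>)) = exp (- \<i> * s * \<theta> * (\<nu> - \<mu> + 1))"
    unfolding E_def exp_add[symmetric] by (simp add: a_def algebra_simps)
  also have "\<i> * s * pi * (- 2 * \<mu>) / 2 = - \<i> * s * pi * \<mu>" by simp
  finally have 3: "E * (1 - u) powr (- 2 * \<mu>) = exp (- \<i> * s * \<theta> * (\<nu> - \<mu> + 1)) *
      (2 powr (- 2 * \<mu>) * sin \<theta> powr (- 2 * \<mu>)) * exp (- \<i> * s * pi * \<mu>)" .
  have "rGamma (- 2 * \<mu>) * rGamma (1 + 2 * \<mu>) * (E * hyp2F1_reg a b c u) =
     E * (rGamma (- 2 * \<mu>) * rGamma (1 + 2 * \<mu>) * hyp2F1_reg a b c u)" by simp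
  also have "\<dots> = rGamma (1 / 2 - \<mu>) * rGamma (\<nu> - \<mu> + 1) * (E * hyp2F1_reg a b (1 + 2 * \<mu>) (1 - u)) -
     rGamma a * rGamma b * ((E * (1 - u) powr (- 2 * \<mu>)) * hyp2F1_reg (1 / 2 - \<mu>) (\<nu> - \<mu> + 1) (1 - 2 * \<mu>) (1 - u))"
    unfolding conn by (simp add: right_diff_distrib mult_ac)
  also have "\<dots> = rGamma (1 / 2 - \<mu>) * rGamma (\<nu> - \<mu> + 1) * (E * hyp2F1_reg a b (1 + 2 * \<mu>) (1 - u)) -
     rGamma a * rGamma b * (2 powr (- 2 * \<mu>) * sin \<theta> powr (- 2 * \<mu>)) * exp (- \<i> * s * pi * \<mu>) *
     (exp (- \<i> * s * \<theta> * (\<nu> - \<mu> + 1)) * hyp2F1_reg (1 / 2 - \<mu>) (\<nu> - \<mu> + 1) (1 - 2 * \<mu>) (1 - u))"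
    unfolding 3 by (simp add: mult_ac)
  finally show ?thesis
    unfolding 1 2 by (simp only: E_def a_def b_def c_def u_def)
qed

text \<open>In the sum of the two boundary values the phases give 2 cos (pi mu). Legendre's
  duplication formula at -mu and mu then converts the quotients of Gamma functions at 2 mu and 1/2
  into \<open>Gamma (- \<mu>)\<close> and \<open>Gamma \<mu>\<close>, with the powers of
  two.\<close>

lemma ferrersQ_theta_expansion:
  fixes s :: real and \<nu> \<mu> \<theta> :: complex
  assumes s: "s \<in> {1, -1}" and \<theta>: "0 < Re \<theta>" "Re \<theta> < pi / 2" and \<mu>: "2 * \<mu> \<notin> \<int>"
    and \<nu>\<mu>: "\<nu> + \<mu> + 1 \<notin> \<int>\<^sub>\<le>\<^sub>0"
  shows "ferrersQ_theta \<nu> \<mu> \<theta> =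
     Gamma (- \<mu>) / 2 powr (\<mu> + 1) * (Gamma (\<nu> + \<mu> + 1) * rGamma (\<nu> - \<mu> + 1)) * sin \<theta> powr \<mu> *
       exp (\<i> * s * (\<nu> - \<mu>) * \<theta>) *
       (Gamma (1 + 2 * \<mu>) * hyp2F1_reg (1 / 2 + \<mu>) (\<mu> - \<nu>) (1 + 2 * \<mu>) (1 - exp (- 2 * \<i> * s * \<theta>)))
     + 2 powr (\<mu> - 1) * Gamma \<mu> * (cos (of_real pi * \<mu>) * exp (\<i> * s * (\<nu> + \<mu>) * \<theta>) / sin \<theta> powr \<mu>) *
       (Gamma (1 - 2 * \<mu>) * hyp2F1_reg (1 / 2 - \<mu>) (- \<nu> - \<mu>) (1 - 2 * \<mu>) (1 - exp (- 2 * \<i> * s * \<theta>)))"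
proof -
  define T1 where "T1 = exp (\<i> * s * (\<nu> - \<mu>) * \<theta>) * hyp2F1_reg (1 / 2 + \<mu>) (\<mu> - \<nu>) (1 + 2 * \<mu>) (1 - exp (- 2 * \<i> * s * \<theta>))"
  define T2 where "T2 = exp (\<i> * s * (\<nu> + \<mu>) * \<theta>) * hyp2F1_reg (1 / 2 - \<mu>) (- \<nu> - \<mu>) (1 - 2 * \<mu>) (1 - exp (- 2 * \<i> * s * \<theta>))"
  define B where "B = (\<lambda>s::real. exp (- \<i> * s * \<theta> * (\<nu> + \<mu> + 1)) *
      hyp2F1_reg (\<nu> + \<mu> + 1) (\<mu> + 1 / 2) (\<nu> + 3 / 2) (exp (- 2 * \<i> * s * \<theta>)))"
  define S where "S = sin \<theta> powr \<mu>"
  define p where "p = (2::complex) powr \<mu>"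
  have "Re (sin \<theta>) > 0" using \<theta> pi_gt_zero by (intro Re_sin_pos) linarith+
  then have S0: "S \<noteq> 0" by (auto simp: S_def powr_def)
  have p0: "p \<noteq> 0" by (simp add: p_def)
  have S2: "sin \<theta> powr (- 2 * \<mu>) = 1 / (S * S)" "(2::complex) powr (- 2 * \<mu>) = 1 / (p * p)"
  proof -
    have "x powr (- 2 * \<mu>) = 1 / (x powr \<mu> * x powr \<mu>)" for x :: complex
      unfolding powr_add[symmetric] by (simp add: powr_minus_divide flip: mult_2)
    then show "sin \<theta> powr (- 2 * \<mu>) = 1 / (S * S)" "(2::complex) powr (- 2 * \<mu>) = 1 / (p * p)"
      by (simp_all only: S_def p_def)
  qed
  define A where "A = rGamma (- 2 * \<mu>) * rGamma (1 + 2 * \<mu>)"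
  have sum_B: "A * (B 1 + B (- 1)) = 2 * rGamma (1 / 2 - \<mu>) * rGamma (\<nu> - \<mu> + 1) * T1
     - 2 * rGamma (\<nu> + \<mu> + 1) * rGamma (\<mu> + 1 / 2) / (p * p * S * S) * cos (of_real pi * \<mu>) * T2"
  proof -
    have conn: "A * B s' = rGamma (1 / 2 - \<mu>) * rGamma (\<nu> - \<mu> + 1) * T1
      - rGamma (\<nu> + \<mu> + 1) * rGamma (\<mu> + 1 / 2) * (1 / (p * p) * (1 / (S * S))) * exp (- \<i> * s' * pi * \<mu>) * T2"
      if s': "s' = 1 \<or> s' = - 1" for s'
      using legendreQ_boundary_connection[OF _ s \<theta> \<mu>, of s' \<nu>] s'
      unfolding A_def B_def T1_def T2_def S2 by simp
    have c2: "2 * cos (of_real pi * \<mu>) = exp (- \<i> * (1::real) * pi * \<mu>) + exp (- \<i> * (-1::real) * pi * \<mu>)"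
      by (simp add: cos_exp_eq mult.assoc)
    have collect: "(Y - X * e1 * T) + (Y - X * e2 * T) = 2 * Y - X * (e1 + e2) * T" for X Y e1 e2 T :: complex
      by (simp add: algebra_simps)
    have "A * (B 1 + B (- 1)) = A * B 1 + A * B (- 1)" by (rule distrib_left)
    also have "\<dots> = 2 * (rGamma (1 / 2 - \<mu>) * rGamma (\<nu> - \<mu> + 1) * T1) - rGamma (\<nu> + \<mu> + 1) * rGamma (\<mu> + 1 / 2) *
      (1 / (p * p) * (1 / (S * S))) * (2 * cos (of_real pi * \<mu>)) * T2"
      unfolding conn[OF disjI1[OF refl]] conn[OF disjI2[OF refl]] collect c2 ..
    also have "\<dots> = 2 * rGamma (1 / 2 - \<mu>) * rGamma (\<nu> - \<mu> + 1) * T1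
     - 2 * rGamma (\<nu> + \<mu> + 1) * rGamma (\<mu> + 1 / 2) / (p * p * S * S) * cos (of_real pi * \<mu>) * T2"
      by (simp add: mult_ac)
    finally show ?thesis .
  qed
  have ints: "- 2 * \<mu> \<notin> \<int>" "1 + 2 * \<mu> \<notin> \<int>" "\<mu> \<notin> \<int>" "- \<mu> \<notin> \<int>" "\<mu> + 1 / 2 \<notin> \<int>" "1 / 2 - \<mu> \<notin> \<int>"
  proof -
    have *: "2 * z \<in> \<int>" if "z \<in> \<int>" for z :: complex using that by (intro Ints_mult) auto
    show "- 2 * \<mu> \<notin> \<int>" "\<mu> \<notin> \<int>" "- \<mu> \<notin> \<int>" using \<mu> *[of \<mu>] *[of "- \<mu>"] Ints_minus[of "- 2 * \<mu>"] by auto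
    show "1 + 2 * \<mu> \<notin> \<int>" using \<mu> Ints_diff[of "1 + 2 * \<mu>" 1] by auto
    show "\<mu> + 1 / 2 \<notin> \<int>"
    proof
      assume "\<mu> + 1 / 2 \<in> \<int>"
      from Ints_diff[OF *[OF this] Ints_1] show False using \<mu> by (simp add: algebra_simps)
    qed
    show "1 / 2 - \<mu> \<notin> \<int>"
    proof
      assume "1 / 2 - \<mu> \<in> \<int>"
      from Ints_diff[OF Ints_1 *[OF this]] show False using \<mu> by (simp add: algebra_simps)
    qed
  qed
  have nonpos: "z \<notin> \<int>\<^sub>\<le>\<^sub>0" if "z \<notin> \<int>" for z :: complex
    using that nonpos_Ints_subset_Ints by blast
  have inv: "Gamma z * rGamma z = 1" if "z \<notin> \<int>\<^sub>\<le>\<^sub>0" for z :: complex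
    using that by (simp add: Gamma_def rGamma_eq_zero_iff)
  define q where "q = complex_of_real (sqrt pi)"
  have dup: "Gamma z * Gamma (z + 1 / 2) = 2 powr (1 - 2 * z) * q * Gamma (2 * z)" if "z \<notin> \<int>" "z + 1 / 2 \<notin> \<int>" for z
    using Gamma_legendre_duplication[of z] nonpos that Ln_of_real[of 2] by (simp add: q_def powr_def)
  have dup1: "q * Gamma (- 2 * \<mu>) * rGamma (1 / 2 - \<mu>) = Gamma (- \<mu>) / (2 * p * p)"
  proof -
    have "Gamma (- \<mu>) * Gamma (1 / 2 - \<mu>) = 2 powr (1 + 2 * \<mu>) * q * Gamma (- 2 * \<mu>)"
      using dup[of "- \<mu>"] ints by simp
    also have "(2::complex) powr (1 + 2 * \<mu>) = 2 * (p * p)"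
    proof -
      have "1 + 2 * \<mu> = 1 + (\<mu> + \<mu>)" by simp
      then show ?thesis by (simp only: p_def powr_add) simp
    qed
    finally have "2 * (p * p) * (q * Gamma (- 2 * \<mu>) * rGamma (1 / 2 - \<mu>)) =
        Gamma (- \<mu>) * (Gamma (1 / 2 - \<mu>) * rGamma (1 / 2 - \<mu>))" by (simp add: mult_ac)
    then have "2 * (p * p) * (q * Gamma (- 2 * \<mu>) * rGamma (1 / 2 - \<mu>)) = Gamma (- \<mu>)"
      unfolding inv[OF nonpos[OF ints(6)]] by simp
    moreover have "Z = G / (2 * p * p)" if "2 * (p * p) * Z = G" for Z G
      using that p0 by (auto simp: field_simps)
    ultimately show ?thesis by blast
  qed
  have dup2: "q * Gamma (2 * \<mu>) * rGamma (\<mu> + 1 / 2) = Gamma \<mu> * (p * p) / 2"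
  proof -
    have "Gamma \<mu> * Gamma (\<mu> + 1 / 2) = 2 powr (1 - 2 * \<mu>) * q * Gamma (2 * \<mu>)"
      using dup[of \<mu>] ints by simp
    also have "(2::complex) powr (1 - 2 * \<mu>) = 2 / (p * p)"
    proof -
      have "1 - 2 * \<mu> = 1 - (\<mu> + \<mu>)" by simp
      then show ?thesis by (simp only: p_def powr_diff powr_add) simp
    qed
    finally have d: "Gamma \<mu> * Gamma (\<mu> + 1 / 2) = 2 / (p * p) * q * Gamma (2 * \<mu>)" .
    have "2 / (p * p) * (q * Gamma (2 * \<mu>) * rGamma (\<mu> + 1 / 2)) =
        (2 / (p * p) * q * Gamma (2 * \<mu>)) * rGamma (\<mu> + 1 / 2)" by (simp only: mult.assoc)
    also have "\<dots> = Gamma \<mu> * (Gamma (\<mu> + 1 / 2) * rGamma (\<mu> + 1 / 2))"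
      unfolding d[symmetric] by (simp only: mult.assoc)
    finally have "2 / (p * p) * (q * Gamma (2 * \<mu>) * rGamma (\<mu> + 1 / 2)) =
        Gamma \<mu> * (Gamma (\<mu> + 1 / 2) * rGamma (\<mu> + 1 / 2))" .
    then have "2 / (p * p) * (q * Gamma (2 * \<mu>) * rGamma (\<mu> + 1 / 2)) = Gamma \<mu>"
      unfolding inv[OF nonpos[OF ints(5)]] by simp
    moreover have "Z = G * (p * p) / 2" if "2 / (p * p) * Z = G" for Z G
      using that p0 by (auto simp: field_simps)
    ultimately show ?thesis by blast
  qed
  have A_inv: "A * (Gamma (- 2 * \<mu>) * Gamma (1 + 2 * \<mu>)) = 1"
    using inv[OF nonpos[OF ints(1)]] inv[OF nonpos[OF ints(2)]] unfolding A_def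
    by (metis mult.assoc mult.commute mult.left_commute mult_1)
  \<comment> \<open>Turns the minus sign of the connection formula into a plus and produces
    \<open>Gamma (1 - 2 * \<mu>)\<close>, the factor that restores the unregularized function in the
    second term.\<close>
  have reflection: "Gamma (- 2 * \<mu>) * Gamma (1 + 2 * \<mu>) = - (Gamma (1 - 2 * \<mu>) * Gamma (2 * \<mu>))"
  proof -
    have "Gamma (1 + 2 * \<mu>) = 2 * \<mu> * Gamma (2 * \<mu>)"
      using Gamma_plus1[of "2 * \<mu>"] nonpos[OF \<mu>] by (simp add: add.commute)
    moreover have "Gamma (1 - 2 * \<mu>) = - 2 * \<mu> * Gamma (- 2 * \<mu>)"
      using Gamma_plus1[of "- 2 * \<mu>"] nonpos[OF ints(1)] by (simp add: add.commute)
    ultimately show ?thesis by simp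
  qed
  \<comment> \<open>The phases in the definition of the average cancel exp (i pi mu) and the
    boundary phases exp (i s pi mu / 2) exactly.\<close>
  have "ferrersQ_theta \<nu> \<mu> \<theta> = 1 / 2 * q * Gamma (\<nu> + \<mu> + 1) * p * S * (B 1 + B (- 1))"
  proof -
    define e where "e = exp (\<i> * of_real pi * \<mu>)"
    define h where "h = exp (1 / 2 * \<i> * of_real pi * \<mu>)"
    have e: "exp (- \<i> * of_real pi * \<mu>) = 1 / e" "exp (- (1 / 2) * \<i> * of_real pi * \<mu>) = 1 / h"
      "exp (\<i> * (1::real) * pi * \<mu> / 2) = h" "exp (\<i> * (-1::real) * pi * \<mu> / 2) = 1 / h"
      by (simp_all add: e_def h_def exp_minus inverse_eq_divide)
    have eh: "e \<noteq> 0" "h \<noteq> 0" by (auto simp: e_def h_def)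
    show ?thesis
      unfolding ferrersQ_theta_def legendreQ_boundary_def e
      unfolding h_def[symmetric] e_def[symmetric] q_def[symmetric] p_def[symmetric] S_def[symmetric]
      using eh by (simp add: B_def field_simps)
  qed
  also have "B 1 + B (- 1) = Gamma (- 2 * \<mu>) * Gamma (1 + 2 * \<mu>) * (A * (B 1 + B (- 1)))"
  proof -
    have "x = g * (y * x)" if "y * g = 1" for x y g :: complex
    proof -
      have "g * (y * x) = (y * g) * x" by (simp only: mult_ac)
      then show ?thesis by (simp add: that)
    qed
    then show ?thesis using A_inv .
  qed
  also have "1 / 2 * q * Gamma (\<nu> + \<mu> + 1) * p * S * \<dots> =
      (q * Gamma (- 2 * \<mu>) * rGamma (1 / 2 - \<mu>)) * Gamma (\<nu> + \<mu> + 1) * p * S * Gamma (1 + 2 * \<mu>) * rGamma (\<nu> - \<mu> + 1) * T1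
      - (Gamma (\<nu> + \<mu> + 1) * rGamma (\<nu> + \<mu> + 1)) * q * rGamma (\<mu> + 1 / 2) * (p * S / (p * p * S * S)) * cos (of_real pi * \<mu>) *
        (Gamma (- 2 * \<mu>) * Gamma (1 + 2 * \<mu>)) * T2"
    unfolding sum_B by (simp add: algebra_simps)
  also have "\<dots> = (Gamma (- \<mu>) / (2 * p * p)) * Gamma (\<nu> + \<mu> + 1) * p * S * Gamma (1 + 2 * \<mu>) * rGamma (\<nu> - \<mu> + 1) * T1
      + (q * Gamma (2 * \<mu>) * rGamma (\<mu> + 1 / 2)) * (p * S / (p * p * S * S)) * cos (of_real pi * \<mu>) * Gamma (1 - 2 * \<mu>) * T2"
    unfolding dup1 inv[OF \<nu>\<mu>] reflection by (simp add: mult_ac)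
  also have "\<dots> = Gamma (- \<mu>) / (2 * p) * Gamma (\<nu> + \<mu> + 1) * S * Gamma (1 + 2 * \<mu>) * rGamma (\<nu> - \<mu> + 1) * T1
      + p / 2 * Gamma \<mu> / S * cos (of_real pi * \<mu>) * Gamma (1 - 2 * \<mu>) * T2"
    unfolding dup2 using p0 S0 by simp
  finally have main: "ferrersQ_theta \<nu> \<mu> \<theta> =
      Gamma (- \<mu>) / (2 * p) * Gamma (\<nu> + \<mu> + 1) * S * Gamma (1 + 2 * \<mu>) * rGamma (\<nu> - \<mu> + 1) * T1
      + p / 2 * Gamma \<mu> / S * cos (of_real pi * \<mu>) * Gamma (1 - 2 * \<mu>) * T2" .
  have pw: "(2::complex) powr (\<mu> + 1) = 2 * p" "(2::complex) powr (\<mu> - 1) = p / 2"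
    by (simp_all add: p_def powr_add powr_diff)
  show ?thesis
    unfolding main T1_def T2_def S_def[symmetric] pw by (simp add: mult_ac)
qed

lemma ferrersQ_cos_expansion:
  fixes s \<nu> \<mu> \<theta> :: complex
  assumes s: "s \<in> {1, -1}" and \<theta>: "0 < Re \<theta>" "Re \<theta> < pi / 2" and \<mu>: "2 * \<mu> \<notin> \<int>"
    and \<nu>\<mu>: "\<nu> + \<mu> + 1 \<notin> \<int>\<^sub>\<le>\<^sub>0"
  shows "ferrersQ \<nu> \<mu> (cos \<theta>) =
        Gamma (- \<mu>) / 2 powr (\<mu> + 1) * (Gamma (\<nu> + \<mu> + 1) * rGamma (\<nu> - \<mu> + 1))
          * sin \<theta> powr \<mu> * exp (s * \<i> * (\<nu> - \<mu>) * \<theta>)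
          * hyp2F1 (1 / 2 + \<mu>) (\<mu> - \<nu>) (1 + 2 * \<mu>) (1 - exp (- s * 2 * \<i> * \<theta>))
        + 2 powr (\<mu> - 1) * Gamma \<mu>
          * (cos (of_real pi * \<mu>) * exp (s * \<i> * (\<nu> + \<mu>) * \<theta>) / sin \<theta> powr \<mu>)
          * hyp2F1 (1 / 2 - \<mu>) (- \<nu> - \<mu>) (1 - 2 * \<mu>) (1 - exp (- s * 2 * \<i> * \<theta>))"
proof -
  \<comment> \<open>The theorem ranges over complex signs, whereas the lemmas on imaginary parts use
    real ones.\<close>
  define r where "r = Re s"
  have r: "r \<in> {1, -1}" "s = of_real r" using s by (auto simp: r_def)
  have e: "exp (- s * 2 * \<i> * \<theta>) = exp (- 2 * \<i> * r * \<theta>)"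
    "exp (s * \<i> * (\<nu> - \<mu>) * \<theta>) = exp (\<i> * r * (\<nu> - \<mu>) * \<theta>)"
    "exp (s * \<i> * (\<nu> + \<mu>) * \<theta>) = exp (\<i> * r * (\<nu> + \<mu>) * \<theta>)"
    by (simp_all add: r(2) mult_ac)
  have Im: "\<bar>Im (- 2 * \<i> * r * \<theta>)\<bar> < pi" using r(1) \<theta> by auto
  have cut: "1 - exp (- 2 * \<i> * r * \<theta>) \<in> cut_plane"
    using exp_not_nonpos_Real[OF Im] by (simp add: mem_cut_plane_iff)
  have "1 + 2 * \<mu> \<notin> \<int>" using \<mu> Ints_diff[of "1 + 2 * \<mu>" 1] by auto
  moreover have "1 - 2 * \<mu> \<notin> \<int>" using \<mu> Ints_diff[of 1 "1 - 2 * \<mu>"] by auto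
  ultimately have c: "1 + 2 * \<mu> \<notin> \<int>\<^sub>\<le>\<^sub>0" "1 - 2 * \<mu> \<notin> \<int>\<^sub>\<le>\<^sub>0"
    using nonpos_Ints_subset_Ints by blast+
  have "ferrersQ \<nu> \<mu> (cos \<theta>) = ferrersQ_theta \<nu> \<mu> \<theta>"
    using \<theta> pi_gt_zero by (intro ferrersQ_cos) linarith+
  then show ?thesis
    unfolding e hyp2F1_eq_Gamma_mult_reg[OF c(1) cut] hyp2F1_eq_Gamma_mult_reg[OF c(2) cut]
    using ferrersQ_theta_expansion[OF r(1) \<theta> \<mu> \<nu>\<mu>] by (simp only:)
qed

section \<open>Return from the angle to the variable x\<close>

lemma Arccos_D1_pos:
  assumes "x \<in> D1_pos"
  shows "0 < Re (Arccos x)" "Re (Arccos x) < pi / 2"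
proof -
  have x: "x \<in> D1" "0 < Re x" using assms by (auto simp: D1_pos_def)
  note b = Re_Arccos_D1[OF x(1)]
  then show "0 < Re (Arccos x)" by simp
  have "0 < Re (cos (Arccos x))" using x by simp
  moreover have "Re (cos (Arccos x)) = ((exp (Im (Arccos x)) + exp (- Im (Arccos x))) / 2) * cos (Re (Arccos x))"
    unfolding Re_cos by simp
  ultimately have "0 < ((exp (Im (Arccos x)) + exp (- Im (Arccos x))) / 2) * cos (Re (Arccos x))"
    by (simp only:)
  then have "0 < cos (Re (Arccos x))"
    by (rule zero_less_mult_pos) (simp add: add_pos_pos)
  then show "Re (Arccos x) < pi / 2"
    using b cos_monotone_0_pi_le[of "pi / 2" "Re (Arccos x)"] by (auto simp: not_less[symmetric])
qed

text \<open>Principal values agree because Re (sin theta) > 0 selects the square root and puts twice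
  its logarithm inside the principal strip, while s i theta has imaginary part below pi/2 in
  modulus.\<close>

lemma D1_pos_parametrization:
  fixes s k :: complex
  assumes s: "s \<in> {1, -1}" and \<theta>: "0 < Re \<theta>" "Re \<theta> < pi / 2"
  shows "csqrt (1 - (cos \<theta>)\<^sup>2) = sin \<theta>"
    and "(1 - (cos \<theta>)\<^sup>2) powr (k / 2) = sin \<theta> powr k"
    and "(cos \<theta> + s * \<i> * sin \<theta>) powr k = exp (s * \<i> * k * \<theta>)"
    and "2 * \<i> * sin \<theta> / (s * cos \<theta> + \<i> * sin \<theta>) = 1 - exp (- s * 2 * \<i> * \<theta>)"
proof -
  have sin: "Re (sin \<theta>) > 0" using \<theta> pi_gt_zero by (intro Re_sin_pos) linarith+
  then have sin0: "sin \<theta> \<noteq> 0" by auto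
  have sq: "1 - (cos \<theta>)\<^sup>2 = (sin \<theta>)\<^sup>2" by (simp add: cos_squared_eq)
  show "csqrt (1 - (cos \<theta>)\<^sup>2) = sin \<theta>" unfolding sq using sin by (intro csqrt_square) auto
  have "\<bar>Im (Ln (sin \<theta>))\<bar> < pi / 2" using sin Re_Ln_pos_lt[OF sin0] by simp
  then have "Ln (exp (2 * Ln (sin \<theta>))) = 2 * Ln (sin \<theta>)" by (intro Ln_exp) auto
  moreover have "exp (2 * Ln (sin \<theta>)) = (sin \<theta>)\<^sup>2" using sin0 by (simp add: exp_double)
  ultimately have "Ln ((sin \<theta>)\<^sup>2) = 2 * Ln (sin \<theta>)" by simp
  then show "(1 - (cos \<theta>)\<^sup>2) powr (k / 2) = sin \<theta> powr k"
    unfolding sq using sin0 by (simp add: powr_def)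
  have e: "cos \<theta> + s * \<i> * sin \<theta> = exp (s * \<i> * \<theta>)"
    using s exp_Euler[of \<theta>] exp_Euler[of "- \<theta>"] by auto
  have "Ln (exp (s * \<i> * \<theta>)) = s * \<i> * \<theta>" using s \<theta> by (intro Ln_exp) auto
  then show "(cos \<theta> + s * \<i> * sin \<theta>) powr k = exp (s * \<i> * k * \<theta>)"
    unfolding e by (simp add: powr_def mult_ac)
  have ss: "s * s = 1" using s by auto
  have "s * cos \<theta> + \<i> * sin \<theta> = s * (cos \<theta> + s * \<i> * sin \<theta>)"
    using ss by (simp add: distrib_left flip: mult.assoc)
  then have d: "s * cos \<theta> + \<i> * sin \<theta> = s * exp (s * \<i> * \<theta>)" unfolding e .
  have "2 * \<i> * sin \<theta> = s * (exp (s * \<i> * \<theta>) - exp (- (s * \<i> * \<theta>)))"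
    using s by (auto simp: sin_exp_eq field_simps)
  also have "\<dots> = s * exp (s * \<i> * \<theta>) * (1 - exp (- s * 2 * \<i> * \<theta>))"
    unfolding right_diff_distrib mult.assoc exp_add[symmetric] by (simp add: algebra_simps)
  finally show "2 * \<i> * sin \<theta> / (s * cos \<theta> + \<i> * sin \<theta>) = 1 - exp (- s * 2 * \<i> * \<theta>)"
    unfolding d using s by auto
qed

theorem theorem5p3:
  fixes \<nu> \<mu> :: complex
  assumes "2 * \<mu> \<notin> \<int>"
    and "\<forall>n::nat. n \<ge> 1 \<longrightarrow> \<nu> + \<mu> \<noteq> - of_nat n"
  shows "(\<forall>x\<in>D1_pos. \<forall>s\<in>{1, -1}.
      ferrersQ \<nu> \<mu> x =
        Gamma (- \<mu>) / 2 powr (\<mu> + 1) * (Gamma (\<nu> + \<mu> + 1) * rGamma (\<nu> - \<mu> + 1))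
          * (1 - x\<^sup>2) powr (\<mu> / 2) * (x + s * \<i> * csqrt (1 - x\<^sup>2)) powr (\<nu> - \<mu>)
          * hyp2F1 (1 / 2 + \<mu>) (\<mu> - \<nu>) (1 + 2 * \<mu>)
              (2 * \<i> * csqrt (1 - x\<^sup>2) / (s * x + \<i> * csqrt (1 - x\<^sup>2)))
        + 2 powr (\<mu> - 1) * Gamma \<mu>
          * (cos (of_real pi * \<mu>) * (x + s * \<i> * csqrt (1 - x\<^sup>2)) powr (\<nu> + \<mu>)
             / (1 - x\<^sup>2) powr (\<mu> / 2))
          * hyp2F1 (1 / 2 - \<mu>) (- \<nu> - \<mu>) (1 - 2 * \<mu>)
              (2 * \<i> * csqrt (1 - x\<^sup>2) / (s * x + \<i> * csqrt (1 - x\<^sup>2))))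
    \<and> (\<forall>\<theta>. 0 < Re \<theta> \<and> Re \<theta> < pi / 2 \<longrightarrow> (\<forall>s\<in>{1, -1}.
      ferrersQ \<nu> \<mu> (cos \<theta>) =
        Gamma (- \<mu>) / 2 powr (\<mu> + 1) * (Gamma (\<nu> + \<mu> + 1) * rGamma (\<nu> - \<mu> + 1))
          * sin \<theta> powr \<mu> * exp (s * \<i> * (\<nu> - \<mu>) * \<theta>)
          * hyp2F1 (1 / 2 + \<mu>) (\<mu> - \<nu>) (1 + 2 * \<mu>) (1 - exp (- s * 2 * \<i> * \<theta>))
        + 2 powr (\<mu> - 1) * Gamma \<mu>
          * (cos (of_real pi * \<mu>) * exp (s * \<i> * (\<nu> + \<mu>) * \<theta>) / sin \<theta> powr \<mu>)
          * hyp2F1 (1 / 2 - \<mu>) (- \<nu> - \<mu>) (1 - 2 * \<mu>) (1 - exp (- s * 2 * \<i> * \<theta>))))"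
proof -
  have \<nu>\<mu>: "\<nu> + \<mu> + 1 \<notin> \<int>\<^sub>\<le>\<^sub>0"
  proof
    assume "\<nu> + \<mu> + 1 \<in> \<int>\<^sub>\<le>\<^sub>0"
    then obtain m where m: "\<nu> + \<mu> + 1 = - of_nat m" by (elim nonpos_Ints_cases')
    have "\<nu> + \<mu> = (\<nu> + \<mu> + 1) - 1" by simp
    also have "\<dots> = - of_nat (Suc m)" unfolding m by simp
    finally have "\<nu> + \<mu> = - of_nat (Suc m)" .
    with assms(2) show False by (metis Suc_le_eq zero_less_Suc One_nat_def)
  qed
  note expansion = ferrersQ_cos_expansion[OF _ _ _ assms(1) \<nu>\<mu>]
  show ?thesis
  proof (intro conjI allI ballI impI)
    fix x s :: complex assume x: "x \<in> D1_pos" and s: "s \<in> {1, -1}"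
    define \<theta> where "\<theta> = Arccos x"
    have \<theta>: "0 < Re \<theta>" "Re \<theta> < pi / 2" unfolding \<theta>_def by (rule Arccos_D1_pos[OF x])+
    have x_eq: "x = cos \<theta>" by (simp add: \<theta>_def)
    note param = D1_pos_parametrization[OF s \<theta>]
    show "ferrersQ \<nu> \<mu> x =
        Gamma (- \<mu>) / 2 powr (\<mu> + 1) * (Gamma (\<nu> + \<mu> + 1) * rGamma (\<nu> - \<mu> + 1))
          * (1 - x\<^sup>2) powr (\<mu> / 2) * (x + s * \<i> * csqrt (1 - x\<^sup>2)) powr (\<nu> - \<mu>)
          * hyp2F1 (1 / 2 + \<mu>) (\<mu> - \<nu>) (1 + 2 * \<mu>)
              (2 * \<i> * csqrt (1 - x\<^sup>2) / (s * x + \<i> * csqrt (1 - x\<^sup>2)))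
        + 2 powr (\<mu> - 1) * Gamma \<mu>
          * (cos (of_real pi * \<mu>) * (x + s * \<i> * csqrt (1 - x\<^sup>2)) powr (\<nu> + \<mu>)
             / (1 - x\<^sup>2) powr (\<mu> / 2))
          * hyp2F1 (1 / 2 - \<mu>) (- \<nu> - \<mu>) (1 - 2 * \<mu>)
              (2 * \<i> * csqrt (1 - x\<^sup>2) / (s * x + \<i> * csqrt (1 - x\<^sup>2)))" 
      unfolding x_eq param expansion[OF s \<theta>] ..
  next
    fix \<theta> s :: complex assume "0 < Re \<theta> \<and> Re \<theta> < pi / 2" and s: "s \<in> {1, -1}"
    then have \<theta>: "0 < Re \<theta>" "Re \<theta> < pi / 2" by auto
    show "ferrersQ \<nu> \<mu> (cos \<theta>) =
        Gamma (- \<mu>) / 2 powr (\<mu> + 1) * (Gamma (\<nu> + \<mu> + 1) * rGamma (\<nu> - \<mu> + 1))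
          * sin \<theta> powr \<mu> * exp (s * \<i> * (\<nu> - \<mu>) * \<theta>)
          * hyp2F1 (1 / 2 + \<mu>) (\<mu> - \<nu>) (1 + 2 * \<mu>) (1 - exp (- s * 2 * \<i> * \<theta>))
        + 2 powr (\<mu> - 1) * Gamma \<mu>
          * (cos (of_real pi * \<mu>) * exp (s * \<i> * (\<nu> + \<mu>) * \<theta>) / sin \<theta> powr \<mu>)
          * hyp2F1 (1 / 2 - \<mu>) (- \<nu> - \<mu>) (1 - 2 * \<mu>) (1 - exp (- s * 2 * \<i> * \<theta>))"
      by (rule expansion[OF s \<theta>])
  qed
qed

end
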